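(* Let $f:\Omega\to\mathbb{R}^3$, $\Omega=\{(u,v)\mid u^2+v^2<1\}$, be a finite piece of a smooth surface without umbilic points parametrized by curvature lines, and let $(u_0,v_0)\in\Omega$ be the initial point. For $\epsilon>0$ put $f_{ij}=f(u_0+i\epsilon,v_0+j\epsilon)$. Then for all sufficiently small $\epsilon>0$ there exists a discrete circular net $f^\epsilon=(f^\epsilon_{ij})$ with all its points $f^\epsilon_{ij}$ on $f(\Omega)$, such that $d(f_{ij},f^\epsilon_{ij})=O(\epsilon^2)$ as $\epsilon\to0$, uniformly in $i,j$.
   Context: A surface is parametrized by curvature lines if $f$ is a smooth immersion whose coordinate lines $u=\mathrm{const}$ and $v=\mathrm{const}$ are lines of curvature. "Finite piece" means that $f$ is smooth with these properties up to the boundary of $\Omega$. A discrete circular net is a map $(i,j)\mapsto f^\epsilon_{ij}\in\mathbb{R}^3$ from (a part of) $\mathbb{Z}^2$ such that the four vertices $f^\epsilon_{ij},f^\epsilon_{i+1,j},f^\epsilon_{i+1,j+1},f^\epsilon_{i,j+1}$ of each elementary quadrangle lie on a circle (in particular are coplanar); here the indices are those $(i,j)$ with $(u_0+i\epsilon,v_0+j\epsilon)\in\Omega$. $d$ denotes Euclidean distance. *)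

theory Defs
  imports "HOL-Analysis.Analysis"
begin

text \<open>\<open>Ck_on k f U\<close>, meant for open \<open>U\<close>: all iterated directional derivatives of \<open>f\<close> up to
  order \<open>k\<close> exist and are continuous on \<open>U\<close>.\<close>

primrec Ck_on :: "nat \<Rightarrow> ('a::real_normed_vector \<Rightarrow> 'b::real_normed_vector) \<Rightarrow> 'a set \<Rightarrow> bool" where
  "Ck_on 0 f U \<longleftrightarrow> continuous_on U f"
| "Ck_on (Suc k) f U \<longleftrightarrow>
     (\<forall>x\<in>U. f differentiable (at x)) \<and> (\<forall>w. Ck_on k (\<lambda>x. frechet_derivative f (at x) w) U)"

definition smooth_on :: "('a::real_normed_vector \<Rightarrow> 'b::real_normed_vector) \<Rightarrow> 'a set \<Rightarrow> bool" where
  "smooth_on f U \<longleftrightarrow> (\<forall>k. Ck_on k f U)"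

definition immersion_on :: "('a::real_normed_vector \<Rightarrow> 'b::real_normed_vector) \<Rightarrow> 'a set \<Rightarrow> bool" where
  "immersion_on f S \<longleftrightarrow> (\<forall>p\<in>S. f differentiable (at p) \<and> inj (frechet_derivative f (at p)))"

definition unit_normal :: "(real \<times> real \<Rightarrow> real^3) \<Rightarrow> real \<times> real \<Rightarrow> real^3" where
  "unit_normal f p =
     sgn (cross3 (frechet_derivative f (at p) (1, 0)) (frechet_derivative f (at p) (0, 1)))"

text \<open>The shape operator at \<open>p\<close> sends \<open>df(w)\<close> to \<open>-dN(w)\<close>, where \<open>N\<close> is the unit normal.
  Tangent vectors are represented by their coordinates \<open>w\<close> in the parameter plane, so
  \<open>df(w)\<close> is an eigenvector with principal curvature \<open>k\<close> iff \<open>w\<close> is nonzero and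
  \<open>-dN(w) = k df(w)\<close>.\<close>

definition principal_direction :: "(real \<times> real \<Rightarrow> real^3) \<Rightarrow> real \<times> real \<Rightarrow> real \<times> real \<Rightarrow> bool" where
  "principal_direction f p w \<longleftrightarrow> w \<noteq> 0 \<and>
     (\<exists>k. - frechet_derivative (unit_normal f) (at p) w = k *\<^sub>R frechet_derivative f (at p) w)"

text \<open>Umbilic: the shape operator is a multiple of the identity (planar points included).\<close>

definition umbilic :: "(real \<times> real \<Rightarrow> real^3) \<Rightarrow> real \<times> real \<Rightarrow> bool" where
  "umbilic f p \<longleftrightarrow>
     (\<exists>k. \<forall>w. - frechet_derivative (unit_normal f) (at p) w = k *\<^sub>R frechet_derivative f (at p) w)"

text \<open>The curve \<open>c\<close> runs in the parameter domain; the curve on the surface is \<open>f \<circ> c\<close>.\<close>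

definition line_of_curvature ::
  "(real \<times> real \<Rightarrow> real^3) \<Rightarrow> (real \<Rightarrow> real \<times> real) \<Rightarrow> real set \<Rightarrow> bool" where
  "line_of_curvature f c T \<longleftrightarrow>
     (\<forall>t\<in>T. principal_direction f (c t) (vector_derivative c (at t)))"

definition curvature_line_parametrized_on ::
  "(real \<times> real \<Rightarrow> real^3) \<Rightarrow> (real \<times> real) set \<Rightarrow> bool" where
  "curvature_line_parametrized_on f S \<longleftrightarrow>
     (\<forall>v. line_of_curvature f (\<lambda>t. (t, v)) {t. (t, v) \<in> S}) \<and>
     (\<forall>u. line_of_curvature f (\<lambda>t. (u, t)) {t. (u, t) \<in> S})"

text \<open>Smoothness up to the boundary of \<open>D\<close> means existence of a smooth extension \<open>g\<close> to a
  neighbourhood of the closure. For open \<open>D\<close>, the derivatives of \<open>g\<close> on the closure, hence the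
  other three conditions, do not depend on the choice of \<open>g\<close>.\<close>

definition finite_curvature_line_piece ::
  "(real \<times> real \<Rightarrow> real^3) \<Rightarrow> (real \<times> real) set \<Rightarrow> bool" where
  "finite_curvature_line_piece f D \<longleftrightarrow>
     (\<exists>g U. open U \<and> closure D \<subseteq> U \<and> smooth_on g U \<and> (\<forall>p\<in>D. g p = f p) \<and>
        immersion_on g (closure D) \<and>
        curvature_line_parametrized_on g (closure D) \<and>
        (\<forall>p\<in>closure D. \<not> umbilic g p))"

definition unit_disk :: "(real \<times> real) set" where
  "unit_disk = {(u, v). u\<^sup>2 + v\<^sup>2 < 1}"

definition is_circle :: "(real^3) set \<Rightarrow> bool" where
  "is_circle C \<longleftrightarrow> (\<exists>c n r. n \<noteq> 0 \<and> r > 0 \<and> C = {x. dist c x = r \<and> n \<bullet> (x - c) = 0})"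

definition circular_net :: "(int \<times> int) set \<Rightarrow> (int \<Rightarrow> int \<Rightarrow> real^3) \<Rightarrow> bool" where
  "circular_net I F \<longleftrightarrow>
     (\<forall>i j. {(i, j), (i + 1, j), (i + 1, j + 1), (i, j + 1)} \<subseteq> I \<longrightarrow>
        (\<exists>C. is_circle C \<and> {F i j, F (i + 1) j, F (i + 1) (j + 1), F i (j + 1)} \<subseteq> C))"

definition grid_point :: "real \<times> real \<Rightarrow> real \<Rightarrow> int \<Rightarrow> int \<Rightarrow> real \<times> real" where
  "grid_point p0 \<epsilon> i j = (fst p0 + of_int i * \<epsilon>, snd p0 + of_int j * \<epsilon>)"

definition grid_indices :: "(real \<times> real) set \<Rightarrow> real \<times> real \<Rightarrow> real \<Rightarrow> (int \<times> int) set" where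
  "grid_indices D p0 \<epsilon> = {(i, j). grid_point p0 \<epsilon> i j \<in> D}"

end

theory Submission
  imports Defs
begin

text \<open>
  Lift the surface to the paraboloid: \<open>H = (g, g \<bullet> g)\<close> maps into a four-dimensional space, and four points of
  the surface are concircular iff their lifts are coplanar. For a curvature line parametrization the lift
  is a conjugate net, \<open>H_uv = A H_u + B H_v\<close>, and without umbilics \<open>H_u, H_v, H_uu, H_vv\<close> is a frame.

  Given three vertices of a nearly rectangular parameter quadrilateral, the fourth one is determined by
  four equations in four unknowns (two coordinates, two multipliers). Write \<open>\<epsilon>\<^sup>2 \<xi>\<close>, \<open>\<epsilon>\<^sup>2 \<eta>\<close> for the displacements of
  the vertices from the grid and \<open>w = (\<xi>(i,j+1) - \<xi>(i,j)) / \<epsilon>\<close>, \<open>z = (\<eta>(i+1,j) - \<eta>(i,j)) / \<epsilon>\<close>. The equations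
  become \<open>w(i+1,j) = - w(i,j) + s + O(\<epsilon>)\<close> and \<open>z(i,j+1) = - z(i,j) + t + O(\<epsilon>)\<close> with Lipschitz functions \<open>s, t\<close> of the
  position. As the signs alternate, \<open>w - s/2\<close> and \<open>z - t/2\<close> stay bounded over the \<open>O(1/\<epsilon>)\<close> steps of the Goursat
  problem, hence so do \<open>\<xi>, \<eta>\<close>.
\<close>

section \<open>Smooth functions of two variables\<close>

text \<open>The four equations live on two scales. Once the leading multipliers are split off, the
  coefficients along \<open>H_u\<close>, \<open>H_v\<close> have size \<open>\<epsilon> ^ 3\<close>,
  those along \<open>H_uu\<close>, \<open>H_vv\<close> only \<open>\<epsilon> ^ 4\<close>, because
  the differentiated Laplace equation cancels the cubic terms there. Hence every expansion is
  carried to a remainder of order \<open>\<epsilon> ^ 5\<close>, although displacements of order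
  \<open>\<epsilon> ^ 2\<close> are sought. To leading order the pair along \<open>H_u\<close>,
  \<open>H_uu\<close> reads \<open>\<gamma> + w' - w - \<alpha>1 = 0\<close> and
  \<open>\<sigma> * (w' - \<alpha>1 / 2) + n3 = 0\<close>; eliminating the multiplier correction
  \<open>\<alpha>1\<close> turns \<open>w' - w\<close> into \<open>w' + w\<close>, which is the
  origin of the alternating sign. The factor -1 damps nothing, so each step may only add an error of
  \<open>\<epsilon>\<close> times a quantity linear in the data. This is why a size \<open>M\<close>
  of the data is tracked linearly through all estimates. The net grows from one crossing of two grid
  lines into four quadrants, hence the signs \<sigma> and \<tau>.\<close>

lemma Ck_on_cong:
  assumes "open U" "\<And>x. x \<in> U \<Longrightarrow> f x = g x" "Ck_on k f U"
  shows "Ck_on k g U"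
  using assms(2,3)
proof (induction k arbitrary: f g)
  case 0
  then show ?case using continuous_on_cong by force
next
  case (Suc k)
  have diff: "(g has_derivative frechet_derivative f (at x)) (at x)" if "x \<in> U" for x
  proof -
    have "(f has_derivative frechet_derivative f (at x)) (at x)"
      using Suc.prems(2) that by (simp add: frechet_derivative_works)
    then show ?thesis
      using has_derivative_transform_within_open[OF _ assms(1) that] Suc.prems(1) by blast
  qed
  have eq: "frechet_derivative f (at x) = frechet_derivative g (at x)" if "x \<in> U" for x
    using frechet_derivative_at[OF diff[OF that]] .
  have "Ck_on k (\<lambda>x. frechet_derivative g (at x) w) U" for w
    using Suc.IH[of "\<lambda>x. frechet_derivative f (at x) w" "\<lambda>x. frechet_derivative g (at x) w"]
      eq Suc.prems(2) by simp
  then show ?case using diff by (auto simp: differentiable_def)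
qed

lemma Ck_on_SucD:
  assumes "open U" "Ck_on (Suc k) f U"
  shows "Ck_on k f U"
  using assms(2)
proof (induction k arbitrary: f)
  case 0
  then show ?case
    by (simp add: continuous_at_imp_continuous_on differentiable_imp_continuous_within)
next
  case (Suc k)
  then show ?case by (metis Ck_on.simps(2))
qed

text \<open>Uniqueness of the derivative lets an explicit \<open>f'\<close> stand in for the choice
  hidden in \<open>frechet_derivative\<close>; the closure rules below rest on this.\<close>

lemma Ck_on_SucI:
  assumes "open U" "\<And>x. x \<in> U \<Longrightarrow> (f has_derivative f' x) (at x)"
    "\<And>w. Ck_on k (\<lambda>x. f' x w) U"
  shows "Ck_on (Suc k) f U"
proof -
  have "f' x = frechet_derivative f (at x)" if "x \<in> U" for x
    using frechet_derivative_at[OF assms(2)[OF that]] .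
  then have "Ck_on k (\<lambda>x. frechet_derivative f (at x) w) U" for w
    using Ck_on_cong[OF assms(1) _ assms(3)[of w], of "\<lambda>x. frechet_derivative f (at x) w"] by simp
  then show ?thesis using assms(2) by (auto simp: differentiable_def)
qed

lemma Ck_on_add:
  assumes "open U" "Ck_on k f U" "Ck_on k g U"
  shows "Ck_on k (\<lambda>x. f x + g x) U"
  using assms(2,3)
proof (induction k arbitrary: f g)
  case 0
  then show ?case by (auto intro: continuous_intros)
next
  case (Suc k)
  show ?case
    by (rule Ck_on_SucI[OF assms(1), where f' = "\<lambda>x w. frechet_derivative f (at x) w + frechet_derivative g (at x) w"])
      (use Suc in \<open>auto intro!: derivative_eq_intros simp: frechet_derivative_works\<close>)
qed

lemma Ck_on_Pair:
  assumes "open U" "Ck_on k f U" "Ck_on k g U"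
  shows "Ck_on k (\<lambda>x. (f x, g x)) U"
  using assms(2,3)
proof (induction k arbitrary: f g)
  case 0
  then show ?case by (auto intro: continuous_intros)
next
  case (Suc k)
  show ?case
    by (rule Ck_on_SucI[OF assms(1), where f' = "\<lambda>x w. (frechet_derivative f (at x) w, frechet_derivative g (at x) w)"])
      (use Suc in \<open>auto intro!: has_derivative_Pair simp: frechet_derivative_works\<close>)
qed

lemma Ck_on_inner:
  fixes f g :: "_ \<Rightarrow> _::real_inner"
  assumes "open U" "Ck_on k f U" "Ck_on k g U"
  shows "Ck_on k (\<lambda>x. f x \<bullet> g x) U"
  using assms(2,3)
proof (induction k arbitrary: f g)
  case 0
  then show ?case by (auto intro: continuous_intros)
next
  case (Suc k)
  have fg: "Ck_on k f U" "Ck_on k g U"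
    using Suc.prems Ck_on_SucD[OF assms(1)] by auto
  show ?case
    by (rule Ck_on_SucI[OF assms(1), where f' = "\<lambda>x w. f x \<bullet> frechet_derivative g (at x) w
          + frechet_derivative f (at x) w \<bullet> g x"])
      (use Suc fg in \<open>auto intro!: has_derivative_inner Ck_on_add assms(1) simp: frechet_derivative_works\<close>)
qed

text \<open>The total derivative at a basis vector, rather than a limit along a line, so that
  iterates are literally those occurring in \<open>Ck_on\<close>.\<close>

definition du :: "(real \<times> real \<Rightarrow> 'b::real_normed_vector) \<Rightarrow> real \<times> real \<Rightarrow> 'b" where
  "du f p = frechet_derivative f (at p) (1, 0)"

definition dv :: "(real \<times> real \<Rightarrow> 'b::real_normed_vector) \<Rightarrow> real \<times> real \<Rightarrow> 'b" where
  "dv f p = frechet_derivative f (at p) (0, 1)"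

lemma smooth_du [intro]: "smooth_on f U \<Longrightarrow> smooth_on (du f) U"
  and smooth_dv [intro]: "smooth_on f U \<Longrightarrow> smooth_on (dv f) U"
  unfolding smooth_on_def du_def dv_def using Ck_on.simps(2) by blast+

lemma smooth_on_continuous_on: "smooth_on f U \<Longrightarrow> continuous_on U f"
  unfolding smooth_on_def by (metis Ck_on.simps(1))

lemma smooth_on_differentiable: "smooth_on f U \<Longrightarrow> p \<in> U \<Longrightarrow> f differentiable (at p)"
  unfolding smooth_on_def by (metis Ck_on.simps(2))

lemma smooth_on_has_derivative:
  assumes "smooth_on f U" "p \<in> U"
  shows "(f has_derivative (\<lambda>w. fst w *\<^sub>R du f p + snd w *\<^sub>R dv f p)) (at p)"
proof -
  let ?D = "frechet_derivative f (at p)"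
  have D: "(f has_derivative ?D) (at p)"
    using smooth_on_differentiable[OF assms] by (simp add: frechet_derivative_works)
  then interpret bounded_linear ?D by (rule has_derivative_bounded_linear)
  have "?D w = fst w *\<^sub>R du f p + snd w *\<^sub>R dv f p" for w
  proof -
    have "w = fst w *\<^sub>R (1,0) + snd w *\<^sub>R (0,1)" by (simp add: prod_eq_iff)
    then have "?D w = ?D (fst w *\<^sub>R (1,0) + snd w *\<^sub>R (0,1))" by simp
    then show ?thesis by (simp only: add scaleR du_def dv_def)
  qed
  then show ?thesis using D by (metis (no_types, lifting) ext)
qed

lemma smooth_on_curve:
  assumes f: "smooth_on f U" and "(c has_vector_derivative (x, y)) (at t within T)" "c t \<in> U"
  shows "((\<lambda>t. f (c t)) has_vector_derivative x *\<^sub>R du f (c t) + y *\<^sub>R dv f (c t)) (at t within T)"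
proof -
  have "((\<lambda>t. f (c t)) has_derivative
      (\<lambda>s. fst (s *\<^sub>R (x,y)) *\<^sub>R du f (c t) + snd (s *\<^sub>R (x,y)) *\<^sub>R dv f (c t))) (at t within T)"
    using has_derivative_compose[OF assms(2)[unfolded has_vector_derivative_def]
        smooth_on_has_derivative[OF f assms(3)]] .
  then show ?thesis
    by (simp add: has_vector_derivative_def scaleR_right_distrib)
qed

lemma smooth_on_slice_u:
  assumes "smooth_on f U" "(u + s, v) \<in> U"
  shows "((\<lambda>s. f (u + s, v)) has_vector_derivative du f (u + s, v)) (at s within T)"
proof -
  have "((\<lambda>s. (u + s, v)) has_vector_derivative (1, 0)) (at s within T)"
    by (auto simp: has_vector_derivative_def intro!: derivative_eq_intros)
  from smooth_on_curve[OF assms(1) this assms(2)] show ?thesis by simp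
qed

lemma smooth_on_slice_v:
  assumes "smooth_on f U" "(u, v + s) \<in> U"
  shows "((\<lambda>s. f (u, v + s)) has_vector_derivative dv f (u, v + s)) (at s within T)"
proof -
  have "((\<lambda>s. (u, v + s)) has_vector_derivative (0, 1)) (at s within T)"
    by (auto simp: has_vector_derivative_def intro!: derivative_eq_intros)
  from smooth_on_curve[OF assms(1) this assms(2)] show ?thesis by simp
qed

section \<open>Mean value inequalities and symmetry of mixed derivatives\<close>

text \<open>Stated on \<open>closed_segment 0 a\<close>, so that negative steps (the quadrants with
  \<sigma> or \<tau> equal to -1) need no separate treatment.\<close>

lemma segment_mvt:
  fixes \<psi> :: "real \<Rightarrow> 'a::real_normed_vector"
  assumes "\<And>t. t \<in> closed_segment 0 a \<Longrightarrow>
      (\<psi> has_vector_derivative \<psi>' t) (at t within closed_segment 0 a)"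
    and "\<And>t. t \<in> closed_segment 0 a \<Longrightarrow> norm (\<psi>' t) \<le> B"
  shows "norm (\<psi> a - \<psi> 0) \<le> B * \<bar>a\<bar>"
proof -
  have "norm (\<psi> a - \<psi> 0) \<le> B * norm (a - 0)"
  proof (rule differentiable_bound[where S = "closed_segment 0 a" and f' = "\<lambda>t s. s *\<^sub>R \<psi>' t"])
    fix t assume t: "t \<in> closed_segment 0 a"
    show "(\<psi> has_derivative (\<lambda>s. s *\<^sub>R \<psi>' t)) (at t within closed_segment 0 a)"
      using assms(1)[OF t] by (simp add: has_vector_derivative_def)
    show "onorm (\<lambda>s. s *\<^sub>R \<psi>' t) \<le> B"
      using assms(2)[OF t] by (intro onorm_le) (simp add: mult.commute[of B] mult_left_mono)
  qed auto
  then show ?thesis by simp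
qed

text \<open>The segment inequality is used twice: in \<open>t\<close> for \<open>hs\<close>, then in
  \<open>s\<close> for the difference of two slices. The gain over a single use is the product of
  both side lengths.\<close>

lemma rectangle_mvt:
  fixes h :: "real \<Rightarrow> real \<Rightarrow> 'a::real_normed_vector"
  assumes 1: "\<And>s t. s \<in> closed_segment 0 a \<Longrightarrow> t \<in> closed_segment 0 b \<Longrightarrow>
      ((\<lambda>s. h s t) has_vector_derivative hs s t) (at s within closed_segment 0 a)"
    and 2: "\<And>s t. s \<in> closed_segment 0 a \<Longrightarrow> t \<in> closed_segment 0 b \<Longrightarrow>
      ((\<lambda>t. hs s t) has_vector_derivative hst s t) (at t within closed_segment 0 b)"
    and 3: "\<And>s t. s \<in> closed_segment 0 a \<Longrightarrow> t \<in> closed_segment 0 b \<Longrightarrow> norm (hst s t) \<le> B"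
  shows "norm (h a b - h a 0 - h 0 b + h 0 0) \<le> B * (\<bar>a\<bar> * \<bar>b\<bar>)"
proof -
  have "norm (hs s b - hs s 0) \<le> B * \<bar>b\<bar>" if "s \<in> closed_segment 0 a" for s
    by (rule segment_mvt) (use that 2 3 in auto)
  then have "norm ((h a b - h a 0) - (h 0 b - h 0 0)) \<le> (B * \<bar>b\<bar>) * \<bar>a\<bar>"
    by (intro segment_mvt[where \<psi> = "\<lambda>s. h s b - h s 0" and \<psi>' = "\<lambda>s. hs s b - hs s 0"])
      (use 1 in \<open>auto intro!: has_vector_derivative_diff\<close>)
  then show ?thesis by (simp add: algebra_simps)
qed

lemma closed_segment_0_abs: "t \<in> closed_segment 0 a \<Longrightarrow> \<bar>t\<bar> \<le> \<bar>a\<bar>" for t a :: real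
  by (auto simp: closed_segment_eq_real_ivl split: if_splits)

lemma norm_pair_le: "norm (x, y) \<le> \<bar>x\<bar> + \<bar>y\<bar>" for x y :: real
  using norm_Pair_le[of x y] by simp

text \<open>The classical argument: the second difference over a small square of side
  \<open>r\<close>, divided by \<open>r * r\<close>, is close to either mixed derivative, depending
  on the order in which the two variables are integrated.\<close>

lemma mixed_partials_commute:
  assumes U: "open U" and f: "smooth_on f U" and p: "p \<in> U"
  shows "du (dv f) p = dv (du f) p"
proof -
  obtain u v where uv: "p = (u, v)" by fastforce
  let ?c = "dv (du f) p" and ?c' = "du (dv f) p"
  have "dist ?c' ?c \<le> 2 * \<eta>" if \<eta>: "\<eta> > 0" for \<eta>
  proof -
    have "continuous_on U (dv (du f))" "continuous_on U (du (dv f))"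
      using f by (auto intro: smooth_on_continuous_on)
    then have "isCont (dv (du f)) p" "isCont (du (dv f)) p"
      using U p continuous_on_eq_continuous_at by blast+
    then have "\<exists>d>0. \<forall>q. dist q p < d \<longrightarrow> dist (dv (du f) q) ?c < \<eta>"
      "\<exists>d>0. \<forall>q. dist q p < d \<longrightarrow> dist (du (dv f) q) ?c' < \<eta>"
      using \<eta> continuous_at_eps_delta[of p "dv (du f)"] continuous_at_eps_delta[of p "du (dv f)"]
      by simp_all
    then obtain d1 d2 where d: "d1 > 0" "d2 > 0"
      "\<And>q. dist q p < d1 \<Longrightarrow> dist (dv (du f) q) ?c < \<eta>"
      "\<And>q. dist q p < d2 \<Longrightarrow> dist (du (dv f) q) ?c' < \<eta>" by blast
    obtain d3 where d3: "d3 > 0" "ball p d3 \<subseteq> U"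
      using U p openE by blast
    \<comment> \<open>A third suffices because offsets are measured by
      \<open>\<bar>s\<bar> + \<bar>t\<bar>\<close>, which is at most \<open>2 * r\<close> on the
      square.\<close>
    define r where "r = min d1 (min d2 d3) / 3"
    have r: "r > 0" using d d3 by (simp add: r_def)
    have near: "dist (u + s, v + t) p < min d1 (min d2 d3)"
      if "s \<in> closed_segment 0 r" "t \<in> closed_segment 0 r" for s t
    proof -
      have "dist (u + s, v + t) p \<le> \<bar>s\<bar> + \<bar>t\<bar>"
        unfolding uv dist_norm using norm_pair_le[of s t] by simp
      then show ?thesis
        using closed_segment_0_abs[OF that(1)] closed_segment_0_abs[OF that(2)] r
        unfolding r_def by linarith
    qed
    have inU: "(u + s, v + t) \<in> U" if "s \<in> closed_segment 0 r" "t \<in> closed_segment 0 r" for s t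
      using near[OF that] d3(2) by (auto simp: dist_commute mem_ball subset_iff)
    define \<Delta> where "\<Delta> = f (u + r, v + r) - f (u + r, v) - f (u, v + r) + f (u, v)"
    \<comment> \<open>Subtracting \<open>(s * t) *\<^sub>R ?c\<close> makes the mixed derivative of
      the integrand the deviation from its value at \<open>p\<close>, which continuity bounds by
      \<eta>.\<close>
    have A: "norm ((f (u + r, v + r) - (r * r) *\<^sub>R ?c) - (f (u + r, v + 0) - (r * 0) *\<^sub>R ?c)
        - (f (u + 0, v + r) - (0 * r) *\<^sub>R ?c) + (f (u + 0, v + 0) - (0 * 0) *\<^sub>R ?c)) \<le> \<eta> * (\<bar>r\<bar> * \<bar>r\<bar>)"
    proof (rule rectangle_mvt[where h = "\<lambda>s t. f (u + s, v + t) - (s * t) *\<^sub>R ?c"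
          and hs = "\<lambda>s t. du f (u + s, v + t) - t *\<^sub>R ?c"
          and hst = "\<lambda>s t. dv (du f) (u + s, v + t) - ?c"])
      fix s t assume st: "s \<in> closed_segment 0 r" "t \<in> closed_segment 0 r"
      show "((\<lambda>s. f (u + s, v + t) - (s * t) *\<^sub>R ?c) has_vector_derivative
          du f (u + s, v + t) - t *\<^sub>R ?c) (at s within closed_segment 0 r)"
        by (rule has_vector_derivative_diff[OF smooth_on_slice_u[OF f inU[OF st]]])
          (auto simp: has_vector_derivative_def intro!: derivative_eq_intros)
      show "((\<lambda>t. du f (u + s, v + t) - t *\<^sub>R ?c) has_vector_derivative
          dv (du f) (u + s, v + t) - ?c) (at t within closed_segment 0 r)"
        by (rule has_vector_derivative_diff[OF smooth_on_slice_v[OF smooth_du[OF f] inU[OF st]]])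
          (auto simp: has_vector_derivative_def intro!: derivative_eq_intros)
      show "norm (dv (du f) (u + s, v + t) - ?c) \<le> \<eta>"
        using d(3)[of "(u + s, v + t)"] near[OF st] by (simp add: dist_norm less_imp_le)
    qed
    have B: "norm ((f (u + r, v + r) - (r * r) *\<^sub>R ?c') - (f (u + 0, v + r) - (r * 0) *\<^sub>R ?c')
        - (f (u + r, v + 0) - (0 * r) *\<^sub>R ?c') + (f (u + 0, v + 0) - (0 * 0) *\<^sub>R ?c')) \<le> \<eta> * (\<bar>r\<bar> * \<bar>r\<bar>)"
    proof (rule rectangle_mvt[where h = "\<lambda>t s. f (u + s, v + t) - (t * s) *\<^sub>R ?c'"
          and hs = "\<lambda>t s. dv f (u + s, v + t) - s *\<^sub>R ?c'"
          and hst = "\<lambda>t s. du (dv f) (u + s, v + t) - ?c'"])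
      fix t s assume st: "t \<in> closed_segment 0 r" "s \<in> closed_segment 0 r"
      show "((\<lambda>t. f (u + s, v + t) - (t * s) *\<^sub>R ?c') has_vector_derivative
          dv f (u + s, v + t) - s *\<^sub>R ?c') (at t within closed_segment 0 r)"
        by (rule has_vector_derivative_diff[OF smooth_on_slice_v[OF f inU[OF st(2,1)]]])
          (auto simp: has_vector_derivative_def intro!: derivative_eq_intros)
      show "((\<lambda>s. dv f (u + s, v + t) - s *\<^sub>R ?c') has_vector_derivative
          du (dv f) (u + s, v + t) - ?c') (at s within closed_segment 0 r)"
        by (rule has_vector_derivative_diff[OF smooth_on_slice_u[OF smooth_dv[OF f] inU[OF st(2,1)]]])
          (auto simp: has_vector_derivative_def intro!: derivative_eq_intros)
      show "norm (du (dv f) (u + s, v + t) - ?c') \<le> \<eta>"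
        using d(4)[of "(u + s, v + t)"] near[OF st(2,1)] by (simp add: dist_norm less_imp_le)
    qed
    have A': "norm (\<Delta> - (r * r) *\<^sub>R ?c) \<le> \<eta> * (r * r)"
      using A r by (simp add: \<Delta>_def algebra_simps)
    have B': "norm (\<Delta> - (r * r) *\<^sub>R ?c') \<le> \<eta> * (r * r)"
      using B r by (simp add: \<Delta>_def algebra_simps)
    have "(r * r) * norm (?c' - ?c) = norm ((\<Delta> - (r * r) *\<^sub>R ?c) - (\<Delta> - (r * r) *\<^sub>R ?c'))"
      using r by (simp flip: scaleR_diff_right)
    also have "\<dots> \<le> \<eta> * (r * r) + \<eta> * (r * r)"
      using norm_triangle_ineq4 A' B' by (meson add_mono order_trans)
    finally have "(r * r) * norm (?c' - ?c) \<le> (r * r) * (2 * \<eta>)" by (simp add: algebra_simps)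
    then show ?thesis using r by (simp add: dist_norm)
  qed
  then have "dist ?c' ?c \<le> e" if "e > 0" for e
    using that by (metis field_sum_of_halves half_gt_zero mult_2)
  then show ?thesis
    by (metis dist_eq_0_iff dense_ge order_antisym zero_le_dist)
qed

text \<open>The Lipschitz bound on \<open>f3\<close> is integrated three times by the mean value
  inequality; the constant stays \<open>L\<close>, as no factorials are gained that way.\<close>

lemma taylor3_segment:
  fixes f0 :: "real \<Rightarrow> 'a::real_normed_vector"
  assumes d: "\<And>t. t \<in> closed_segment 0 a \<Longrightarrow> (f0 has_vector_derivative f1 t) (at t within closed_segment 0 a)"
    "\<And>t. t \<in> closed_segment 0 a \<Longrightarrow> (f1 has_vector_derivative f2 t) (at t within closed_segment 0 a)"
    "\<And>t. t \<in> closed_segment 0 a \<Longrightarrow> (f2 has_vector_derivative f3 t) (at t within closed_segment 0 a)"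
    and L: "\<And>t. t \<in> closed_segment 0 a \<Longrightarrow> norm (f3 t - f3 0) \<le> L * \<bar>t\<bar>"
    and L0: "L \<ge> 0"
  shows "norm (f0 a - f0 0 - a *\<^sub>R f1 0 - (a\<^sup>2 / 2) *\<^sub>R f2 0 - (a ^ 3 / 6) *\<^sub>R f3 0) \<le> L * \<bar>a\<bar> ^ 4"
proof -
  have sub: "closed_segment 0 t \<subseteq> closed_segment 0 a" if "t \<in> closed_segment 0 a" for t
    using that by (simp add: subset_closed_segment)
  have mono: "L * \<bar>s\<bar> ^ n \<le> L * \<bar>t\<bar> ^ n" if "s \<in> closed_segment 0 t" for s t n
    using closed_segment_0_abs[OF that] L0 by (simp add: mult_left_mono power_mono)
  note dd = d[THEN has_vector_derivative_within_subset, OF _ sub]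
  have 1: "norm (f2 t - f2 0 - t *\<^sub>R f3 0) \<le> L * \<bar>t\<bar> ^ 2" if t: "t \<in> closed_segment 0 a" for t
  proof -
    have "norm ((f2 t - f2 0 - t *\<^sub>R f3 0) - (f2 0 - f2 0 - 0 *\<^sub>R f3 0)) \<le> (L * \<bar>t\<bar>) * \<bar>t\<bar>"
    proof (rule segment_mvt)
      fix s assume s: "s \<in> closed_segment 0 t"
      then have sa: "s \<in> closed_segment 0 a" using sub[OF t] by blast
      show "((\<lambda>t. f2 t - f2 0 - t *\<^sub>R f3 0) has_vector_derivative f3 s - f3 0) (at s within closed_segment 0 t)"
        using dd(3)[OF sa t] by (auto intro!: derivative_eq_intros simp: has_vector_derivative_def algebra_simps)
      show "norm (f3 s - f3 0) \<le> L * \<bar>t\<bar>" using L[OF sa] mono[OF s, of 1] by simp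
    qed
    then show ?thesis by (simp add: power2_eq_square)
  qed
  have 2: "norm (f1 t - f1 0 - t *\<^sub>R f2 0 - (t\<^sup>2 / 2) *\<^sub>R f3 0) \<le> L * \<bar>t\<bar> ^ 3" if t: "t \<in> closed_segment 0 a" for t
  proof -
    have "norm ((f1 t - f1 0 - t *\<^sub>R f2 0 - (t\<^sup>2 / 2) *\<^sub>R f3 0) - (f1 0 - f1 0 - 0 *\<^sub>R f2 0 - (0\<^sup>2 / 2) *\<^sub>R f3 0))
        \<le> (L * \<bar>t\<bar> ^ 2) * \<bar>t\<bar>"
    proof (rule segment_mvt)
      fix s assume s: "s \<in> closed_segment 0 t"
      then have sa: "s \<in> closed_segment 0 a" using sub[OF t] by blast
      show "((\<lambda>t. f1 t - f1 0 - t *\<^sub>R f2 0 - (t\<^sup>2 / 2) *\<^sub>R f3 0) has_vector_derivative f2 s - f2 0 - s *\<^sub>R f3 0)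
          (at s within closed_segment 0 t)"
        using dd(2)[OF sa t] by (auto intro!: derivative_eq_intros simp: has_vector_derivative_def algebra_simps)
      show "norm (f2 s - f2 0 - s *\<^sub>R f3 0) \<le> L * \<bar>t\<bar> ^ 2" using 1[OF sa] mono[OF s, of 2] by simp
    qed
    then show ?thesis by (simp add: power2_eq_square power3_eq_cube)
  qed
  have "norm ((f0 a - f0 0 - a *\<^sub>R f1 0 - (a\<^sup>2 / 2) *\<^sub>R f2 0 - (a ^ 3 / 6) *\<^sub>R f3 0)
     - (f0 0 - f0 0 - 0 *\<^sub>R f1 0 - (0\<^sup>2 / 2) *\<^sub>R f2 0 - (0 ^ 3 / 6) *\<^sub>R f3 0)) \<le> (L * \<bar>a\<bar> ^ 3) * \<bar>a\<bar>"
  proof (rule segment_mvt)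
    fix s assume s: "s \<in> closed_segment 0 a"
    show "((\<lambda>t. f0 t - f0 0 - t *\<^sub>R f1 0 - (t\<^sup>2 / 2) *\<^sub>R f2 0 - (t ^ 3 / 6) *\<^sub>R f3 0)
        has_vector_derivative f1 s - f1 0 - s *\<^sub>R f2 0 - (s\<^sup>2 / 2) *\<^sub>R f3 0) (at s within closed_segment 0 a)"
      using d(1)[OF s] by (auto intro!: derivative_eq_intros simp: has_vector_derivative_def algebra_simps)
    show "norm (f1 s - f1 0 - s *\<^sub>R f2 0 - (s\<^sup>2 / 2) *\<^sub>R f3 0) \<le> L * \<bar>a\<bar> ^ 3"
      using 2[OF s] mono[OF s, of 3] by simp
  qed
  then show ?thesis by (simp add: eval_nat_numeral mult_ac)
qed

section \<open>Uniform bounds and Taylor expansions on compact convex sets\<close>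

lemma smooth_on_bounded:
  assumes "smooth_on f U" "compact K" "K \<subseteq> U"
  shows "\<exists>B>0. \<forall>p\<in>K. norm (f p) \<le> B"
proof -
  have "bounded (f ` K)"
    using assms by (meson compact_continuous_image compact_imp_bounded continuous_on_subset
        smooth_on_continuous_on)
  then show ?thesis by (auto simp: bounded_pos)
qed

lemma smooth_on_lipschitz:
  fixes f :: "real \<times> real \<Rightarrow> 'a::real_normed_vector"
  assumes f: "smooth_on f U" and K: "compact K" "convex K" "K \<subseteq> U"
  shows "\<exists>L>0. \<forall>p\<in>K. \<forall>q\<in>K. norm (f p - f q) \<le> L * norm (p - q)"
proof -
  obtain B1 where B1: "B1 > 0" "\<And>p. p \<in> K \<Longrightarrow> norm (du f p) \<le> B1"
    using smooth_on_bounded[OF smooth_du[OF f] K(1,3)] by blast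
  obtain B2 where B2: "B2 > 0" "\<And>p. p \<in> K \<Longrightarrow> norm (dv f p) \<le> B2"
    using smooth_on_bounded[OF smooth_dv[OF f] K(1,3)] by blast
  have "norm (f p - f q) \<le> (B1 + B2) * norm (p - q)" if "p \<in> K" "q \<in> K" for p q
  proof (rule differentiable_bound[OF K(2)])
    fix x assume x: "x \<in> K"
    show "(f has_derivative (\<lambda>w. fst w *\<^sub>R du f x + snd w *\<^sub>R dv f x)) (at x within K)"
      using smooth_on_has_derivative[OF f] x K(3) has_derivative_at_withinI by blast
    show "onorm (\<lambda>w. fst w *\<^sub>R du f x + snd w *\<^sub>R dv f x) \<le> B1 + B2"
    proof (rule onorm_le)
      fix w :: "real \<times> real"
      have "norm (fst w *\<^sub>R du f x + snd w *\<^sub>R dv f x)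
          \<le> \<bar>fst w\<bar> * norm (du f x) + \<bar>snd w\<bar> * norm (dv f x)"
        using norm_triangle_ineq[of "fst w *\<^sub>R du f x" "snd w *\<^sub>R dv f x"] by simp
      also have "\<dots> \<le> norm w * B1 + norm w * B2"
        using B1(2)[OF x] B2(2)[OF x] norm_fst_le[of "fst w" "snd w"] norm_snd_le[of "snd w" "fst w"]
        by (intro add_mono mult_mono) auto
      finally show "norm (fst w *\<^sub>R du f x + snd w *\<^sub>R dv f x) \<le> (B1 + B2) * norm w"
        by (simp add: algebra_simps)
    qed
  qed (use that in auto)
  then show ?thesis using B1(1) B2(1) by (intro exI[of _ "B1 + B2"]) auto
qed

lemma segment_in_convex:
  assumes "convex K" "(u, v) \<in> K" "(u + x, v + y) \<in> K" "t \<in> closed_segment 0 (1::real)"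
  shows "(u + t * x, v + t * y) \<in> (K :: (real \<times> real) set)"
proof -
  have t: "0 \<le> t" "t \<le> 1" using assms(4) by (auto simp: closed_segment_eq_real_ivl)
  have "(1 - t) *\<^sub>R (u, v) + t *\<^sub>R (u + x, v + y) \<in> K"
    using assms(1-3) t by (intro convexD) auto
  then show ?thesis by (simp add: algebra_simps)
qed

lemma smooth_on_line:
  assumes "smooth_on f U" "(u + t * x, v + t * y) \<in> U"
  shows "((\<lambda>t. f (u + t * x, v + t * y)) has_vector_derivative
    x *\<^sub>R du f (u + t * x, v + t * y) + y *\<^sub>R dv f (u + t * x, v + t * y)) (at t within T)"
proof -
  have "((\<lambda>t. (u + t * x, v + t * y)) has_vector_derivative (x, y)) (at t within T)"
    by (auto simp: has_vector_derivative_def intro!: derivative_eq_intros)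
  from smooth_on_curve[OF assms(1) this assms(2)] show ?thesis .
qed

lemma norm_scaleR_add_le:
  assumes "norm P \<le> B" "norm Q \<le> B" "\<bar>x\<bar> \<le> d" "\<bar>y\<bar> \<le> d"
  shows "norm (x *\<^sub>R P + y *\<^sub>R Q) \<le> 2 * d * B"
proof -
  have "norm (x *\<^sub>R P + y *\<^sub>R Q) \<le> \<bar>x\<bar> * norm P + \<bar>y\<bar> * norm Q"
    using norm_triangle_ineq[of "x *\<^sub>R P" "y *\<^sub>R Q"] by simp
  also have "\<dots> \<le> d * B + d * B"
    by (intro add_mono mult_mono) (use assms order_trans[OF norm_ge_zero assms(1)] in auto)
  finally show ?thesis by (simp add: mult_ac)
qed

text \<open>Mean value inequality along the segment between the two points, for \<open>f\<close>
  minus its linear part; convexity keeps the segment in \<open>K\<close>. A single \<open>d\<close>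
  bounding both offsets gives remainders that are homogeneous in the mesh size.\<close>

lemma smooth_on_taylor1:
  assumes f: "smooth_on f U" and K: "compact K" "convex K" "K \<subseteq> U"
  shows "\<exists>C>0. \<forall>u v x y d. (u, v) \<in> K \<longrightarrow> (u + x, v + y) \<in> K \<longrightarrow> \<bar>x\<bar> \<le> d \<longrightarrow> \<bar>y\<bar> \<le> d \<longrightarrow>
    norm (f (u + x, v + y) - f (u, v) - x *\<^sub>R du f (u, v) - y *\<^sub>R dv f (u, v)) \<le> C * d ^ 2"
proof -
  obtain L1 where L1: "L1 > 0" "\<And>p q. p \<in> K \<Longrightarrow> q \<in> K \<Longrightarrow> norm (du f p - du f q) \<le> L1 * norm (p - q)"
    using smooth_on_lipschitz[OF smooth_du[OF f] K] by blast
  obtain L2 where L2: "L2 > 0" "\<And>p q. p \<in> K \<Longrightarrow> q \<in> K \<Longrightarrow> norm (dv f p - dv f q) \<le> L2 * norm (p - q)"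
    using smooth_on_lipschitz[OF smooth_dv[OF f] K] by blast
  define L where "L = 2 * (L1 + L2)"
  have "norm (f (u + x, v + y) - f (u, v) - x *\<^sub>R du f (u, v) - y *\<^sub>R dv f (u, v)) \<le> (2 * L) * d ^ 2"
    if p: "(u, v) \<in> K" "(u + x, v + y) \<in> K" and xy: "\<bar>x\<bar> \<le> d" "\<bar>y\<bar> \<le> d" for u v x y d
  proof -
    let ?q = "\<lambda>t. (u + t * x, v + t * y)"
    have "norm ((f (?q 1) - 1 *\<^sub>R (x *\<^sub>R du f (u, v) + y *\<^sub>R dv f (u, v)))
        - (f (?q 0) - 0 *\<^sub>R (x *\<^sub>R du f (u, v) + y *\<^sub>R dv f (u, v)))) \<le> (2 * d * (L * d)) * \<bar>1\<bar>"
    proof (rule segment_mvt)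
      fix t assume t: "t \<in> closed_segment 0 (1::real)"
      have q: "?q t \<in> K" using segment_in_convex[OF K(2) p t] .
      have "norm (?q t - (u, v)) \<le> 2 * d"
      proof -
        have "norm (?q t - (u, v)) \<le> \<bar>t * x\<bar> + \<bar>t * y\<bar>" using norm_pair_le by simp
        moreover have "\<bar>t * x\<bar> \<le> 1 * d" "\<bar>t * y\<bar> \<le> 1 * d"
          unfolding abs_mult using closed_segment_0_abs[OF t] xy by (intro mult_mono; simp)+
        ultimately show ?thesis by simp
      qed
      then have "L1 * norm (?q t - (u, v)) \<le> L1 * (2 * d)" "L2 * norm (?q t - (u, v)) \<le> L2 * (2 * d)"
        using L1(1) L2(1) by (intro mult_left_mono; simp)+
      moreover have "d \<ge> 0" using xy by linarith
      then have "L1 * (2 * d) \<le> L * d" "L2 * (2 * d) \<le> L * d"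
        using L1(1) L2(1) by (auto simp: L_def algebra_simps)
      ultimately have "L1 * norm (?q t - (u, v)) \<le> L * d" "L2 * norm (?q t - (u, v)) \<le> L * d"
        by linarith+
      then have "norm (du f (?q t) - du f (u, v)) \<le> L * d" "norm (dv f (?q t) - dv f (u, v)) \<le> L * d"
        using L1(2)[OF q p(1)] L2(2)[OF q p(1)] by linarith+
      then have "norm (x *\<^sub>R (du f (?q t) - du f (u, v)) + y *\<^sub>R (dv f (?q t) - dv f (u, v))) \<le> 2 * d * (L * d)"
        by (rule norm_scaleR_add_le) (use xy in auto)
      then show "norm (x *\<^sub>R du f (?q t) + y *\<^sub>R dv f (?q t) - (x *\<^sub>R du f (u, v) + y *\<^sub>R dv f (u, v))) \<le> 2 * d * (L * d)"
        by (simp add: algebra_simps)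
      show "((\<lambda>t. f (?q t) - t *\<^sub>R (x *\<^sub>R du f (u, v) + y *\<^sub>R dv f (u, v))) has_vector_derivative
         x *\<^sub>R du f (?q t) + y *\<^sub>R dv f (?q t) - (x *\<^sub>R du f (u, v) + y *\<^sub>R dv f (u, v)))
         (at t within closed_segment 0 1)"
        by (rule has_vector_derivative_diff[OF smooth_on_line[OF f]])
          (use q K(3) in \<open>auto simp: has_vector_derivative_def intro!: derivative_eq_intros\<close>)
    qed
    then show ?thesis by (simp add: algebra_simps power2_eq_square)
  qed
  then show ?thesis using L1(1) L2(1) unfolding L_def
    by (intro exI[of _ "2 * (2 * (L1 + L2))"]) auto
qed

text \<open>One integration along the segment of the first-order expansions of \<open>du f\<close>
  and \<open>dv f\<close>; symmetry of the mixed derivatives merges the two cross terms.\<close>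

lemma smooth_on_taylor2:
  assumes U: "open U" and f: "smooth_on f U" and K: "compact K" "convex K" "K \<subseteq> U"
  shows "\<exists>C>0. \<forall>u v x y d. (u, v) \<in> K \<longrightarrow> (u + x, v + y) \<in> K \<longrightarrow> \<bar>x\<bar> \<le> d \<longrightarrow> \<bar>y\<bar> \<le> d \<longrightarrow>
    norm (f (u + x, v + y) - f (u, v) - x *\<^sub>R du f (u, v) - y *\<^sub>R dv f (u, v)
      - (x\<^sup>2 / 2) *\<^sub>R du (du f) (u, v) - (x * y) *\<^sub>R dv (du f) (u, v) - (y\<^sup>2 / 2) *\<^sub>R dv (dv f) (u, v)) \<le> C * d ^ 3"
proof -
  obtain C1 where C1: "C1 > 0" "\<And>u v x y d. (u, v) \<in> K \<Longrightarrow> (u + x, v + y) \<in> K \<Longrightarrow> \<bar>x\<bar> \<le> d \<Longrightarrow> \<bar>y\<bar> \<le> d \<Longrightarrow>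
      norm (du f (u + x, v + y) - du f (u, v) - x *\<^sub>R du (du f) (u, v) - y *\<^sub>R dv (du f) (u, v)) \<le> C1 * d ^ 2"
    using smooth_on_taylor1[OF smooth_du[OF f] K] by blast
  obtain C2 where C2: "C2 > 0" "\<And>u v x y d. (u, v) \<in> K \<Longrightarrow> (u + x, v + y) \<in> K \<Longrightarrow> \<bar>x\<bar> \<le> d \<Longrightarrow> \<bar>y\<bar> \<le> d \<Longrightarrow>
      norm (dv f (u + x, v + y) - dv f (u, v) - x *\<^sub>R du (dv f) (u, v) - y *\<^sub>R dv (dv f) (u, v)) \<le> C2 * d ^ 2"
    using smooth_on_taylor1[OF smooth_dv[OF f] K] by blast
  define C where "C = C1 + C2"
  have C: "C1 \<le> C" "C2 \<le> C" using C1(1) C2(1) by (auto simp: C_def)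
  have "norm (f (u + x, v + y) - f (u, v) - x *\<^sub>R du f (u, v) - y *\<^sub>R dv f (u, v)
      - (x\<^sup>2 / 2) *\<^sub>R du (du f) (u, v) - (x * y) *\<^sub>R dv (du f) (u, v) - (y\<^sup>2 / 2) *\<^sub>R dv (dv f) (u, v)) \<le> (2 * C) * d ^ 3"
    if p: "(u, v) \<in> K" "(u + x, v + y) \<in> K" and xy: "\<bar>x\<bar> \<le> d" "\<bar>y\<bar> \<le> d" for u v x y d
  proof -
    let ?q = "\<lambda>t. (u + t * x, v + t * y)"
    have comm: "du (dv f) (u, v) = dv (du f) (u, v)"
      using mixed_partials_commute[OF U f] p(1) K(3) by blast
    define W1 where "W1 = x *\<^sub>R du f (u, v) + y *\<^sub>R dv f (u, v)"
    define W2 where "W2 = x\<^sup>2 *\<^sub>R du (du f) (u, v) + (2 * x * y) *\<^sub>R dv (du f) (u, v) + y\<^sup>2 *\<^sub>R dv (dv f) (u, v)"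
    have "norm ((f (?q 1) - 1 *\<^sub>R W1 - (1\<^sup>2 / 2) *\<^sub>R W2)
        - (f (?q 0) - 0 *\<^sub>R W1 - (0\<^sup>2 / 2) *\<^sub>R W2)) \<le> (2 * d * (C * d ^ 2)) * \<bar>1\<bar>"
    proof (rule segment_mvt)
      fix t assume t: "t \<in> closed_segment 0 (1::real)"
      have q: "?q t \<in> K" using segment_in_convex[OF K(2) p t] .
      have txy: "\<bar>t * x\<bar> \<le> d" "\<bar>t * y\<bar> \<le> d"
        using closed_segment_0_abs[OF t] xy mult_mono[of "\<bar>t\<bar>" 1 "\<bar>x\<bar>" d] mult_mono[of "\<bar>t\<bar>" 1 "\<bar>y\<bar>" d]
        by (auto simp: abs_mult)
      let ?P = "du f (?q t) - du f (u, v) - (t * x) *\<^sub>R du (du f) (u, v) - (t * y) *\<^sub>R dv (du f) (u, v)"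
      let ?Q = "dv f (?q t) - dv f (u, v) - (t * x) *\<^sub>R du (dv f) (u, v) - (t * y) *\<^sub>R dv (dv f) (u, v)"
      have "norm ?P \<le> C * d ^ 2" "norm ?Q \<le> C * d ^ 2"
        using C1(2)[OF p(1) q txy] C2(2)[OF p(1) q txy] C
        by (smt (verit) mult_right_mono zero_le_power2)+
      then have "norm (x *\<^sub>R ?P + y *\<^sub>R ?Q) \<le> 2 * d * (C * d ^ 2)"
        by (rule norm_scaleR_add_le) (use xy in auto)
      moreover have "x *\<^sub>R ?P + y *\<^sub>R ?Q = x *\<^sub>R du f (?q t) + y *\<^sub>R dv f (?q t) - W1 - t *\<^sub>R W2"
        by (simp add: W1_def W2_def comm algebra_simps power2_eq_square)
          (simp flip: scaleR_add_left)
      ultimately show "norm (x *\<^sub>R du f (?q t) + y *\<^sub>R dv f (?q t) - W1 - t *\<^sub>R W2) \<le> 2 * d * (C * d ^ 2)"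
        by simp
      have "((\<lambda>t. t *\<^sub>R W1) has_vector_derivative W1) (at t within closed_segment 0 1)"
        "((\<lambda>t. (t\<^sup>2 / 2) *\<^sub>R W2) has_vector_derivative t *\<^sub>R W2) (at t within closed_segment 0 1)"
        by (auto simp: has_vector_derivative_def intro!: derivative_eq_intros)
      then show "((\<lambda>t. f (?q t) - t *\<^sub>R W1 - (t\<^sup>2 / 2) *\<^sub>R W2) has_vector_derivative
         x *\<^sub>R du f (?q t) + y *\<^sub>R dv f (?q t) - W1 - t *\<^sub>R W2)
         (at t within closed_segment 0 1)"
        using q K(3) by (intro has_vector_derivative_diff smooth_on_line[OF f]) auto
    qed
    moreover have "(1/2) *\<^sub>R W2 = (x\<^sup>2 / 2) *\<^sub>R du (du f) (u, v) + (x * y) *\<^sub>R dv (du f) (u, v) + (y\<^sup>2 / 2) *\<^sub>R dv (dv f) (u, v)"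
      by (simp add: W2_def scaleR_add_right)
    ultimately show ?thesis
      by (simp add: W1_def algebra_simps power2_eq_square power3_eq_cube)
  qed
  then show ?thesis using C1(1) C2(1) unfolding C_def
    by (intro exI[of _ "2 * (C1 + C2)"]) auto
qed

text \<open>The margin \<open>\<rho> - 1\<close> is room for quadrilaterals that have their base
  vertex in the unit disk but stick out of it.\<close>

locale smooth_near_disk =
  fixes h :: "real \<times> real \<Rightarrow> 'a::real_normed_vector" and U :: "(real \<times> real) set" and \<rho> :: real
  assumes open_U: "open U" and smooth: "smooth_on h U"
    and rho: "\<rho> > 1" and U: "cball 0 \<rho> \<subseteq> U"
begin

abbreviation "hu \<equiv> du h"
abbreviation "hv \<equiv> dv h"
abbreviation "huu \<equiv> du (du h)"
abbreviation "huv \<equiv> dv (du h)"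
abbreviation "hvv \<equiv> dv (dv h)"
abbreviation "huuu \<equiv> du (du (du h))"
abbreviation "hvvv \<equiv> dv (dv (dv h))"

lemma compact_convex: "compact (cball (0 :: real \<times> real) \<rho>)" "convex (cball (0 :: real \<times> real) \<rho>)"
  by auto

lemmas K = compact_convex U

lemma smooths [intro]: "smooth_on hu U" "smooth_on hv U" "smooth_on huu U" "smooth_on huv U"
    "smooth_on hvv U" "smooth_on huuu U" "smooth_on hvvv U" "smooth_on (du huv) U" "smooth_on (dv huv) U"
    "smooth_on (du (du huv)) U" "smooth_on (dv (du huv)) U" "smooth_on (dv (dv huv)) U"
  using smooth by (meson smooth_du smooth_dv)+

lemma shift_in_cball:
  assumes "norm (u, v) \<le> (1::real)" "\<bar>s\<bar> + \<bar>t\<bar> \<le> \<rho> - 1"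
  shows "(u + s, v + t) \<in> cball 0 \<rho>"
proof -
  have "norm (u + s, v + t) \<le> norm (u, v) + norm (s, t)"
    using norm_triangle_ineq[of "(u,v)" "(s,t)"] by simp
  then show ?thesis using assms norm_pair_le[of s t] by simp
qed

lemma mixed_du_dv: "p \<in> cball 0 \<rho> \<Longrightarrow> du hv p = huv p"
  using mixed_partials_commute[OF open_U smooth] U by blast

text \<open>Expanding only \<open>huv\<close> to second order suffices: the mixed second difference
  is its double integral over the rectangle, which raises the remainder from order 3 to order 5 and
  removes all pure derivatives.\<close>

lemma rectangle_taylor:
  "\<exists>C>0. \<forall>u v a b d. norm (u, v) \<le> 1 \<longrightarrow> 2 * d \<le> \<rho> - 1 \<longrightarrow> \<bar>a\<bar> \<le> d \<longrightarrow> \<bar>b\<bar> \<le> d \<longrightarrow>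
    norm (h (u + a, v + b) - h (u + a, v) - h (u, v + b) + h (u, v)
      - ((a * b) *\<^sub>R huv (u, v) + (a\<^sup>2 * b / 2) *\<^sub>R du huv (u, v) + (a * b\<^sup>2 / 2) *\<^sub>R dv huv (u, v)
        + (a ^ 3 * b / 6) *\<^sub>R du (du huv) (u, v) + (a\<^sup>2 * b\<^sup>2 / 4) *\<^sub>R dv (du huv) (u, v)
        + (a * b ^ 3 / 6) *\<^sub>R dv (dv huv) (u, v))) \<le> C * d ^ 5"
proof -
  obtain C where C: "C > 0" "\<And>u v x y d. (u, v) \<in> cball 0 \<rho> \<Longrightarrow> (u + x, v + y) \<in> cball 0 \<rho> \<Longrightarrow> \<bar>x\<bar> \<le> d \<Longrightarrow> \<bar>y\<bar> \<le> d \<Longrightarrow>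
    norm (huv (u + x, v + y) - huv (u, v) - x *\<^sub>R du huv (u, v) - y *\<^sub>R dv huv (u, v)
      - (x\<^sup>2 / 2) *\<^sub>R du (du huv) (u, v) - (x * y) *\<^sub>R dv (du huv) (u, v) - (y\<^sup>2 / 2) *\<^sub>R dv (dv huv) (u, v)) \<le> C * d ^ 3"
    using smooth_on_taylor2[OF open_U _ K, of huv] by blast
  have "norm (h (u + a, v + b) - h (u + a, v) - h (u, v + b) + h (u, v)
      - ((a * b) *\<^sub>R huv (u, v) + (a\<^sup>2 * b / 2) *\<^sub>R du huv (u, v) + (a * b\<^sup>2 / 2) *\<^sub>R dv huv (u, v)
        + (a ^ 3 * b / 6) *\<^sub>R du (du huv) (u, v) + (a\<^sup>2 * b\<^sup>2 / 4) *\<^sub>R dv (du huv) (u, v)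
        + (a * b ^ 3 / 6) *\<^sub>R dv (dv huv) (u, v))) \<le> C * d ^ 5"
    if p: "norm (u, v) \<le> 1" and d: "2 * d \<le> \<rho> - 1" and ab: "\<bar>a\<bar> \<le> d" "\<bar>b\<bar> \<le> d" for u v a b d
  proof -
    \<comment> \<open>\<open>P\<close> is the double primitive, vanishing on both axes, of the
      Taylor polynomial \<open>Pst\<close> of \<open>huv\<close>.\<close>
    define P where "P s t = (s * t) *\<^sub>R huv (u, v) + (s\<^sup>2 * t / 2) *\<^sub>R du huv (u, v) + (s * t\<^sup>2 / 2) *\<^sub>R dv huv (u, v)
        + (s ^ 3 * t / 6) *\<^sub>R du (du huv) (u, v) + (s\<^sup>2 * t\<^sup>2 / 4) *\<^sub>R dv (du huv) (u, v)
        + (s * t ^ 3 / 6) *\<^sub>R dv (dv huv) (u, v)" for s t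
    define Ps where "Ps s t = t *\<^sub>R huv (u, v) + (s * t) *\<^sub>R du huv (u, v) + (t\<^sup>2 / 2) *\<^sub>R dv huv (u, v)
        + (s\<^sup>2 * t / 2) *\<^sub>R du (du huv) (u, v) + (s * t\<^sup>2 / 2) *\<^sub>R dv (du huv) (u, v)
        + (t ^ 3 / 6) *\<^sub>R dv (dv huv) (u, v)" for s t
    define Pst where "Pst s t = huv (u, v) + s *\<^sub>R du huv (u, v) + t *\<^sub>R dv huv (u, v)
        + (s\<^sup>2 / 2) *\<^sub>R du (du huv) (u, v) + (s * t) *\<^sub>R dv (du huv) (u, v)
        + (t\<^sup>2 / 2) *\<^sub>R dv (dv huv) (u, v)" for s t
    have d0: "0 \<le> d" using ab by linarith
    have "norm ((h (u + a, v + b) - P a b) - (h (u + a, v + 0) - P a 0) - (h (u + 0, v + b) - P 0 b)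
        + (h (u + 0, v + 0) - P 0 0)) \<le> (C * d ^ 3) * (\<bar>a\<bar> * \<bar>b\<bar>)"
    proof (rule rectangle_mvt[where h = "\<lambda>s t. h (u + s, v + t) - P s t"])
      fix s t assume st: "s \<in> closed_segment 0 a" "t \<in> closed_segment 0 b"
      have st': "\<bar>s\<bar> \<le> d" "\<bar>t\<bar> \<le> d"
        using closed_segment_0_abs[OF st(1)] closed_segment_0_abs[OF st(2)] ab by auto
      have q: "(u + s, v + t) \<in> cball 0 \<rho>" using shift_in_cball[OF p, of s t] st' d by linarith
      then have qU: "(u + s, v + t) \<in> U" using U by blast
      have "((\<lambda>s. P s t) has_vector_derivative Ps s t) (at s within closed_segment 0 a)"
        unfolding P_def Ps_def has_vector_derivative_def
        by (auto intro!: derivative_eq_intros simp: algebra_simps eval_nat_numeral scaleR_add_left)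
      then show "((\<lambda>s. h (u + s, v + t) - P s t) has_vector_derivative hu (u + s, v + t) - Ps s t)
          (at s within closed_segment 0 a)"
        by (rule has_vector_derivative_diff[OF smooth_on_slice_u[OF smooth qU]])
      have "((\<lambda>t. Ps s t) has_vector_derivative Pst s t) (at t within closed_segment 0 b)"
        unfolding Pst_def Ps_def has_vector_derivative_def
        by (auto intro!: derivative_eq_intros simp: algebra_simps eval_nat_numeral)
      then show "((\<lambda>t. hu (u + s, v + t) - Ps s t) has_vector_derivative huv (u + s, v + t) - Pst s t)
          (at t within closed_segment 0 b)"
        using has_vector_derivative_diff[OF smooth_on_slice_v[OF smooths(1) qU]] by blast
      show "norm (huv (u + s, v + t) - Pst s t) \<le> C * d ^ 3"
        using C(2)[OF _ q st'] p rho by (simp add: Pst_def algebra_simps)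
    qed
    also have "\<dots> \<le> (C * d ^ 3) * (d * d)"
      using ab C(1) d0 by (intro mult_left_mono mult_mono) auto
    finally show ?thesis by (simp add: P_def algebra_simps eval_nat_numeral)
  qed
  then show ?thesis using C(1) by blast
qed

text \<open>The effect of displacing the corner \<open>(a, b)\<close> by \<open>(x, y)\<close>, with
  the gradient at the corner replaced by its first-order expansion at the base vertex. The remainder
  is \<open>d\<^sup>2\<close> per unit of displacement, so displacements of size
  \<open>\<epsilon> ^ 3 * M\<close> cost \<open>\<epsilon> ^ 5 * M\<close>.\<close>

lemma vertex_taylor:
  "\<exists>C>0. \<forall>u v a b x y d. norm (u, v) \<le> 1 \<longrightarrow> 4 * d \<le> \<rho> - 1 \<longrightarrow> d \<le> 1 \<longrightarrow> \<bar>a\<bar> \<le> d \<longrightarrow> \<bar>b\<bar> \<le> d \<longrightarrow>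
      \<bar>x\<bar> \<le> d\<^sup>2 \<longrightarrow> \<bar>y\<bar> \<le> d\<^sup>2 \<longrightarrow>
    norm (h (u + (a + x), v + (b + y)) - h (u + a, v + b)
      - x *\<^sub>R (hu (u, v) + a *\<^sub>R huu (u, v) + b *\<^sub>R huv (u, v))
      - y *\<^sub>R (hv (u, v) + a *\<^sub>R huv (u, v) + b *\<^sub>R hvv (u, v))) \<le> C * d\<^sup>2 * (\<bar>x\<bar> + \<bar>y\<bar>)"
proof -
  obtain C1 where C1: "C1 > 0" "\<And>u v x y d. (u, v) \<in> cball 0 \<rho> \<Longrightarrow> (u + x, v + y) \<in> cball 0 \<rho> \<Longrightarrow> \<bar>x\<bar> \<le> d \<Longrightarrow> \<bar>y\<bar> \<le> d \<Longrightarrow>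
    norm (hu (u + x, v + y) - hu (u, v) - x *\<^sub>R huu (u, v) - y *\<^sub>R huv (u, v)) \<le> C1 * d ^ 2"
    using smooth_on_taylor1[OF _ K, of hu] by blast
  obtain C2 where C2: "C2 > 0" "\<And>u v x y d. (u, v) \<in> cball 0 \<rho> \<Longrightarrow> (u + x, v + y) \<in> cball 0 \<rho> \<Longrightarrow> \<bar>x\<bar> \<le> d \<Longrightarrow> \<bar>y\<bar> \<le> d \<Longrightarrow>
    norm (hv (u + x, v + y) - hv (u, v) - x *\<^sub>R du hv (u, v) - y *\<^sub>R hvv (u, v)) \<le> C2 * d ^ 2"
    using smooth_on_taylor1[OF _ K, of hv] by blast
  obtain B1 where B1: "B1 > 0" "\<And>p. p \<in> cball 0 \<rho> \<Longrightarrow> norm (huu p) \<le> B1"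
    using smooth_on_bounded[OF _ K(1,3), of huu] by blast
  obtain B2 where B2: "B2 > 0" "\<And>p. p \<in> cball 0 \<rho> \<Longrightarrow> norm (huv p) \<le> B2"
    using smooth_on_bounded[OF _ K(1,3), of huv] by blast
  obtain B3 where B3: "B3 > 0" "\<And>p. p \<in> cball 0 \<rho> \<Longrightarrow> norm (hvv p) \<le> B3"
    using smooth_on_bounded[OF _ K(1,3), of hvv] by blast
  define B where "B = B1 + B2 + B3"
  have B: "B > 0" "\<And>p. p \<in> cball 0 \<rho> \<Longrightarrow> norm (huu p) \<le> B"
    "\<And>p. p \<in> cball 0 \<rho> \<Longrightarrow> norm (huv p) \<le> B" "\<And>p. p \<in> cball 0 \<rho> \<Longrightarrow> norm (hvv p) \<le> B"
    using B1(1) B2(1) B3(1) B1(2) B2(2) B3(2) unfolding B_def by (smt (verit))+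
  define C where "C = 4 * (C1 + C2) + 2 * B"
  have "norm (h (u + (a + x), v + (b + y)) - h (u + a, v + b)
      - x *\<^sub>R (hu (u, v) + a *\<^sub>R huu (u, v) + b *\<^sub>R huv (u, v))
      - y *\<^sub>R (hv (u, v) + a *\<^sub>R huv (u, v) + b *\<^sub>R hvv (u, v))) \<le> C * d\<^sup>2 * (\<bar>x\<bar> + \<bar>y\<bar>)"
    if p: "norm (u, v) \<le> 1" and d: "4 * d \<le> \<rho> - 1" "d \<le> 1" and ab: "\<bar>a\<bar> \<le> d" "\<bar>b\<bar> \<le> d"
      and xy: "\<bar>x\<bar> \<le> d\<^sup>2" "\<bar>y\<bar> \<le> d\<^sup>2" for u v a b x y d
  proof -
    have d0: "0 \<le> d" using ab by linarith
    have dd: "d\<^sup>2 \<le> d" using d0 d(2) by (simp add: power2_eq_square mult_left_le)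
    have pK: "(u, v) \<in> cball 0 \<rho>" using p rho by simp
    define P where "P = hu (u, v) + a *\<^sub>R huu (u, v) + b *\<^sub>R huv (u, v)"
    define Q where "Q = hv (u, v) + a *\<^sub>R huv (u, v) + b *\<^sub>R hvv (u, v)"
    let ?q = "\<lambda>t. (u + a + t * x, v + b + t * y)"
    have "norm ((h (?q 1) - 1 *\<^sub>R (x *\<^sub>R P + y *\<^sub>R Q)) - (h (?q 0) - 0 *\<^sub>R (x *\<^sub>R P + y *\<^sub>R Q)))
        \<le> (C * d\<^sup>2 * (\<bar>x\<bar> + \<bar>y\<bar>)) * \<bar>1\<bar>"
    proof (rule segment_mvt)
      fix t assume t: "t \<in> closed_segment 0 (1::real)"
      have tx: "\<bar>t * x\<bar> \<le> d\<^sup>2" "\<bar>t * y\<bar> \<le> d\<^sup>2"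
        using closed_segment_0_abs[OF t] xy mult_mono[of "\<bar>t\<bar>" 1 "\<bar>x\<bar>" "d\<^sup>2"] mult_mono[of "\<bar>t\<bar>" 1 "\<bar>y\<bar>" "d\<^sup>2"]
        by (auto simp: abs_mult)
      have atx: "\<bar>a + t * x\<bar> \<le> 2 * d" "\<bar>b + t * y\<bar> \<le> 2 * d" using tx ab dd by linarith+
      then have q: "(u + (a + t * x), v + (b + t * y)) \<in> cball 0 \<rho>"
        using shift_in_cball[OF p, of "a + t * x" "b + t * y"] d by linarith
      then have q': "?q t \<in> cball 0 \<rho>" by (simp add: add.assoc)
      have lin: "norm ((t * x) *\<^sub>R V + (t * y) *\<^sub>R W) \<le> 2 * d\<^sup>2 * B" if "norm V \<le> B" "norm W \<le> B" for V W :: 'a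
        using norm_scaleR_add_le[OF that tx] .
      let ?R = "hu (?q t) - hu (u, v) - (a + t * x) *\<^sub>R huu (u, v) - (b + t * y) *\<^sub>R huv (u, v)"
      let ?S = "hv (?q t) - hv (u, v) - (a + t * x) *\<^sub>R huv (u, v) - (b + t * y) *\<^sub>R hvv (u, v)"
      have "norm ?R \<le> 4 * C1 * d\<^sup>2" "norm ?S \<le> 4 * C2 * d\<^sup>2"
        using C1(2)[OF pK q atx] C2(2)[OF pK q atx] mixed_du_dv[OF pK]
        by (simp_all add: power_mult_distrib add.assoc)
      moreover have "norm (hu (?q t) - P) \<le> norm ?R + norm ((t * x) *\<^sub>R huu (u, v) + (t * y) *\<^sub>R huv (u, v))"
        by (rule order_trans[OF _ norm_triangle_ineq]) (simp add: P_def algebra_simps)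
      moreover have "norm (hv (?q t) - Q) \<le> norm ?S + norm ((t * x) *\<^sub>R huv (u, v) + (t * y) *\<^sub>R hvv (u, v))"
        by (rule order_trans[OF _ norm_triangle_ineq]) (simp add: Q_def algebra_simps)
      moreover have "C1 * d\<^sup>2 \<ge> 0" "C2 * d\<^sup>2 \<ge> 0" using C1(1) C2(1) by auto
      ultimately have PQ: "norm (hu (?q t) - P) \<le> C * d\<^sup>2" "norm (hv (?q t) - Q) \<le> C * d\<^sup>2"
        using lin[OF B(2,3)[OF pK]] lin[OF B(3,4)[OF pK]] unfolding C_def by (auto simp: algebra_simps)
      have "norm (x *\<^sub>R (hu (?q t) - P) + y *\<^sub>R (hv (?q t) - Q))
          \<le> \<bar>x\<bar> * norm (hu (?q t) - P) + \<bar>y\<bar> * norm (hv (?q t) - Q)"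
        using norm_triangle_ineq[of "x *\<^sub>R (hu (?q t) - P)" "y *\<^sub>R (hv (?q t) - Q)"] by simp
      also have "\<dots> \<le> \<bar>x\<bar> * (C * d\<^sup>2) + \<bar>y\<bar> * (C * d\<^sup>2)"
        using PQ by (intro add_mono mult_left_mono) auto
      finally show "norm (x *\<^sub>R hu (?q t) + y *\<^sub>R hv (?q t) - (x *\<^sub>R P + y *\<^sub>R Q)) \<le> C * d\<^sup>2 * (\<bar>x\<bar> + \<bar>y\<bar>)"
        by (simp add: algebra_simps)
      show "((\<lambda>t. h (?q t) - t *\<^sub>R (x *\<^sub>R P + y *\<^sub>R Q)) has_vector_derivative
          x *\<^sub>R hu (?q t) + y *\<^sub>R hv (?q t) - (x *\<^sub>R P + y *\<^sub>R Q)) (at t within closed_segment 0 1)"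
        by (rule has_vector_derivative_diff[OF smooth_on_line[OF smooth]])
          (use q' U in \<open>auto simp: has_vector_derivative_def intro!: derivative_eq_intros\<close>)
    qed
    then show ?thesis by (simp add: P_def Q_def algebra_simps)
  qed
  then show ?thesis using C1(1) C2(1) B(1) unfolding C_def
    by (intro exI[of _ "4 * (C1 + C2) + 2 * B"]) auto
qed

text \<open>A remainder of order 4 is enough here, since edges enter the defect multiplied by
  multipliers of size \<open>O(\<epsilon>)\<close>.\<close>

lemma edge_taylor:
  "\<exists>C>0. \<forall>u v a. norm (u, v) \<le> 1 \<longrightarrow> \<bar>a\<bar> \<le> \<rho> - 1 \<longrightarrow>
    norm (h (u + a, v) - h (u, v) - a *\<^sub>R hu (u, v) - (a\<^sup>2 / 2) *\<^sub>R huu (u, v) - (a ^ 3 / 6) *\<^sub>R huuu (u, v)) \<le> C * \<bar>a\<bar> ^ 4 \<and>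
    norm (h (u, v + a) - h (u, v) - a *\<^sub>R hv (u, v) - (a\<^sup>2 / 2) *\<^sub>R hvv (u, v) - (a ^ 3 / 6) *\<^sub>R hvvv (u, v)) \<le> C * \<bar>a\<bar> ^ 4"
proof -
  obtain L1 where L1: "L1 > 0" "\<And>p q. p \<in> cball 0 \<rho> \<Longrightarrow> q \<in> cball 0 \<rho> \<Longrightarrow> norm (huuu p - huuu q) \<le> L1 * norm (p - q)"
    using smooth_on_lipschitz[OF _ K, of huuu] by blast
  obtain L2 where L2: "L2 > 0" "\<And>p q. p \<in> cball 0 \<rho> \<Longrightarrow> q \<in> cball 0 \<rho> \<Longrightarrow> norm (hvvv p - hvvv q) \<le> L2 * norm (p - q)"
    using smooth_on_lipschitz[OF _ K, of hvvv] by blast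
  have "norm (h (u + a, v) - h (u, v) - a *\<^sub>R hu (u, v) - (a\<^sup>2 / 2) *\<^sub>R huu (u, v) - (a ^ 3 / 6) *\<^sub>R huuu (u, v)) \<le> L1 * \<bar>a\<bar> ^ 4"
    "norm (h (u, v + a) - h (u, v) - a *\<^sub>R hv (u, v) - (a\<^sup>2 / 2) *\<^sub>R hvv (u, v) - (a ^ 3 / 6) *\<^sub>R hvvv (u, v)) \<le> L2 * \<bar>a\<bar> ^ 4"
    if p: "norm (u, v) \<le> 1" and a: "\<bar>a\<bar> \<le> \<rho> - 1" for u v a
  proof -
    have pK: "(u, v) \<in> cball 0 \<rho>" using p rho by simp
    have q: "(u + t, v) \<in> cball 0 \<rho>" "(u, v + t) \<in> cball 0 \<rho>" if "t \<in> closed_segment 0 a" for t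
      using shift_in_cball[OF p, of t 0] shift_in_cball[OF p, of 0 t] closed_segment_0_abs[OF that] a by auto
    have "norm (h (u + a, v) - h (u + 0, v) - a *\<^sub>R hu (u + 0, v) - (a\<^sup>2 / 2) *\<^sub>R huu (u + 0, v)
        - (a ^ 3 / 6) *\<^sub>R huuu (u + 0, v)) \<le> L1 * \<bar>a\<bar> ^ 4"
    proof (rule taylor3_segment)
      fix t assume t: "t \<in> closed_segment 0 a"
      have qU: "(u + t, v) \<in> U" using q(1)[OF t] U by blast
      show "((\<lambda>t. h (u + t, v)) has_vector_derivative hu (u + t, v)) (at t within closed_segment 0 a)"
        "((\<lambda>t. hu (u + t, v)) has_vector_derivative huu (u + t, v)) (at t within closed_segment 0 a)"
        "((\<lambda>t. huu (u + t, v)) has_vector_derivative huuu (u + t, v)) (at t within closed_segment 0 a)"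
        using qU smooth by (auto intro: smooth_on_slice_u)
      show "norm (huuu (u + t, v) - huuu (u + 0, v)) \<le> L1 * \<bar>t\<bar>"
        using L1(2)[OF q(1)[OF t] pK] norm_pair_le[of t 0] L1(1)
        by (simp add: norm_Pair)
    qed (use L1 in auto)
    moreover have "norm (h (u, v + a) - h (u, v + 0) - a *\<^sub>R hv (u, v + 0) - (a\<^sup>2 / 2) *\<^sub>R hvv (u, v + 0)
        - (a ^ 3 / 6) *\<^sub>R hvvv (u, v + 0)) \<le> L2 * \<bar>a\<bar> ^ 4"
    proof (rule taylor3_segment)
      fix t assume t: "t \<in> closed_segment 0 a"
      have qU: "(u, v + t) \<in> U" using q(2)[OF t] U by blast
      show "((\<lambda>t. h (u, v + t)) has_vector_derivative hv (u, v + t)) (at t within closed_segment 0 a)"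
        "((\<lambda>t. hv (u, v + t)) has_vector_derivative hvv (u, v + t)) (at t within closed_segment 0 a)"
        "((\<lambda>t. hvv (u, v + t)) has_vector_derivative hvvv (u, v + t)) (at t within closed_segment 0 a)"
        using qU smooth by (auto intro: smooth_on_slice_v)
      show "norm (hvvv (u, v + t) - hvvv (u, v + 0)) \<le> L2 * \<bar>t\<bar>"
        using L2(2)[OF q(2)[OF t] pK] L2(1) by (simp add: norm_Pair)
    qed (use L2 in auto)
    ultimately show "norm (h (u + a, v) - h (u, v) - a *\<^sub>R hu (u, v) - (a\<^sup>2 / 2) *\<^sub>R huu (u, v) - (a ^ 3 / 6) *\<^sub>R huuu (u, v)) \<le> L1 * \<bar>a\<bar> ^ 4"
    "norm (h (u, v + a) - h (u, v) - a *\<^sub>R hv (u, v) - (a\<^sup>2 / 2) *\<^sub>R hvv (u, v) - (a ^ 3 / 6) *\<^sub>R hvvv (u, v)) \<le> L2 * \<bar>a\<bar> ^ 4"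
      by simp_all
  qed
  moreover have "L1 * \<bar>a\<bar> ^ 4 \<le> (L1 + L2) * \<bar>a\<bar> ^ 4" "L2 * \<bar>a\<bar> ^ 4 \<le> (L1 + L2) * \<bar>a\<bar> ^ 4" for a :: real
    using L1(1) L2(1) by (auto intro!: mult_right_mono)
  ultimately show ?thesis using L1(1) L2(1)
    by (intro exI[of _ "L1 + L2"]) (meson add_pos_pos order_trans)
qed

end

section \<open>Conjugate nets in four-dimensional space\<close>

text \<open>The regularity required of the coefficients. Together with the bound, the Lipschitz
  property is stable under products and under passage to frame coordinates, so the coefficients
  never have to be differentiated.\<close>

definition bdd_lipschitz :: "('a::real_normed_vector \<Rightarrow> 'b::real_normed_vector) \<Rightarrow> 'a set \<Rightarrow> bool" where
  "bdd_lipschitz f S \<longleftrightarrow>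
    (\<exists>L>0. \<forall>p\<in>S. norm (f p) \<le> L \<and> (\<forall>q\<in>S. norm (f p - f q) \<le> L * norm (p - q)))"

lemma bdd_lipschitzI:
  assumes "\<And>p. p \<in> S \<Longrightarrow> norm (f p) \<le> B" "\<And>p q. p \<in> S \<Longrightarrow> q \<in> S \<Longrightarrow> norm (f p - f q) \<le> L * norm (p - q)"
  shows "bdd_lipschitz f S"
proof -
  have "norm (f p - f q) \<le> (\<bar>B\<bar> + \<bar>L\<bar> + 1) * norm (p - q)" if "p \<in> S" "q \<in> S" for p q
    by (rule order_trans[OF assms(2)[OF that]], rule mult_right_mono) auto
  moreover have "norm (f p) \<le> \<bar>B\<bar> + \<bar>L\<bar> + 1" if "p \<in> S" for p
    using assms(1)[OF that] by linarith
  ultimately show ?thesis unfolding bdd_lipschitz_def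
    by (intro exI[of _ "\<bar>B\<bar> + \<bar>L\<bar> + 1"]) auto
qed

lemma bdd_lipschitzE:
  assumes "bdd_lipschitz f S"
  obtains L where "L > 0" "\<And>p. p \<in> S \<Longrightarrow> norm (f p) \<le> L"
    "\<And>p q. p \<in> S \<Longrightarrow> q \<in> S \<Longrightarrow> norm (f p - f q) \<le> L * norm (p - q)"
  using assms unfolding bdd_lipschitz_def by blast

lemma bdd_lipschitz_bounded_linear:
  assumes "bounded_linear T" "bdd_lipschitz f S"
  shows "bdd_lipschitz (\<lambda>p. T (f p)) S"
proof -
  obtain L where L: "L > 0" "\<And>p. p \<in> S \<Longrightarrow> norm (f p) \<le> L"
    "\<And>p q. p \<in> S \<Longrightarrow> q \<in> S \<Longrightarrow> norm (f p - f q) \<le> L * norm (p - q)"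
    using assms(2) by (rule bdd_lipschitzE) blast
  obtain K where K: "\<And>x. norm (T x) \<le> norm x * K" "K > 0"
    using bounded_linear.pos_bounded[OF assms(1)] by blast
  show ?thesis
  proof (rule bdd_lipschitzI)
    show "norm (T (f p)) \<le> L * K" if "p \<in> S" for p
      using K(1)[of "f p"] L(2)[OF that] K(2) by (meson mult_right_mono order_trans less_imp_le)
    show "norm (T (f p) - T (f q)) \<le> (L * K) * norm (p - q)" if "p \<in> S" "q \<in> S" for p q
    proof -
      have "norm (T (f p) - T (f q)) = norm (T (f p - f q))"
        using assms(1) by (simp add: bounded_linear.linear linear_diff)
      also have "\<dots> \<le> norm (f p - f q) * K" by (rule K)
      also have "\<dots> \<le> (L * norm (p - q)) * K" using L(3)[OF that] K(2) by (intro mult_right_mono) auto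
      finally show ?thesis by (simp add: mult_ac)
    qed
  qed
qed

lemma bdd_lipschitz_add:
  assumes "bdd_lipschitz f S" "bdd_lipschitz g S"
  shows "bdd_lipschitz (\<lambda>p. f p + g p) S"
proof -
  obtain L1 where L1: "L1 > 0" "\<And>p. p \<in> S \<Longrightarrow> norm (f p) \<le> L1"
    "\<And>p q. p \<in> S \<Longrightarrow> q \<in> S \<Longrightarrow> norm (f p - f q) \<le> L1 * norm (p - q)"
    using assms(1) by (rule bdd_lipschitzE) blast
  obtain L2 where L2: "L2 > 0" "\<And>p. p \<in> S \<Longrightarrow> norm (g p) \<le> L2"
    "\<And>p q. p \<in> S \<Longrightarrow> q \<in> S \<Longrightarrow> norm (g p - g q) \<le> L2 * norm (p - q)"
    using assms(2) by (rule bdd_lipschitzE) blast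
  show ?thesis
  proof (rule bdd_lipschitzI)
    show "norm (f p + g p) \<le> L1 + L2" if "p \<in> S" for p
      using L1(2)[OF that] L2(2)[OF that] norm_triangle_ineq[of "f p" "g p"] by linarith
    show "norm (f p + g p - (f q + g q)) \<le> (L1 + L2) * norm (p - q)" if "p \<in> S" "q \<in> S" for p q
      using L1(3)[OF that] L2(3)[OF that] norm_triangle_ineq[of "f p - f q" "g p - g q"]
      by (simp add: algebra_simps)
  qed
qed

lemma bdd_lipschitz_scaleR:
  assumes "bdd_lipschitz f S" "bdd_lipschitz g S"
  shows "bdd_lipschitz (\<lambda>p. f p *\<^sub>R g p) S"
proof -
  obtain L1 where L1: "L1 > 0" "\<And>p. p \<in> S \<Longrightarrow> norm (f p) \<le> L1"
    "\<And>p q. p \<in> S \<Longrightarrow> q \<in> S \<Longrightarrow> norm (f p - f q) \<le> L1 * norm (p - q)"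
    using assms(1) by (rule bdd_lipschitzE) blast
  obtain L2 where L2: "L2 > 0" "\<And>p. p \<in> S \<Longrightarrow> norm (g p) \<le> L2"
    "\<And>p q. p \<in> S \<Longrightarrow> q \<in> S \<Longrightarrow> norm (g p - g q) \<le> L2 * norm (p - q)"
    using assms(2) by (rule bdd_lipschitzE) blast
  show ?thesis
  proof (rule bdd_lipschitzI)
    show "norm (f p *\<^sub>R g p) \<le> L1 * L2" if "p \<in> S" for p
      using L1(2)[OF that] L2(2)[OF that] L1(1) by (simp add: mult_mono)
    show "norm (f p *\<^sub>R g p - f q *\<^sub>R g q) \<le> (2 * L1 * L2) * norm (p - q)" if pq: "p \<in> S" "q \<in> S" for p q
    proof -
      have "f p *\<^sub>R g p - f q *\<^sub>R g q = (f p - f q) *\<^sub>R g p + f q *\<^sub>R (g p - g q)"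
        by (simp add: algebra_simps)
      then have "norm (f p *\<^sub>R g p - f q *\<^sub>R g q) \<le> \<bar>f p - f q\<bar> * norm (g p) + \<bar>f q\<bar> * norm (g p - g q)"
        by (metis norm_scaleR norm_triangle_ineq)
      also have "\<dots> \<le> (L1 * norm (p - q)) * L2 + L1 * (L2 * norm (p - q))"
        using L1 L2 pq by (intro add_mono mult_mono) (auto simp: order_less_imp_le)
      finally show ?thesis by (simp add: algebra_simps)
    qed
  qed
qed

text \<open>One constant for a whole list of functions; being at least 1 it also absorbs numerical
  constants and lower powers of itself.\<close>

lemma common_bound:
  assumes "\<forall>f\<in>set fs. bdd_lipschitz f S"
  shows "\<exists>B\<ge>1. \<forall>f\<in>set fs. \<forall>p\<in>S. norm (f p) \<le> B"
  using assms
proof (induction fs)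
  case (Cons f fs)
  then obtain B where B: "1 \<le> B" "\<forall>f\<in>set fs. \<forall>p\<in>S. norm (f p) \<le> B" by auto
  obtain L where L: "\<And>p. p \<in> S \<Longrightarrow> norm (f p) \<le> L"
    using Cons.prems unfolding bdd_lipschitz_def by (metis list.set_intros(1))
  show ?case
    by (rule exI[of _ "max B L"]) (use B L in \<open>auto intro: max.coboundedI1 max.coboundedI2\<close>)
qed auto

lemma bdd_lipschitz_const: "bdd_lipschitz (\<lambda>_. c) S"
  by (rule bdd_lipschitzI[where B = "norm c" and L = 0]) auto

lemma bdd_lipschitz_scaleR_const: "bdd_lipschitz f S \<Longrightarrow> bdd_lipschitz (\<lambda>p. c *\<^sub>R f p) S"
  by (rule bdd_lipschitz_scaleR[OF bdd_lipschitz_const])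

lemma bdd_lipschitz_diff:
  assumes "bdd_lipschitz f S" "bdd_lipschitz g S"
  shows "bdd_lipschitz (\<lambda>p. f p - g p) S"
  using bdd_lipschitz_add[OF assms(1) bdd_lipschitz_scaleR_const[OF assms(2), of "-1"]] by simp

lemma bdd_lipschitz_mult:
  fixes f g :: "_ \<Rightarrow> real"
  assumes "bdd_lipschitz f S" "bdd_lipschitz g S"
  shows "bdd_lipschitz (\<lambda>p. f p * g p) S"
  using bdd_lipschitz_scaleR[OF assms] by simp

lemma bdd_lipschitz_fst: "bdd_lipschitz f S \<Longrightarrow> bdd_lipschitz (\<lambda>p. fst (f p)) S"
  and bdd_lipschitz_snd: "bdd_lipschitz f S \<Longrightarrow> bdd_lipschitz (\<lambda>p. snd (f p)) S"
  using bdd_lipschitz_bounded_linear bounded_linear_fst bounded_linear_snd by blast+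

lemmas bdd_lipschitz_intros = bdd_lipschitz_const bdd_lipschitz_add bdd_lipschitz_diff
  bdd_lipschitz_scaleR bdd_lipschitz_mult bdd_lipschitz_fst bdd_lipschitz_snd

text \<open>The equations for \<open>du huv\<close> and \<open>dv huv\<close> are the derivatives of the first one (the Laplace equation);
  listing them spares any differentiability assumption on its coefficients \<open>A\<close> and \<open>B\<close>.\<close>

locale conjugate_net = smooth_near_disk h U \<rho>
  for h :: "real \<times> real \<Rightarrow> 'a::euclidean_space" and U \<rho> +
  assumes dim4: "DIM('a) = 4"
    and indep: "\<And>p x1 x2 x3 x4. p \<in> cball 0 1 \<Longrightarrow>
      x1 *\<^sub>R hu p + x2 *\<^sub>R hv p + x3 *\<^sub>R huu p + x4 *\<^sub>R hvv p = 0 \<Longrightarrow> x1 = 0 \<and> x2 = 0 \<and> x3 = 0 \<and> x4 = 0"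
    and conj: "\<And>p. p \<in> ball 0 1 \<Longrightarrow> \<exists>A B g1 g2 k1 k2. huv p = A *\<^sub>R hu p + B *\<^sub>R hv p \<and>
      du huv p = g1 *\<^sub>R hu p + g2 *\<^sub>R hv p + A *\<^sub>R huu p \<and>
      dv huv p = k1 *\<^sub>R hu p + k2 *\<^sub>R hv p + B *\<^sub>R hvv p"
begin

section \<open>The moving frame and its coordinates\<close>

definition frame :: "real \<times> real \<Rightarrow> real \<times> real \<times> real \<times> real \<Rightarrow> 'a" where
  "frame p x = fst x *\<^sub>R hu p + fst (snd x) *\<^sub>R hv p + fst (snd (snd x)) *\<^sub>R huu p + snd (snd (snd x)) *\<^sub>R hvv p"

definition coord :: "real \<times> real \<Rightarrow> 'a \<Rightarrow> real \<times> real \<times> real \<times> real" where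
  "coord p = inv (frame p)"

lemma linear_frame: "linear (frame p)"
  by (rule linearI) (simp_all add: frame_def algebra_simps)

text \<open>Independence gives injectivity, and \<open>dim4\<close> makes an injective linear map
  from four-space onto.\<close>

lemma bij_frame:
  assumes "p \<in> cball 0 1"
  shows "bij (frame p)"
proof -
  have inj: "inj (frame p)"
    using indep[OF assms] unfolding linear_injective_0[OF linear_frame]
    by (fastforce simp: frame_def prod_eq_iff)
  have "dim (range (frame p)) = dim (UNIV :: (real \<times> real \<times> real \<times> real) set)"
    using dim_image_eq[OF linear_frame inj_on_subset[OF inj]] by blast
  then have "dim (range (frame p)) = DIM('a)"
    by (simp add: dim4)
  moreover have "subspace (range (frame p))"
    using linear_frame linear_subspace_image subspace_UNIV by blast
  ultimately have "range (frame p) = UNIV"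
    by (metis dim_eq_full span_eq_iff)
  then show ?thesis using inj by (simp add: bij_def)
qed

lemma frame_coord: "p \<in> cball 0 1 \<Longrightarrow> frame p (coord p y) = y"
  unfolding coord_def using bij_frame by (meson bij_is_surj surj_f_inv_f)

lemma coord_frame: "p \<in> cball 0 1 \<Longrightarrow> coord p (frame p x) = x"
  unfolding coord_def using bij_frame by (meson bij_is_inj inv_f_f)

lemma coord_eqI: "p \<in> cball 0 1 \<Longrightarrow> frame p x = y \<Longrightarrow> coord p y = x"
  using coord_frame by blast

lemma linear_coord: "p \<in> cball 0 1 \<Longrightarrow> linear (coord p)"
  by (rule linearI; rule coord_eqI)
    (simp_all add: frame_coord linear_add[OF linear_frame] linear_cmul[OF linear_frame])

lemma continuous_on_smooths:
  assumes "smooth_on f U"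
  shows "continuous_on (cball 0 1) f"
  using smooth_on_continuous_on[OF assms] U rho
  by (meson continuous_on_subset less_imp_le order_trans subset_cball)

text \<open>A continuous positive function on the compact product of the disk and the unit sphere
  has a positive minimum; homogeneity extends the bound to all \<open>x\<close>.\<close>

lemma frame_bounded_below: "\<exists>m>0. \<forall>p\<in>cball 0 1. \<forall>x. m * norm x \<le> norm (frame p x)"
proof -
  let ?S = "cball (0::real \<times> real) 1 \<times> sphere (0::real \<times> real \<times> real \<times> real) 1"
  have ne: "(1, 0, 0, 0) \<in> sphere (0::real \<times> real \<times> real \<times> real) 1"
    by (simp add: norm_Pair)
  have "compact ?S" by (intro compact_Times) auto
  moreover have "?S \<noteq> {}" using ne by auto
  moreover have "continuous_on ?S (\<lambda>z. norm (frame (fst z) (snd z)))"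
  proof -
    have *: "continuous_on ?S (\<lambda>z. f (fst z))" if "smooth_on f U" for f :: "real \<times> real \<Rightarrow> 'a"
      by (rule continuous_on_compose2[OF continuous_on_smooths[OF that]]) (auto intro: continuous_intros)
    show ?thesis unfolding frame_def by (intro continuous_intros *) auto
  qed
  ultimately obtain z where z: "z \<in> ?S" "\<And>y. y \<in> ?S \<Longrightarrow> norm (frame (fst z) (snd z)) \<le> norm (frame (fst y) (snd y))"
    using continuous_attains_inf by meson
  let ?m = "norm (frame (fst z) (snd z))"
  have zz: "fst z \<in> cball 0 1" "norm (snd z) = 1" using z(1) by auto
  have "frame (fst z) (snd z) \<noteq> 0"
  proof
    assume "frame (fst z) (snd z) = 0"
    then have "coord (fst z) 0 = snd z" using coord_eqI[OF zz(1)] by blast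
    moreover have "coord (fst z) 0 = 0" using linear_coord[OF zz(1)] by (rule linear_0)
    ultimately show False using zz(2) by simp
  qed
  then have "?m > 0" by simp
  moreover have "?m * norm x \<le> norm (frame p x)" if p: "p \<in> cball 0 1" for p x
  proof (cases "x = 0")
    case False
    have "?m \<le> norm (frame p (x /\<^sub>R norm x))"
      using z(2)[of "(p, x /\<^sub>R norm x)"] p False by simp
    also have "\<dots> = norm (frame p x) / norm x"
      using linear_cmul[OF linear_frame, of p "inverse (norm x)" x] by (simp add: divide_inverse_commute)
    finally show ?thesis using False by (simp add: field_simps)
  qed auto
  ultimately show ?thesis by blast
qed

lemma coord_bounded: "\<exists>Q>0. \<forall>p\<in>cball 0 1. \<forall>y. norm (coord p y) \<le> Q * norm y"
proof -
  obtain m where m: "m > 0" "\<And>p x. p \<in> cball 0 1 \<Longrightarrow> m * norm x \<le> norm (frame p x)"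
    using frame_bounded_below by blast
  have "norm (coord p y) \<le> (1 / m) * norm y" if "p \<in> cball 0 1" for p y
    using m(2)[OF that, of "coord p y"] m(1) by (simp add: frame_coord[OF that] field_simps)
  then show ?thesis using m(1) by (intro exI[of _ "1 / m"]) auto
qed

lemma bdd_lipschitz_smooth:
  fixes f :: "real \<times> real \<Rightarrow> 'b::real_normed_vector"
  assumes "smooth_on f U"
  shows "bdd_lipschitz f (cball 0 1)"
proof -
  have sub: "cball 0 1 \<subseteq> U" using U rho by (meson less_imp_le order_trans subset_cball)
  obtain B where "\<And>p. p \<in> cball 0 1 \<Longrightarrow> norm (f p) \<le> B"
    using smooth_on_bounded[OF assms compact_cball sub] by blast
  moreover obtain L where "\<And>p q. p \<in> cball 0 1 \<Longrightarrow> q \<in> cball 0 1 \<Longrightarrow> norm (f p - f q) \<le> L * norm (p - q)"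
    using smooth_on_lipschitz[OF assms compact_cball convex_cball sub] by blast
  ultimately show ?thesis by (rule bdd_lipschitzI)
qed

text \<open>A resolvent identity replaces differentiation of the inverse matrix: the difference of
  the coordinates at \<open>p\<close> and \<open>q\<close> is \<open>coord p\<close> of an error
  made of \<open>Y p - Y q\<close> and of the change of the frame.\<close>

lemma bdd_lipschitz_coord:
  assumes "bdd_lipschitz Y (cball 0 1)"
  shows "bdd_lipschitz (\<lambda>p. coord p (Y p)) (cball 0 1)"
proof -
  obtain Q where Q: "Q > 0" "\<And>p y. p \<in> cball 0 1 \<Longrightarrow> norm (coord p y) \<le> Q * norm y"
    using coord_bounded by blast
  obtain L where L: "L > 0" "\<And>p. p \<in> cball 0 1 \<Longrightarrow> norm (Y p) \<le> L"
    "\<And>p q. p \<in> cball 0 1 \<Longrightarrow> q \<in> cball 0 1 \<Longrightarrow> norm (Y p - Y q) \<le> L * norm (p - q)"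
    using assms by (rule bdd_lipschitzE) blast
  have "\<exists>M>0. \<forall>p\<in>cball 0 1. \<forall>q\<in>cball 0 1. \<forall>x. norm (frame p x - frame q x) \<le> M * norm (p - q) * norm x"
  proof -
    have ex: "\<exists>L>0. \<forall>p\<in>cball 0 1. \<forall>q\<in>cball 0 1. norm (f p - f q) \<le> L * norm (p - q)"
      if "smooth_on f U" for f :: "real \<times> real \<Rightarrow> 'a"
      using bdd_lipschitz_smooth[OF that] unfolding bdd_lipschitz_def by blast
    obtain L1 where L1: "L1 > 0" "\<And>p q. p \<in> cball 0 1 \<Longrightarrow> q \<in> cball 0 1 \<Longrightarrow> norm (hu p - hu q) \<le> L1 * norm (p - q)"
      using ex[OF smooths(1)] by blast
    obtain L2 where L2: "L2 > 0" "\<And>p q. p \<in> cball 0 1 \<Longrightarrow> q \<in> cball 0 1 \<Longrightarrow> norm (hv p - hv q) \<le> L2 * norm (p - q)"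
      using ex[OF smooths(2)] by blast
    obtain L3 where L3: "L3 > 0" "\<And>p q. p \<in> cball 0 1 \<Longrightarrow> q \<in> cball 0 1 \<Longrightarrow> norm (huu p - huu q) \<le> L3 * norm (p - q)"
      using ex[OF smooths(3)] by blast
    obtain L4 where L4: "L4 > 0" "\<And>p q. p \<in> cball 0 1 \<Longrightarrow> q \<in> cball 0 1 \<Longrightarrow> norm (hvv p - hvv q) \<le> L4 * norm (p - q)"
      using ex[OF smooths(5)] by blast
    note LL = L1(1) L2(1) L3(1) L4(1) and lip = L1(2) L2(2) L3(2) L4(2)
    have "norm (frame p x - frame q x) \<le> (L1 + L2 + L3 + L4) * norm (p - q) * norm x"
      if pq: "p \<in> cball 0 1" "q \<in> cball 0 1" for p q x
    proof -
      obtain x1 x2 x3 x4 where x: "x = (x1, x2, x3, x4)" by (cases x) auto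
      have nx: "\<bar>x1\<bar> \<le> norm x" "\<bar>x2\<bar> \<le> norm x" "\<bar>x3\<bar> \<le> norm x" "\<bar>x4\<bar> \<le> norm x"
        unfolding x norm_Pair by (auto intro!: real_le_rsqrt simp: power2_eq_square)
      have eq: "frame p x - frame q x = x1 *\<^sub>R (hu p - hu q) + x2 *\<^sub>R (hv p - hv q)
          + x3 *\<^sub>R (huu p - huu q) + x4 *\<^sub>R (hvv p - hvv q)"
        by (simp add: x frame_def algebra_simps)
      have "norm (frame p x - frame q x) \<le> \<bar>x1\<bar> * norm (hu p - hu q) + \<bar>x2\<bar> * norm (hv p - hv q)
          + \<bar>x3\<bar> * norm (huu p - huu q) + \<bar>x4\<bar> * norm (hvv p - hvv q)"
        unfolding eq by (intro order_trans[OF norm_triangle_ineq] add_mono) auto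
      also have "\<dots> \<le> norm x * (L1 * norm (p - q)) + norm x * (L2 * norm (p - q))
          + norm x * (L3 * norm (p - q)) + norm x * (L4 * norm (p - q))"
        using lip[OF pq] nx by (intro add_mono mult_mono) auto
      finally show ?thesis by (simp add: algebra_simps)
    qed
    then show ?thesis using LL by (intro exI[of _ "L1 + L2 + L3 + L4"]) auto
  qed
  then obtain M where M: "M > 0" "\<And>p q x. p \<in> cball 0 1 \<Longrightarrow> q \<in> cball 0 1 \<Longrightarrow>
      norm (frame p x - frame q x) \<le> M * norm (p - q) * norm x" by blast
  have bd: "norm (coord p (Y p)) \<le> Q * L" if "p \<in> cball 0 1" for p
    using Q(2)[OF that, of "Y p"] L(2)[OF that] Q(1) by (meson mult_left_mono order_trans less_imp_le)
  show ?thesis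
  proof (rule bdd_lipschitzI[OF bd])
    fix p q assume pq: "p \<in> cball (0 :: real \<times> real) 1" "q \<in> cball (0 :: real \<times> real) 1"
    let ?y = "coord q (Y q)"
    have "coord p (Y p) - ?y = coord p (Y p - frame p ?y)"
      by (simp add: linear_diff[OF linear_coord[OF pq(1)]] coord_frame[OF pq(1)])
    also have "Y p - frame p ?y = (Y p - Y q) - (frame p ?y - frame q ?y)"
      by (simp add: frame_coord[OF pq(2)])
    finally have "norm (coord p (Y p) - ?y) \<le> Q * norm ((Y p - Y q) - (frame p ?y - frame q ?y))"
      using Q(2)[OF pq(1)] by simp
    also have "\<dots> \<le> Q * (L * norm (p - q) + M * norm (p - q) * (Q * L))"
    proof (rule mult_left_mono)
      have "norm ((Y p - Y q) - (frame p ?y - frame q ?y)) \<le> norm (Y p - Y q) + norm (frame p ?y - frame q ?y)"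
        by (rule norm_triangle_ineq4)
      also have "\<dots> \<le> L * norm (p - q) + M * norm (p - q) * (Q * L)"
        using M(1) by (intro add_mono L(3)[OF pq] order_trans[OF M(2)[OF pq, of ?y]]
            mult_left_mono[OF bd[OF pq(2)]]) auto
      finally show "norm ((Y p - Y q) - (frame p ?y - frame q ?y)) \<le> L * norm (p - q) + M * norm (p - q) * (Q * L)" .
    qed (use Q(1) in simp)
    finally show "norm (coord p (Y p) - coord q (Y q)) \<le> (Q * (L + M * (Q * L))) * norm (p - q)"
      by (simp add: algebra_simps)
  qed
qed

end

section \<open>The fourth vertex of a quadrilateral\<close>

lemma abs_mult_diff_le: "\<bar>x * y - x0 * y0\<bar> \<le> \<bar>x - x0\<bar> * \<bar>y\<bar> + \<bar>x0\<bar> * \<bar>y - y0\<bar>" for x y x0 y0 :: real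
proof -
  have "x * y - x0 * y0 = (x - x0) * y + x0 * (y - y0)" by (simp add: algebra_simps)
  then show ?thesis by (metis abs_mult abs_triangle_ineq)
qed

lemma abs_mult_le: "\<bar>x\<bar> \<le> a \<Longrightarrow> \<bar>y\<bar> \<le> b \<Longrightarrow> \<bar>x * y\<bar> \<le> a * b" for x y a b :: real
  unfolding abs_mult by (rule mult_mono) auto

text \<open>Powers of a number near a sign are near the corresponding powers of the sign, which
  reduce by \<open>\<sigma> * \<sigma> = 1\<close>. Multiplying one factor at a time gives the
  constants 5/2, 19/4 and 65/8, all below 10.\<close>

lemma near_sign_bounds:
  fixes x y \<sigma> \<tau> d :: real
  assumes "\<bar>\<sigma>\<bar> = 1" "\<bar>\<tau>\<bar> = 1" "\<bar>x - \<sigma>\<bar> \<le> d" "\<bar>y - \<tau>\<bar> \<le> d" "d \<le> 1 / 2"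
  shows "\<bar>x\<bar> \<le> 3 / 2" "1 / 2 \<le> \<bar>x\<bar>" "\<bar>x\<^sup>2 * y - \<tau>\<bar> \<le> 10 * d" "\<bar>x ^ 3 * y - \<sigma> * \<tau>\<bar> \<le> 10 * d"
    "\<bar>x\<^sup>2 * y\<^sup>2 - 1\<bar> \<le> 10 * d" "\<bar>1 / x - \<sigma>\<bar> \<le> 2 * d"
proof -
  have d: "0 \<le> d" using assms(3) by linarith
  show x: "\<bar>x\<bar> \<le> 3 / 2" and x': "1 / 2 \<le> \<bar>x\<bar>" using assms by linarith+
  have y: "\<bar>y\<bar> \<le> 3 / 2" using assms by linarith
  have ss: "\<sigma> * \<sigma> = 1" "\<tau> * \<tau> = 1" using assms(1,2) by (metis abs_mult_self_eq mult_1)+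
  have step: "\<bar>s * t - s0 * t0\<bar> \<le> c * (3 / 2) + e" if "\<bar>s - s0\<bar> \<le> c" "\<bar>t\<bar> \<le> 3 / 2" "\<bar>s0\<bar> = 1" "\<bar>t - t0\<bar> \<le> e"
    for s t s0 t0 c e :: real
  proof -
    have "\<bar>s - s0\<bar> * \<bar>t\<bar> \<le> c * (3 / 2)" using that by (intro mult_mono) auto
    then show ?thesis using abs_mult_diff_le[of s t s0 t0] that by simp
  qed
  have xy: "\<bar>x * y - \<sigma> * \<tau>\<bar> \<le> 5 / 2 * d" using step[OF assms(3) y assms(1,4)] by simp
  have "\<bar>\<sigma> * \<tau>\<bar> = 1" "\<bar>\<sigma> * \<tau> * \<sigma>\<bar> = 1" "\<bar>\<sigma> * \<tau> * \<sigma> * \<sigma>\<bar> = 1" using assms(1,2) by (simp_all add: abs_mult)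
  then have xyx: "\<bar>x * y * x - \<sigma> * \<tau> * \<sigma>\<bar> \<le> 19 / 4 * d"
    and xyy: "\<bar>x * y * y - \<sigma> * \<tau> * \<tau>\<bar> \<le> 19 / 4 * d"
    using step[OF xy x _ assms(3)] step[OF xy y _ assms(4)] by simp_all
  have x3: "\<bar>x * y * x * x - \<sigma> * \<tau> * \<sigma> * \<sigma>\<bar> \<le> 65 / 8 * d"
    using step[OF xyx x _ assms(3)] \<open>\<bar>\<sigma> * \<tau> * \<sigma>\<bar> = 1\<close> by simp
  have x22: "\<bar>x * y * x * y - \<sigma> * \<tau> * \<sigma> * \<tau>\<bar> \<le> 65 / 8 * d"
    using step[OF xyx y _ assms(4)] \<open>\<bar>\<sigma> * \<tau> * \<sigma>\<bar> = 1\<close> by simp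
  have s1: "\<sigma> * \<tau> * \<sigma> = \<tau>" and s2: "\<sigma> * \<tau> * \<sigma> * \<sigma> = \<sigma> * \<tau>" and s3: "\<sigma> * \<tau> * \<sigma> * \<tau> = 1"
    using ss by (metis mult.assoc mult.commute mult_1_right)+
  have e1: "x * y * x = x\<^sup>2 * y" and e2: "x * y * x * x = x ^ 3 * y" and e3: "x * y * x * y = x\<^sup>2 * y\<^sup>2"
    by (simp_all add: power2_eq_square power3_eq_cube)
  show "\<bar>x\<^sup>2 * y - \<tau>\<bar> \<le> 10 * d" "\<bar>x ^ 3 * y - \<sigma> * \<tau>\<bar> \<le> 10 * d" "\<bar>x\<^sup>2 * y\<^sup>2 - 1\<bar> \<le> 10 * d"
    using xyx[unfolded e1 s1] x3[unfolded e2 s2] x22[unfolded e3 s3] d by linarith+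
  have "x \<noteq> 0" using x' by auto
  then have "1 / x - \<sigma> = - \<sigma> * (x - \<sigma>) / x" using ss by (simp add: field_simps)
  then have "\<bar>1 / x - \<sigma>\<bar> = \<bar>x - \<sigma>\<bar> / \<bar>x\<bar>" using assms(1) by (simp add: abs_mult)
  also have "\<dots> \<le> d / (1 / 2)" using assms(3) x' d by (intro frac_le) auto
  finally show "\<bar>1 / x - \<sigma>\<bar> \<le> 2 * d" by simp
qed

text \<open>The tangential coefficients of the defect of a quadrilateral, divided by the cube of the mesh size.\<close>

definition tang :: "real \<Rightarrow> real \<Rightarrow> real \<Rightarrow> real \<Rightarrow> real \<Rightarrow> real \<Rightarrow> real \<Rightarrow> real \<Rightarrow> real \<Rightarrow> real \<Rightarrow> real \<Rightarrow> real \<Rightarrow> real \<Rightarrow> real" where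
  "tang A g k \<epsilon> X Y w z w' z' \<alpha> \<beta> \<alpha>1 = (X\<^sup>2 * Y * g + X * Y\<^sup>2 * k) / 2 + w' * (1 + \<epsilon> * Y * A) + z' * (\<epsilon> * X * A)
     - (1 + \<alpha>) * z * (\<epsilon> * X * A) - (1 + \<beta>) * w * (1 + \<epsilon> * Y * A) - \<alpha>1"

text \<open>Every dropped term carries either a deviation such as
  \<open>X\<^sup>2 * Y - \<tau>\<close> or a factor \<epsilon> together with at most one of the data
  \<open>w\<close>, \<open>z\<close>, \<open>w'\<close>, \<open>z'\<close>. The error is therefore
  linear in \<open>M\<close>.\<close>

lemma tang_approx:
  assumes "\<bar>\<sigma>\<bar> = 1" "\<bar>\<tau>\<bar> = 1" "\<bar>X - \<sigma>\<bar> \<le> \<epsilon> * M" "\<bar>Y - \<tau>\<bar> \<le> \<epsilon> * M" "\<epsilon> * M \<le> 1 / 2"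
    and \<epsilon>: "0 < \<epsilon>" "\<epsilon> \<le> 1" and M: "1 \<le> M" and B: "1 \<le> B" "\<bar>A\<bar> \<le> B" "\<bar>g\<bar> \<le> B" "\<bar>k\<bar> \<le> B"
    and w: "\<bar>w\<bar> \<le> M" "\<bar>z\<bar> \<le> M" "\<bar>w'\<bar> \<le> M" "\<bar>z'\<bar> \<le> M"
    and \<alpha>: "\<bar>\<alpha>\<bar> \<le> c * \<epsilon>" "\<bar>\<beta>\<bar> \<le> c * \<epsilon>"
  shows "\<bar>tang A g k \<epsilon> X Y w z w' z' \<alpha> \<beta> \<alpha>1 - ((\<tau> * g + \<sigma> * k) / 2 + w' - w - \<alpha>1)\<bar>
    \<le> (20 + 4 * c) * B * (\<epsilon> * M)"
proof -
  note nx = near_sign_bounds[OF assms(1-5)]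
  note ny = near_sign_bounds[OF assms(2,1,4,3,5)]
  have "0 \<le> c * \<epsilon>" using \<alpha>(1) by linarith
  then have c: "0 \<le> c" using \<epsilon>(1) by (simp add: zero_le_mult_iff)
  have c\<epsilon>: "c * \<epsilon> \<le> c" using c \<epsilon> by (simp add: mult_left_le)
  define E where "E = \<epsilon> * M"
  have E: "0 \<le> E" "\<epsilon> \<le> E" using \<epsilon> M by (auto simp: E_def mult_left_mono[of 1 M \<epsilon>, simplified])
  have 1: "\<bar>(X\<^sup>2 * Y - \<tau>) * g\<bar> \<le> (10 * E) * B" "\<bar>(Y\<^sup>2 * X - \<sigma>) * k\<bar> \<le> (10 * E) * B"
    using nx(3) ny(3) B by (auto intro!: abs_mult_le simp: E_def)
  have YA0: "\<bar>\<epsilon>\<bar> \<le> \<epsilon>" using \<epsilon> by simp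
  have YA: "\<bar>\<epsilon> * Y * A\<bar> \<le> \<epsilon> * (3 / 2) * B" "\<bar>\<epsilon> * X * A\<bar> \<le> \<epsilon> * (3 / 2) * B"
    by (intro abs_mult_le YA0 nx(1) ny(1) B(2))+
  have 3: "\<bar>w' * (\<epsilon> * Y * A)\<bar> \<le> M * (\<epsilon> * (3 / 2) * B)" "\<bar>z' * (\<epsilon> * X * A)\<bar> \<le> M * (\<epsilon> * (3 / 2) * B)"
    "\<bar>w * (\<epsilon> * Y * A)\<bar> \<le> M * (\<epsilon> * (3 / 2) * B)"
    by (intro abs_mult_le YA w)+
  have \<alpha>': "\<bar>1 + \<alpha>\<bar> \<le> 1 + c" "\<bar>\<beta>\<bar> \<le> c" using \<alpha> c\<epsilon> by linarith+
  have 4: "\<bar>((1 + \<alpha>) * z) * (\<epsilon> * X * A)\<bar> \<le> ((1 + c) * M) * (\<epsilon> * (3 / 2) * B)"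
    "\<bar>\<beta> * (w * (\<epsilon> * Y * A))\<bar> \<le> c * (M * (\<epsilon> * (3 / 2) * B))"
    by (intro abs_mult_le \<alpha>' w YA 3)+
  have 5: "\<bar>\<beta> * w\<bar> \<le> (c * \<epsilon>) * M" by (intro abs_mult_le \<alpha> w)
  have "tang A g k \<epsilon> X Y w z w' z' \<alpha> \<beta> \<alpha>1 - ((\<tau> * g + \<sigma> * k) / 2 + w' - w - \<alpha>1)
     = ((X\<^sup>2 * Y - \<tau>) * g) / 2 + ((Y\<^sup>2 * X - \<sigma>) * k) / 2 + w' * (\<epsilon> * Y * A) + z' * (\<epsilon> * X * A)
       - ((1 + \<alpha>) * z) * (\<epsilon> * X * A) - \<beta> * w - w * (\<epsilon> * Y * A) - \<beta> * (w * (\<epsilon> * Y * A))"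
    by (simp add: tang_def field_simps)
  also have "\<bar>\<dots>\<bar> \<le> (10 * E) * B / 2 + (10 * E) * B / 2 + M * (\<epsilon> * (3 / 2) * B) + M * (\<epsilon> * (3 / 2) * B)
      + ((1 + c) * M) * (\<epsilon> * (3 / 2) * B) + (c * \<epsilon>) * M + M * (\<epsilon> * (3 / 2) * B) + c * (M * (\<epsilon> * (3 / 2) * B))"
    using 1 3 4 5 unfolding abs_le_iff by linarith
  also have "\<dots> = (16 * B + 3 * (c * B) + c) * E" by (simp add: E_def field_simps)
  also have "\<dots> \<le> ((20 + 4 * c) * B) * E"
  proof (rule mult_right_mono)
    have "c * 1 \<le> c * B" using c B by (intro mult_left_mono) auto
    then show "16 * B + 3 * (c * B) + c \<le> (20 + 4 * c) * B" using B by (simp add: algebra_simps)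
  qed (use E in auto)
  finally show ?thesis by (simp add: E_def)
qed

text \<open>Pure bookkeeping: the defect minus its explicit leading terms is a combination of the
  Taylor remainders of the corners and edges and of the error of replacing \<open>X\<close>,
  \<open>Y\<close> by signs, with \<open>s\<close> in the role of \<sigma>\<tau>. Testing with an
  arbitrary vector \<open>y\<close> turns it into an identity of real polynomials.\<close>

lemma residual_identity:
  fixes hu hv huu hvv huv huuu hvvv Fu Fv Fuu Fuv Fvv h00 h10 h01 h11 ha hb hab :: "'a::real_inner"
  assumes "huv = A *\<^sub>R hu + B *\<^sub>R hv"
    "Fu = g1 *\<^sub>R hu + g2 *\<^sub>R hv + A *\<^sub>R huu" "Fv = k1 *\<^sub>R hu + k2 *\<^sub>R hv + B *\<^sub>R hvv"
    "a = \<epsilon> * X" "b = \<epsilon> * Y" "\<alpha> = \<epsilon> * Y * A + \<epsilon>\<^sup>2 * q1" "\<beta> = \<epsilon> * X * B + \<epsilon>\<^sup>2 * q2"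
  shows "h11 - h10 - h01 + h00 - \<alpha> *\<^sub>R (h10 - h00) - \<beta> *\<^sub>R (h01 - h00)
    - ((\<epsilon> ^ 3 * tang A g1 k1 \<epsilon> X Y w z w' z' \<alpha> \<beta> (q1 * X)) *\<^sub>R hu
      + (\<epsilon> ^ 3 * tang B k2 g2 \<epsilon> Y X z w z' w' \<beta> \<alpha> (q2 * Y)) *\<^sub>R hv
      + (\<epsilon> ^ 4 * (X * (w' - q1 * X / 2))) *\<^sub>R huu + (\<epsilon> ^ 4 * (Y * (z' - q2 * Y / 2))) *\<^sub>R hvv)
    - \<epsilon> ^ 4 *\<^sub>R ((s / 6) *\<^sub>R (Fuu + Fvv) + (1 / 4) *\<^sub>R Fuv - (s / 6) *\<^sub>R (A *\<^sub>R huuu + B *\<^sub>R hvvv))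
   = (hab - ha - hb + h00 - ((a * b) *\<^sub>R huv + (a\<^sup>2 * b / 2) *\<^sub>R Fu + (a * b\<^sup>2 / 2) *\<^sub>R Fv
        + (a ^ 3 * b / 6) *\<^sub>R Fuu + (a\<^sup>2 * b\<^sup>2 / 4) *\<^sub>R Fuv + (a * b ^ 3 / 6) *\<^sub>R Fvv))
     + (h11 - hab - (\<epsilon> ^ 3 * w') *\<^sub>R (hu + a *\<^sub>R huu + b *\<^sub>R huv) - (\<epsilon> ^ 3 * z') *\<^sub>R (hv + a *\<^sub>R huv + b *\<^sub>R hvv))
     - (1 + \<alpha>) *\<^sub>R (h10 - ha - (\<epsilon> ^ 3 * z) *\<^sub>R (hv + a *\<^sub>R huv))
     - (1 + \<beta>) *\<^sub>R (h01 - hb - (\<epsilon> ^ 3 * w) *\<^sub>R (hu + b *\<^sub>R huv))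
     - \<alpha> *\<^sub>R (ha - h00 - a *\<^sub>R hu - (a\<^sup>2 / 2) *\<^sub>R huu - (a ^ 3 / 6) *\<^sub>R huuu)
     - \<beta> *\<^sub>R (hb - h00 - b *\<^sub>R hv - (b\<^sup>2 / 2) *\<^sub>R hvv - (b ^ 3 / 6) *\<^sub>R hvvv)
     + \<epsilon> ^ 4 *\<^sub>R (((X ^ 3 * Y - s) / 6) *\<^sub>R Fuu + ((X\<^sup>2 * Y\<^sup>2 - 1) / 4) *\<^sub>R Fuv + ((Y ^ 3 * X - s) / 6) *\<^sub>R Fvv
       - ((A * (X ^ 3 * Y - s) + \<epsilon> * (q1 * X ^ 3)) / 6) *\<^sub>R huuu - ((B * (Y ^ 3 * X - s) + \<epsilon> * (q2 * Y ^ 3)) / 6) *\<^sub>R hvvv)"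
    (is "?l = ?r")
proof -
  have "y \<bullet> ?l = y \<bullet> ?r" for y
    unfolding assms tang_def
    by (simp add: inner_add_right inner_diff_right field_simps eval_nat_numeral)
  then show ?thesis using vector_eq_ldot by blast
qed

lemma norm_diff_mono: "norm x \<le> a \<Longrightarrow> norm y \<le> b \<Longrightarrow> norm (x - y) \<le> a + b"
  by (meson add_mono norm_triangle_ineq4 order_trans)

lemma norm_scaleR_mono: "\<bar>r\<bar> \<le> a \<Longrightarrow> norm y \<le> b \<Longrightarrow> norm (r *\<^sub>R y) \<le> a * b"
  by (simp add: mult_mono order_trans[OF abs_ge_zero])

text \<open>The leading equations \<open>\<gamma> + w' - w - \<alpha>1 = 0\<close> and
  \<open>X * (w' - \<alpha>1 / 2) + n3 = 0\<close> form an invertible linear system for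
  \<open>w'\<close> and \<open>\<alpha>1\<close>. The two combinations of \<open>c1\<close> and
  \<open>c3\<close> below apply its inverse, with the equations rescaled by their orders
  \<open>\<epsilon> ^ 3\<close> and \<open>\<epsilon> ^ 4\<close>, and \<open>1 / X\<close> is
  replaced by \<sigma>.\<close>

lemma corner_equations_approx:
  fixes \<epsilon> M B D T :: real
  assumes c1: "c1 = \<epsilon> ^ 3 * t1 + \<epsilon> ^ 4 * n1 + e1" and c3: "c3 = \<epsilon> ^ 4 * (X * (w' - \<alpha>1 / 2)) + \<epsilon> ^ 4 * n3 + e3"
    and t1: "\<bar>t1 - (\<gamma> + w' - w - \<alpha>1)\<bar> \<le> T" and e: "\<bar>e1\<bar> \<le> D * (\<epsilon> ^ 5 * M)" "\<bar>e3\<bar> \<le> D * (\<epsilon> ^ 5 * M)"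
    and n: "\<bar>n1\<bar> \<le> B" "\<bar>n3\<bar> \<le> B" and \<epsilon>: "0 < \<epsilon>" "\<epsilon> \<le> 1" and M: "1 \<le> M"
    and X: "1 / 2 \<le> \<bar>X\<bar>" "\<bar>1 / X - \<sigma>\<bar> \<le> 2 * (\<epsilon> * M)"
  shows "\<bar>2 * c3 / (\<epsilon> ^ 4 * X) - c1 / \<epsilon> ^ 3 - (w' - (\<gamma> - w - 2 * \<sigma> * n3))\<bar> \<le> T + (5 * B + 5 * D) * (\<epsilon> * M)"
    and "\<bar>2 * c3 / (\<epsilon> ^ 4 * X) - 2 * c1 / \<epsilon> ^ 3 - (\<alpha>1 - (2 * \<gamma> - 2 * w - 2 * \<sigma> * n3))\<bar> \<le> 2 * T + (6 * B + 6 * D) * (\<epsilon> * M)"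
proof -
  have X0: "X \<noteq> 0" using X(1) by auto
  have B: "0 \<le> B" using n(1) by linarith
  have "0 \<le> D * (\<epsilon> ^ 5 * M)" using e(1) by linarith
  moreover have "0 < \<epsilon> ^ 5 * M" using \<epsilon> M by (intro mult_pos_pos) auto
  ultimately have D: "0 \<le> D" by (meson linorder_not_le mult_neg_pos)
  have "\<bar>1 / X\<bar> \<le> 2" using X(1) X0 by (simp add: field_simps)
  moreover have e3: "\<bar>e3 / \<epsilon> ^ 4\<bar> \<le> D * (\<epsilon> * M)" "\<bar>e1 / \<epsilon> ^ 3\<bar> \<le> D * (\<epsilon>\<^sup>2 * M)"
    using e \<epsilon> by (simp_all add: field_simps eval_nat_numeral)
  ultimately have e3': "\<bar>e3 / \<epsilon> ^ 4 * (1 / X)\<bar> \<le> D * (\<epsilon> * M) * 2" by (intro abs_mult_le)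
  have "\<epsilon>\<^sup>2 * M \<le> \<epsilon> * M" using \<epsilon> M by (simp add: power2_eq_square mult_left_le)
  then have e1': "\<bar>e1 / \<epsilon> ^ 3\<bar> \<le> D * (\<epsilon> * M)"
    using e3(2) D by (meson mult_left_mono order_trans)
  have n3: "\<bar>n3 * (1 / X - \<sigma>)\<bar> \<le> B * (2 * (\<epsilon> * M))" by (intro abs_mult_le n X)
  have "\<bar>\<epsilon> * n1\<bar> \<le> \<epsilon> * B" by (intro abs_mult_le n) (use \<epsilon> in auto)
  moreover have "\<epsilon> * B \<le> B * (\<epsilon> * M)" using \<epsilon> M B mult_left_mono[of 1 M "B * \<epsilon>"] by (simp add: mult_ac)
  ultimately have n1: "\<bar>\<epsilon> * n1\<bar> \<le> B * (\<epsilon> * M)" by linarith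
  have fin: "\<bar>2 * a + 2 * b - c * t - c * n - c * e\<bar> \<le> 2 * a' + 2 * b' + c * t' + c * n' + c * e'"
    if "\<bar>a\<bar> \<le> a'" "\<bar>b\<bar> \<le> b'" "\<bar>t\<bar> \<le> t'" "\<bar>n\<bar> \<le> n'" "\<bar>e\<bar> \<le> e'" "0 \<le> c" for a b c t n e a' b' t' n' e' :: real
  proof -
    have "\<bar>c * t\<bar> \<le> c * t'" "\<bar>c * n\<bar> \<le> c * n'" "\<bar>c * e\<bar> \<le> c * e'"
      using that by (simp_all add: abs_mult mult_left_mono)
    then show ?thesis using that unfolding abs_le_iff by linarith
  qed
  have c3': "2 * c3 / (\<epsilon> ^ 4 * X) = 2 * w' - \<alpha>1 + 2 * (n3 * (1 / X)) + 2 * (e3 / \<epsilon> ^ 4 * (1 / X))"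
    unfolding c3 using X0 \<epsilon>(1) by (simp add: field_simps)
  have c1': "c1 / \<epsilon> ^ 3 = t1 + \<epsilon> * n1 + e1 / \<epsilon> ^ 3"
    unfolding c1 using \<epsilon>(1) by (simp add: field_simps eval_nat_numeral)
  have c1'': "2 * c1 / \<epsilon> ^ 3 = 2 * (t1 + \<epsilon> * n1 + e1 / \<epsilon> ^ 3)"
    using c1' by simp
  have eq: "2 * c3 / (\<epsilon> ^ 4 * X) - c1 / \<epsilon> ^ 3 - (w' - (\<gamma> - w - 2 * \<sigma> * n3))
     = 2 * (n3 * (1 / X - \<sigma>)) + 2 * (e3 / \<epsilon> ^ 4 * (1 / X)) - (t1 - (\<gamma> + w' - w - \<alpha>1)) - \<epsilon> * n1 - e1 / \<epsilon> ^ 3"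
    unfolding c3' c1' by (simp add: algebra_simps)
  show "\<bar>2 * c3 / (\<epsilon> ^ 4 * X) - c1 / \<epsilon> ^ 3 - (w' - (\<gamma> - w - 2 * \<sigma> * n3))\<bar> \<le> T + (5 * B + 5 * D) * (\<epsilon> * M)"
    unfolding eq using fin[OF n3 e3' t1 n1 e1', of 1] by (simp add: algebra_simps)
  have eq: "2 * c3 / (\<epsilon> ^ 4 * X) - 2 * c1 / \<epsilon> ^ 3 - (\<alpha>1 - (2 * \<gamma> - 2 * w - 2 * \<sigma> * n3))
     = 2 * (n3 * (1 / X - \<sigma>)) + 2 * (e3 / \<epsilon> ^ 4 * (1 / X)) - 2 * (t1 - (\<gamma> + w' - w - \<alpha>1)) - 2 * (\<epsilon> * n1) - 2 * (e1 / \<epsilon> ^ 3)"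
    unfolding c3' c1'' by (simp add: algebra_simps)
  show "\<bar>2 * c3 / (\<epsilon> ^ 4 * X) - 2 * c1 / \<epsilon> ^ 3 - (\<alpha>1 - (2 * \<gamma> - 2 * w - 2 * \<sigma> * n3))\<bar> \<le> 2 * T + (6 * B + 6 * D) * (\<epsilon> * M)"
    unfolding eq using fin[OF n3 e3' t1 n1 e1', of 2] by (simp add: algebra_simps)
qed

section \<open>Leading terms and remainder of the coplanarity equations\<close>

context conjugate_net
begin

text \<open>The locale asserts coefficients only pointwise; reading them off as frame coordinates
  makes them functions whose Lipschitz bounds are known.\<close>

definition "cA p = fst (coord p (huv p))"
definition "cB p = fst (snd (coord p (huv p)))"
definition "g1 p = fst (coord p (du huv p))"
definition "g2 p = fst (snd (coord p (du huv p)))"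
definition "k1 p = fst (coord p (dv huv p))"
definition "k2 p = fst (snd (coord p (dv huv p)))"

lemma conj_coeffs:
  assumes "p \<in> ball 0 1"
  shows "huv p = cA p *\<^sub>R hu p + cB p *\<^sub>R hv p"
    "du huv p = g1 p *\<^sub>R hu p + g2 p *\<^sub>R hv p + cA p *\<^sub>R huu p"
    "dv huv p = k1 p *\<^sub>R hu p + k2 p *\<^sub>R hv p + cB p *\<^sub>R hvv p"
proof -
  obtain A B g1' g2' k1' k2' where c: "huv p = A *\<^sub>R hu p + B *\<^sub>R hv p"
      "du huv p = g1' *\<^sub>R hu p + g2' *\<^sub>R hv p + A *\<^sub>R huu p"
      "dv huv p = k1' *\<^sub>R hu p + k2' *\<^sub>R hv p + B *\<^sub>R hvv p"
    using conj[OF assms] by blast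
  have p: "p \<in> cball 0 1" using assms by auto
  have "coord p (huv p) = (A, B, 0, 0)" "coord p (du huv p) = (g1', g2', A, 0)"
    "coord p (dv huv p) = (k1', k2', 0, B)"
    by (rule coord_eqI[OF p]; simp add: frame_def c)+
  then have "cA p = A" "cB p = B" "g1 p = g1'" "g2 p = g2'" "k1 p = k1'" "k2 p = k2'"
    by (simp_all add: cA_def cB_def g1_def g2_def k1_def k2_def)
  then show "huv p = cA p *\<^sub>R hu p + cB p *\<^sub>R hv p"
    "du huv p = g1 p *\<^sub>R hu p + g2 p *\<^sub>R hv p + cA p *\<^sub>R huu p"
    "dv huv p = k1 p *\<^sub>R hu p + k2 p *\<^sub>R hv p + cB p *\<^sub>R hvv p"
    using c by simp_all
qed

text \<open>The part of order \<open>\<epsilon> ^ 4\<close> of the defect that contains none of the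
  displacements or multiplier corrections, with \<open>X\<close>, \<open>Y\<close> replaced by their
  signs: \<open>X ^ 3 * Y\<close> and \<open>X * Y ^ 3\<close> become \<sigma>\<tau>,
  \<open>X\<^sup>2 * Y\<^sup>2\<close> becomes 1.\<close>

definition V0 :: "real \<Rightarrow> real \<Rightarrow> real \<times> real \<Rightarrow> 'a" where
  "V0 \<sigma> \<tau> p = (\<sigma> * \<tau> / 6) *\<^sub>R (du (du huv) p + dv (dv huv) p) + (1 / 4) *\<^sub>R dv (du huv) p
    - (\<sigma> * \<tau> / 6) *\<^sub>R (cA p *\<^sub>R huuu p + cB p *\<^sub>R hvvv p)"

definition "\<nu>1 \<sigma> \<tau> p = fst (coord p (V0 \<sigma> \<tau> p))"
definition "\<nu>2 \<sigma> \<tau> p = fst (snd (coord p (V0 \<sigma> \<tau> p)))"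
definition "\<nu>3 \<sigma> \<tau> p = fst (snd (snd (coord p (V0 \<sigma> \<tau> p))))"
definition "\<nu>4 \<sigma> \<tau> p = snd (snd (snd (coord p (V0 \<sigma> \<tau> p))))"

text \<open>The value of \<open>w' + w\<close> in the leading linear system. The last term stems
  from the equation along \<open>huu\<close> after division by \<open>X\<close>, as
  \<open>1 / \<sigma> = \<sigma>\<close>.\<close>

definition "src_u \<sigma> \<tau> p = (\<tau> * g1 p + \<sigma> * k1 p) / 2 - 2 * \<sigma> * \<nu>3 \<sigma> \<tau> p"
definition "src_v \<sigma> \<tau> p = (\<sigma> * k2 p + \<tau> * g2 p) / 2 - 2 * \<tau> * \<nu>4 \<sigma> \<tau> p"

lemma bdd_lipschitz_coeffs:
  "bdd_lipschitz cA (cball 0 1)" "bdd_lipschitz cB (cball 0 1)" "bdd_lipschitz g1 (cball 0 1)"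
  "bdd_lipschitz g2 (cball 0 1)" "bdd_lipschitz k1 (cball 0 1)" "bdd_lipschitz k2 (cball 0 1)"
  unfolding cA_def[abs_def] cB_def[abs_def] g1_def[abs_def] g2_def[abs_def] k1_def[abs_def] k2_def[abs_def]
  by (intro bdd_lipschitz_intros bdd_lipschitz_coord bdd_lipschitz_smooth smooths)+

lemma bdd_lipschitz_\<nu>:
  "bdd_lipschitz (\<nu>1 \<sigma> \<tau>) (cball 0 1)" "bdd_lipschitz (\<nu>2 \<sigma> \<tau>) (cball 0 1)"
  "bdd_lipschitz (\<nu>3 \<sigma> \<tau>) (cball 0 1)" "bdd_lipschitz (\<nu>4 \<sigma> \<tau>) (cball 0 1)"
  unfolding \<nu>1_def[abs_def] \<nu>2_def[abs_def] \<nu>3_def[abs_def] \<nu>4_def[abs_def] V0_def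
  by (intro bdd_lipschitz_intros bdd_lipschitz_coord bdd_lipschitz_smooth smooths bdd_lipschitz_coeffs)+

lemma bdd_lipschitz_src:
  "bdd_lipschitz (src_u \<sigma> \<tau>) (cball 0 1)" "bdd_lipschitz (src_v \<sigma> \<tau>) (cball 0 1)"
  unfolding src_u_def[abs_def] src_v_def[abs_def] divide_inverse
  by (intro bdd_lipschitz_intros bdd_lipschitz_coeffs bdd_lipschitz_\<nu>)+

text \<open>The step sizes \<open>\<epsilon> X\<close>, \<open>\<epsilon> Y\<close> carry the signs of the directions of evolution, and \<open>\<epsilon> ^ 3 * w\<close>, \<open>\<epsilon> ^ 3 * z\<close> are
  the deviations of the quadrilateral from a coordinate rectangle. A zero of \<open>defect\<close> means that its
  vertices have coplanar images; the multipliers are split off their leading terms \<open>b * A\<close>, \<open>a * B\<close>,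
  which cancel \<open>a * b * huv\<close> by the Laplace equation.\<close>

definition defect :: "real \<Rightarrow> real \<Rightarrow> real \<Rightarrow> real \<Rightarrow> real \<Rightarrow> real \<Rightarrow> real \<Rightarrow> real \<Rightarrow> real \<Rightarrow> real \<Rightarrow> real \<Rightarrow> 'a" where
  "defect u v \<epsilon> X Y w z w' z' q1 q2 =
    h (u + (\<epsilon> * X + \<epsilon> ^ 3 * w'), v + (\<epsilon> * Y + \<epsilon> ^ 3 * z')) - h (u + \<epsilon> * X, v + \<epsilon> ^ 3 * z)
    - h (u + \<epsilon> ^ 3 * w, v + \<epsilon> * Y) + h (u, v)
    - (\<epsilon> * Y * cA (u, v) + \<epsilon>\<^sup>2 * q1) *\<^sub>R (h (u + \<epsilon> * X, v + \<epsilon> ^ 3 * z) - h (u, v))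
    - (\<epsilon> * X * cB (u, v) + \<epsilon>\<^sup>2 * q2) *\<^sub>R (h (u + \<epsilon> ^ 3 * w, v + \<epsilon> * Y) - h (u, v))"

text \<open>Frame coordinates of the leading terms. Along \<open>huu\<close> the cubic terms
  \<open>a\<^sup>2 * b / 2\<close> times \<open>cA\<close>, from \<open>du huv\<close> and from the
  multiplier \<open>b * cA\<close> acting on the edge, cancel; what remains has order
  \<open>\<epsilon> ^ 4\<close>. The same happens along \<open>hvv\<close>.\<close>

definition leading_part where
  "leading_part u v \<epsilon> X Y w z w' z' q1 q2 =
    (let p = (u, v); \<alpha> = \<epsilon> * Y * cA p + \<epsilon>\<^sup>2 * q1; \<beta> = \<epsilon> * X * cB p + \<epsilon>\<^sup>2 * q2 in
      (\<epsilon> ^ 3 * tang (cA p) (g1 p) (k1 p) \<epsilon> X Y w z w' z' \<alpha> \<beta> (q1 * X),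
       \<epsilon> ^ 3 * tang (cB p) (k2 p) (g2 p) \<epsilon> Y X z w z' w' \<beta> \<alpha> (q2 * Y),
       \<epsilon> ^ 4 * (X * (w' - q1 * X / 2)), \<epsilon> ^ 4 * (Y * (z' - q2 * Y / 2))))"

text \<open>The bounds \<open>8 * \<epsilon> \<le> \<rho> - 1\<close> and
  \<open>\<epsilon> \<le> 1 / 2\<close> are the hypotheses of the Taylor lemmas for
  \<open>d = 2 * \<epsilon>\<close>, which dominates the sides because
  \<open>\<epsilon> * M \<le> 1 / 2\<close> keeps \<open>X\<close> and \<open>Y\<close> below
  3/2.\<close>

definition almost_square :: "real \<Rightarrow> real \<Rightarrow> real \<Rightarrow> real \<Rightarrow> real \<Rightarrow> real \<Rightarrow> bool" where
  "almost_square \<epsilon> M \<sigma> \<tau> X Y \<longleftrightarrow> 0 < \<epsilon> \<and> 8 * \<epsilon> \<le> \<rho> - 1 \<and> \<epsilon> \<le> 1 / 2 \<and> 1 \<le> M \<and> \<epsilon> * M \<le> 1 / 2 \<and>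
    \<bar>\<sigma>\<bar> = 1 \<and> \<bar>\<tau>\<bar> = 1 \<and> \<bar>X - \<sigma>\<bar> \<le> \<epsilon> * M \<and> \<bar>Y - \<tau>\<bar> \<le> \<epsilon> * M"

text \<open>Termwise estimate of \<open>residual_identity\<close>. Each Taylor remainder is of order
  \<open>\<epsilon> ^ 5\<close> up to one factor \<open>M\<close>, and so is
  \<open>\<epsilon> ^ 4\<close> times the \<open>O(\<epsilon> * M)\<close> error of replacing
  \<open>X\<close>, \<open>Y\<close> by signs.\<close>

lemma defect_bound:
  "\<exists>C>0. \<forall>u v \<epsilon> M X Y w z w' z' q1 q2 \<sigma> \<tau>. norm (u, v) < 1 \<longrightarrow> almost_square \<epsilon> M \<sigma> \<tau> X Y \<longrightarrow>
    (\<forall>t\<in>{w, z, w', z', q1, q2}. \<bar>t\<bar> \<le> M) \<longrightarrow>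
    norm (defect u v \<epsilon> X Y w z w' z' q1 q2 - frame (u, v) (leading_part u v \<epsilon> X Y w z w' z' q1 q2)
      - \<epsilon> ^ 4 *\<^sub>R V0 \<sigma> \<tau> (u, v)) \<le> C * (\<epsilon> ^ 5 * M)"
proof -
  obtain B1 where B1: "B1 \<ge> 1" "\<forall>f\<in>set [du (du huv), dv (du huv), dv (dv huv), huuu, hvvv]. \<forall>p\<in>cball 0 1. norm (f p) \<le> B1"
    using common_bound[of "[du (du huv), dv (du huv), dv (dv huv), huuu, hvvv]" "cball 0 1"] bdd_lipschitz_smooth[OF smooths(10)]
      bdd_lipschitz_smooth[OF smooths(11)] bdd_lipschitz_smooth[OF smooths(12)] bdd_lipschitz_smooth[OF smooths(6)]
      bdd_lipschitz_smooth[OF smooths(7)] by auto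
  obtain B2 where B2: "B2 \<ge> 1" "\<forall>f\<in>set [cA, cB]. \<forall>p\<in>cball 0 1. norm (f p) \<le> B2"
    using common_bound[of "[cA, cB]" "cball 0 1"] bdd_lipschitz_coeffs(1,2) by auto
  define B where "B = max B1 B2"
  have B: "1 \<le> B" "B1 \<le> B" "B2 \<le> B" using B1(1) by (auto simp: B_def)
  note B' = B and B = B(1)
  obtain C1 where C1: "C1 > 0" "\<And>u v a b d. norm (u, v) \<le> 1 \<Longrightarrow> 2 * d \<le> \<rho> - 1 \<Longrightarrow> \<bar>a\<bar> \<le> d \<Longrightarrow> \<bar>b\<bar> \<le> d \<Longrightarrow>
    norm (h (u + a, v + b) - h (u + a, v) - h (u, v + b) + h (u, v)
      - ((a * b) *\<^sub>R huv (u, v) + (a\<^sup>2 * b / 2) *\<^sub>R du huv (u, v) + (a * b\<^sup>2 / 2) *\<^sub>R dv huv (u, v)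
        + (a ^ 3 * b / 6) *\<^sub>R du (du huv) (u, v) + (a\<^sup>2 * b\<^sup>2 / 4) *\<^sub>R dv (du huv) (u, v)
        + (a * b ^ 3 / 6) *\<^sub>R dv (dv huv) (u, v))) \<le> C1 * d ^ 5"
    using rectangle_taylor by blast
  obtain C2 where C2: "C2 > 0" "\<And>u v a b x y d. norm (u, v) \<le> 1 \<Longrightarrow> 4 * d \<le> \<rho> - 1 \<Longrightarrow> d \<le> 1 \<Longrightarrow> \<bar>a\<bar> \<le> d \<Longrightarrow> \<bar>b\<bar> \<le> d \<Longrightarrow>
      \<bar>x\<bar> \<le> d\<^sup>2 \<Longrightarrow> \<bar>y\<bar> \<le> d\<^sup>2 \<Longrightarrow>
    norm (h (u + (a + x), v + (b + y)) - h (u + a, v + b)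
      - x *\<^sub>R (hu (u, v) + a *\<^sub>R huu (u, v) + b *\<^sub>R huv (u, v))
      - y *\<^sub>R (hv (u, v) + a *\<^sub>R huv (u, v) + b *\<^sub>R hvv (u, v))) \<le> C2 * d\<^sup>2 * (\<bar>x\<bar> + \<bar>y\<bar>)"
    using vertex_taylor by blast
  obtain C3 where C3: "C3 > 0" "\<And>u v a. norm (u, v) \<le> 1 \<Longrightarrow> \<bar>a\<bar> \<le> \<rho> - 1 \<Longrightarrow>
    norm (h (u + a, v) - h (u, v) - a *\<^sub>R hu (u, v) - (a\<^sup>2 / 2) *\<^sub>R huu (u, v) - (a ^ 3 / 6) *\<^sub>R huuu (u, v)) \<le> C3 * \<bar>a\<bar> ^ 4"
    "\<And>u v a. norm (u, v) \<le> 1 \<Longrightarrow> \<bar>a\<bar> \<le> \<rho> - 1 \<Longrightarrow>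
    norm (h (u, v + a) - h (u, v) - a *\<^sub>R hv (u, v) - (a\<^sup>2 / 2) *\<^sub>R hvv (u, v) - (a ^ 3 / 6) *\<^sub>R hvvv (u, v)) \<le> C3 * \<bar>a\<bar> ^ 4"
    using edge_taylor by blast
  \<comment> \<open>In order: the rectangle (\<open>32 = 2 ^ 5\<close>), the fourth vertex with two
    displacements, the two displaced neighbours times \<open>1 + \<alpha>\<close> and
    \<open>1 + \<beta>\<close>, the two edges (\<open>16 = 2 ^ 4\<close>) times \<alpha> and
    \<beta>, and the passage to signs.\<close>
  define C where "C = 32 * C1 + 8 * C2 + 2 * ((1 + 3 * B) * (4 * C2)) + 2 * (3 * B * (16 * C3)) + 27 * B * B"
  have bound: "norm (defect u v \<epsilon> X Y w z w' z' q1 q2 - frame (u, v) (leading_part u v \<epsilon> X Y w z w' z' q1 q2)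
      - \<epsilon> ^ 4 *\<^sub>R V0 \<sigma> \<tau> (u, v)) \<le> C * (\<epsilon> ^ 5 * M)"
    if p: "norm (u, v) < 1" and sq: "almost_square \<epsilon> M \<sigma> \<tau> X Y" and wM: "\<forall>t\<in>{w, z, w', z', q1, q2}. \<bar>t\<bar> \<le> M"
    for u v \<epsilon> M X Y w z w' z' q1 q2 \<sigma> \<tau>
  proof -
    have \<epsilon>: "0 < \<epsilon>" "8 * \<epsilon> \<le> \<rho> - 1" "\<epsilon> \<le> 1 / 2" and M: "1 \<le> M" "\<epsilon> * M \<le> 1 / 2"
      and \<sigma>: "\<bar>\<sigma>\<bar> = 1" "\<bar>\<tau>\<bar> = 1" and X: "\<bar>X - \<sigma>\<bar> \<le> \<epsilon> * M" "\<bar>Y - \<tau>\<bar> \<le> \<epsilon> * M"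
      using sq by (simp_all add: almost_square_def)
    have w: "\<bar>w\<bar> \<le> M" "\<bar>z\<bar> \<le> M" "\<bar>w'\<bar> \<le> M" "\<bar>z'\<bar> \<le> M" "\<bar>q1\<bar> \<le> M" "\<bar>q2\<bar> \<le> M" using wM by simp_all
    define a where "a = \<epsilon> * X"
    define b where "b = \<epsilon> * Y"
    define \<alpha> where "\<alpha> = \<epsilon> * Y * cA (u, v) + \<epsilon>\<^sup>2 * q1"
    define \<beta> where "\<beta> = \<epsilon> * X * cB (u, v) + \<epsilon>\<^sup>2 * q2"
    let ?p = "(u, v)"
    have pb: "?p \<in> ball 0 1" "?p \<in> cball 0 1" "norm ?p \<le> 1" using p by auto
    have BB: "norm (du (du huv) ?p) \<le> B" "norm (dv (du huv) ?p) \<le> B" "norm (dv (dv huv) ?p) \<le> B"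
      "norm (huuu ?p) \<le> B" "norm (hvvv ?p) \<le> B" "\<bar>cA ?p\<bar> \<le> B" "\<bar>cB ?p\<bar> \<le> B"
      using B1(2) B2(2) pb(2) B'(2,3) by (auto intro: order_trans)
    note nx = near_sign_bounds[OF \<sigma> X M(2)]
    note ny = near_sign_bounds[OF \<sigma>(2,1) X(2,1) M(2)]
    have \<epsilon>': "\<bar>\<epsilon>\<bar> \<le> \<epsilon>" "\<bar>\<epsilon> ^ 3\<bar> \<le> \<epsilon> ^ 3" using \<epsilon> by auto
    have ab: "\<bar>a\<bar> \<le> \<epsilon> * (3 / 2)" "\<bar>b\<bar> \<le> \<epsilon> * (3 / 2)"
      unfolding a_def b_def by (intro abs_mult_le \<epsilon>' nx ny)+
    have ab2: "\<bar>a\<bar> \<le> 2 * \<epsilon>" "\<bar>b\<bar> \<le> 2 * \<epsilon>" using ab \<epsilon> by linarith+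
    have small: "\<bar>\<epsilon> ^ 3 * t\<bar> \<le> \<epsilon> ^ 3 * M" "\<bar>\<epsilon> ^ 3 * t\<bar> \<le> (2 * \<epsilon>)\<^sup>2" if "\<bar>t\<bar> \<le> M" for t
    proof -
      show 1: "\<bar>\<epsilon> ^ 3 * t\<bar> \<le> \<epsilon> ^ 3 * M" by (intro abs_mult_le \<epsilon>' that)
      have "\<epsilon> ^ 3 * M = \<epsilon>\<^sup>2 * (\<epsilon> * M)" by (simp add: eval_nat_numeral)
      also have "\<dots> \<le> \<epsilon>\<^sup>2 * 1" using M by (intro mult_left_mono) auto
      finally show "\<bar>\<epsilon> ^ 3 * t\<bar> \<le> (2 * \<epsilon>)\<^sup>2" using 1 by (simp add: power_mult_distrib)
    qed
    have \<epsilon>q: "\<bar>\<epsilon>\<^sup>2 * t\<bar> \<le> \<epsilon>" if "\<bar>t\<bar> \<le> M" for t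
    proof -
      have "\<bar>\<epsilon> * (\<epsilon> * t)\<bar> \<le> \<epsilon> * (\<epsilon> * M)" by (intro abs_mult_le \<epsilon>' that)
      also have "\<dots> \<le> \<epsilon> * 1" using M \<epsilon> by (intro mult_left_mono) auto
      finally show ?thesis by (simp add: power2_eq_square mult.assoc)
    qed
    have "\<epsilon> * 1 \<le> \<epsilon> * (3 / 2 * B)" using \<epsilon> B by (intro mult_left_mono) auto
    then have "\<epsilon> * (3 / 2) * B + \<epsilon> \<le> 3 * B * \<epsilon>" by (simp only: mult_1_right mult.assoc mult.commute[of _ \<epsilon>])
    moreover have "\<bar>\<epsilon> * Y * cA ?p\<bar> \<le> \<epsilon> * (3 / 2) * B" "\<bar>\<epsilon> * X * cB ?p\<bar> \<le> \<epsilon> * (3 / 2) * B"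
      by (intro abs_mult_le \<epsilon>' nx ny BB)+
    ultimately have \<alpha>: "\<bar>\<alpha>\<bar> \<le> 3 * B * \<epsilon>" "\<bar>\<beta>\<bar> \<le> 3 * B * \<epsilon>"
      unfolding \<alpha>_def \<beta>_def using \<epsilon>q[OF w(5)] \<epsilon>q[OF w(6)] by linarith+
    moreover have "3 * B * \<epsilon> \<le> 3 * B * 1" using B \<epsilon> by (intro mult_left_mono) auto
    ultimately have \<alpha>1: "\<bar>1 + \<alpha>\<bar> \<le> 1 + 3 * B" "\<bar>1 + \<beta>\<bar> \<le> 1 + 3 * B" by linarith+
    have r1: "norm (h (u + a, v + b) - h (u + a, v) - h (u, v + b) + h (u, v)
      - ((a * b) *\<^sub>R huv (u, v) + (a\<^sup>2 * b / 2) *\<^sub>R du huv (u, v) + (a * b\<^sup>2 / 2) *\<^sub>R dv huv (u, v)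
        + (a ^ 3 * b / 6) *\<^sub>R du (du huv) (u, v) + (a\<^sup>2 * b\<^sup>2 / 4) *\<^sub>R dv (du huv) (u, v)
        + (a * b ^ 3 / 6) *\<^sub>R dv (dv huv) (u, v))) \<le> C1 * (2 * \<epsilon>) ^ 5"
      by (rule C1(2)[OF pb(3) _ ab2]) (use \<epsilon> in auto)
    have vert: "norm (h (u + (a' + \<epsilon> ^ 3 * s), v + (b' + \<epsilon> ^ 3 * t)) - h (u + a', v + b')
      - (\<epsilon> ^ 3 * s) *\<^sub>R (hu (u, v) + a' *\<^sub>R huu (u, v) + b' *\<^sub>R huv (u, v))
      - (\<epsilon> ^ 3 * t) *\<^sub>R (hv (u, v) + a' *\<^sub>R huv (u, v) + b' *\<^sub>R hvv (u, v))) \<le> 4 * C2 * \<epsilon>\<^sup>2 * (\<bar>\<epsilon> ^ 3 * s\<bar> + \<bar>\<epsilon> ^ 3 * t\<bar>)"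
      if "\<bar>a'\<bar> \<le> 2 * \<epsilon>" "\<bar>b'\<bar> \<le> 2 * \<epsilon>" "\<bar>s\<bar> \<le> M" "\<bar>t\<bar> \<le> M" for a' b' s t
      using C2(2)[OF pb(3) _ _ that(1,2) small(2)[OF that(3)] small(2)[OF that(4)]] \<epsilon>
      by (simp add: power_mult_distrib mult_ac)
    have \<epsilon>5: "4 * C2 * \<epsilon>\<^sup>2 * (\<epsilon> ^ 3 * M) = 4 * C2 * (\<epsilon> ^ 5 * M)" by (simp add: eval_nat_numeral)
    have le: "4 * C2 * \<epsilon>\<^sup>2 * x \<le> 4 * C2 * \<epsilon>\<^sup>2 * y" if "x \<le> y" for x y
      using that C2(1) by (intro mult_left_mono) auto
    have r2: "norm (h (u + (a + \<epsilon> ^ 3 * w'), v + (b + \<epsilon> ^ 3 * z')) - h (u + a, v + b)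
      - (\<epsilon> ^ 3 * w') *\<^sub>R (hu (u, v) + a *\<^sub>R huu (u, v) + b *\<^sub>R huv (u, v))
      - (\<epsilon> ^ 3 * z') *\<^sub>R (hv (u, v) + a *\<^sub>R huv (u, v) + b *\<^sub>R hvv (u, v))) \<le> 8 * C2 * (\<epsilon> ^ 5 * M)"
      using vert[OF ab2 w(3,4)] le[OF add_mono[OF small(1)[OF w(3)] small(1)[OF w(4)]]] \<epsilon>5
      by (simp add: algebra_simps)
    have r3: "norm (h (u + a, v + \<epsilon> ^ 3 * z) - h (u + a, v)
      - (\<epsilon> ^ 3 * z) *\<^sub>R (hv (u, v) + a *\<^sub>R huv (u, v))) \<le> 4 * C2 * (\<epsilon> ^ 5 * M)"
      using vert[OF ab2(1), of 0 0 z] le[OF small(1)[OF w(2)]] w(2) \<epsilon>5 \<epsilon> M by simp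
    have r4: "norm (h (u + \<epsilon> ^ 3 * w, v + b) - h (u, v + b)
      - (\<epsilon> ^ 3 * w) *\<^sub>R (hu (u, v) + b *\<^sub>R huv (u, v))) \<le> 4 * C2 * (\<epsilon> ^ 5 * M)"
      using vert[OF _ ab2(2), of 0 w 0] le[OF small(1)[OF w(1)]] w(1) \<epsilon>5 \<epsilon> M by simp
    have p4: "C3 * \<bar>t\<bar> ^ 4 \<le> 16 * C3 * \<epsilon> ^ 4" if "\<bar>t\<bar> \<le> 2 * \<epsilon>" for t
      using power_mono[OF that, of 4] C3(1) by (simp add: power_mult_distrib)
    have r5: "norm (h (u + a, v) - h (u, v) - a *\<^sub>R hu (u, v) - (a\<^sup>2 / 2) *\<^sub>R huu (u, v) - (a ^ 3 / 6) *\<^sub>R huuu (u, v)) \<le> 16 * C3 * \<epsilon> ^ 4"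
      using C3(2)[OF pb(3), of a] p4[OF ab2(1)] ab2 \<epsilon> by linarith
    have r6: "norm (h (u, v + b) - h (u, v) - b *\<^sub>R hv (u, v) - (b\<^sup>2 / 2) *\<^sub>R hvv (u, v) - (b ^ 3 / 6) *\<^sub>R hvvv (u, v)) \<le> 16 * C3 * \<epsilon> ^ 4"
      using C3(3)[OF pb(3), of b] p4[OF ab2(2)] ab2 \<epsilon> by linarith
    have cub: "\<bar>t ^ 3\<bar> \<le> 4" if "\<bar>t\<bar> \<le> 3 / 2" for t :: real
      using abs_mult_le[OF that abs_mult_le[OF that that]] by (simp add: power3_eq_cube mult.assoc)
    define d where "d = \<epsilon> * M"
    have d: "0 \<le> d" using \<epsilon> M by (simp add: d_def)
    have mixed: "\<bar>(c * m + \<epsilon> * (q * t ^ 3)) / 6\<bar> \<le> 10 * B * d" if "\<bar>c\<bar> \<le> B" "\<bar>m\<bar> \<le> 10 * d" "\<bar>q\<bar> \<le> M" "\<bar>t\<bar> \<le> 3 / 2" for c m q t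
    proof -
      have "\<bar>c * m\<bar> \<le> B * (10 * d)" "\<bar>\<epsilon> * (q * t ^ 3)\<bar> \<le> \<epsilon> * (M * 4)"
        by (intro abs_mult_le that \<epsilon>' cub)+
      moreover have "1 * d \<le> B * d" using B d by (intro mult_right_mono)
      ultimately show ?thesis unfolding d_def by (simp add: field_simps)
    qed
    have quart: "\<bar>m / 6\<bar> \<le> 2 * d" "\<bar>m / 4\<bar> \<le> 3 * d" if "\<bar>m\<bar> \<le> 10 * d" for m :: real using that by simp_all
    have my: "\<bar>Y ^ 3 * X - \<sigma> * \<tau>\<bar> \<le> 10 * d" using ny(4) by (simp add: mult.commute d_def)
    have rest: "norm (((X ^ 3 * Y - \<sigma> * \<tau>) / 6) *\<^sub>R du (du huv) ?p + ((X\<^sup>2 * Y\<^sup>2 - 1) / 4) *\<^sub>R dv (du huv) ?p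
        + ((Y ^ 3 * X - \<sigma> * \<tau>) / 6) *\<^sub>R dv (dv huv) ?p
       - ((cA ?p * (X ^ 3 * Y - \<sigma> * \<tau>) + \<epsilon> * (q1 * X ^ 3)) / 6) *\<^sub>R huuu ?p
       - ((cB ?p * (Y ^ 3 * X - \<sigma> * \<tau>) + \<epsilon> * (q2 * Y ^ 3)) / 6) *\<^sub>R hvvv ?p)
      \<le> (2 * d) * B + (3 * d) * B + (2 * d) * B + (10 * B * d) * B + (10 * B * d) * B"
      using nx(4,5)
      by (intro norm_triangle_mono norm_diff_mono norm_scaleR_mono BB quart mixed my w nx ny) (simp_all add: d_def)
    also have "\<dots> \<le> 27 * B * B * d"
    proof -
      have "1 * (B * d) \<le> B * (B * d)" using B d by (intro mult_right_mono) auto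
      then show ?thesis by (simp add: algebra_simps)
    qed
    finally have rest': "norm (((X ^ 3 * Y - \<sigma> * \<tau>) / 6) *\<^sub>R du (du huv) ?p + ((X\<^sup>2 * Y\<^sup>2 - 1) / 4) *\<^sub>R dv (du huv) ?p
        + ((Y ^ 3 * X - \<sigma> * \<tau>) / 6) *\<^sub>R dv (dv huv) ?p
       - ((cA ?p * (X ^ 3 * Y - \<sigma> * \<tau>) + \<epsilon> * (q1 * X ^ 3)) / 6) *\<^sub>R huuu ?p
       - ((cB ?p * (Y ^ 3 * X - \<sigma> * \<tau>) + \<epsilon> * (q2 * Y ^ 3)) / 6) *\<^sub>R hvvv ?p) \<le> 27 * B * B * d" .
    have \<epsilon>4: "\<bar>\<epsilon> ^ 4\<bar> \<le> \<epsilon> ^ 4" by simp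
    have "norm (defect u v \<epsilon> X Y w z w' z' q1 q2 - frame (u, v) (leading_part u v \<epsilon> X Y w z w' z' q1 q2)
      - \<epsilon> ^ 4 *\<^sub>R V0 \<sigma> \<tau> (u, v)) \<le> C1 * (2 * \<epsilon>) ^ 5 + 8 * C2 * (\<epsilon> ^ 5 * M) + (1 + 3 * B) * (4 * C2 * (\<epsilon> ^ 5 * M))
        + (1 + 3 * B) * (4 * C2 * (\<epsilon> ^ 5 * M)) + (3 * B * \<epsilon>) * (16 * C3 * \<epsilon> ^ 4) + (3 * B * \<epsilon>) * (16 * C3 * \<epsilon> ^ 4)
        + \<epsilon> ^ 4 * (27 * B * B * d)"
      unfolding defect_def leading_part_def Let_def frame_def fst_conv snd_conv V0_def \<alpha>_def[symmetric] \<beta>_def[symmetric]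
      unfolding a_def[symmetric] b_def[symmetric]
      \<comment> \<open>The undisplaced corners do not occur on the left side of the identity and
        have to be supplied.\<close>
      unfolding residual_identity[OF conj_coeffs[OF pb(1)] a_def b_def \<alpha>_def \<beta>_def,
          where ha = "h (u + a, v)" and hb = "h (u, v + b)" and hab = "h (u + a, v + b)"]
      by (intro norm_triangle_mono norm_diff_mono norm_scaleR_mono r1 r2 r3 r4 r5 r6 \<alpha> \<alpha>1 rest' \<epsilon>4)
    also have "\<dots> \<le> C * (\<epsilon> ^ 5 * M)"
    proof -
      have "\<epsilon> ^ 5 * 1 \<le> \<epsilon> ^ 5 * M" using M \<epsilon> by (intro mult_left_mono) auto
      then have "(32 * C1 + 2 * (3 * B * (16 * C3))) * \<epsilon> ^ 5 \<le> (32 * C1 + 2 * (3 * B * (16 * C3))) * (\<epsilon> ^ 5 * M)"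
        using C1(1) C3(1) B by (intro mult_left_mono) auto
      moreover have e: "C1 * (2 * \<epsilon>) ^ 5 = 32 * C1 * \<epsilon> ^ 5"
        "(3 * B * \<epsilon>) * (16 * C3 * \<epsilon> ^ 4) = (3 * B * (16 * C3)) * \<epsilon> ^ 5"
        "\<epsilon> ^ 4 * (27 * B * B * d) = 27 * B * B * (\<epsilon> ^ 5 * M)"
        by (simp_all add: d_def eval_nat_numeral)
      ultimately show ?thesis unfolding C_def e by (simp add: algebra_simps)
    qed
    finally show ?thesis .
  qed
  have "0 \<le> 2 * ((1 + 3 * B) * (4 * C2))" "0 \<le> 2 * (3 * B * (16 * C3))" "0 \<le> 27 * B * B"
    using C2(1) C3(1) B by simp_all
  then have "0 < C" unfolding C_def using C1(1) C2(1) by linarith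
  then show ?thesis
    by (intro exI[of _ C] conjI allI impI bound)
qed

end

section \<open>Solving the four equations\<close>

lemma abs_center_le:
  fixes x c r a :: real
  assumes "\<bar>x - c\<bar> \<le> r" "\<bar>c\<bar> \<le> a" shows "\<bar>x\<bar> \<le> a + r"
  using assms by linarith

text \<open>Coplanarity in the form of a discrete Laplace equation: the edges from
  \<open>h p00\<close> to \<open>h p10\<close> and \<open>h p01\<close> have weights
  \<open>1 + \<alpha>\<close> and \<open>1 + \<beta>\<close> in the diagonal to
  \<open>h p11\<close>.\<close>

definition lift_coplanar :: "('a \<Rightarrow> 'b::real_vector) \<Rightarrow> 'a \<Rightarrow> 'a \<Rightarrow> 'a \<Rightarrow> 'a \<Rightarrow> bool" where
  "lift_coplanar h p00 p10 p01 p11 \<longleftrightarrow>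
    (\<exists>\<alpha> \<beta>. h p11 - h p10 - h p01 + h p00 = \<alpha> *\<^sub>R (h p10 - h p00) + \<beta> *\<^sub>R (h p01 - h p00))"

context conjugate_net
begin

text \<open>Transfers a norm estimate of the defect to its four scalar equations, at the cost of the
  bound \<open>Q\<close> on the inverse frame.\<close>

lemma coord_error:
  assumes Q: "\<And>y. norm (coord p y) \<le> Q * norm y" and p: "p \<in> cball 0 1"
    and err: "norm (E - frame p (x1, x2, x3, x4) - r *\<^sub>R V) \<le> e" and Q0: "0 \<le> Q"
  obtains e1 e2 e3 e4 where "\<bar>e1\<bar> \<le> Q * e" "\<bar>e2\<bar> \<le> Q * e" "\<bar>e3\<bar> \<le> Q * e" "\<bar>e4\<bar> \<le> Q * e"
    "fst (coord p E) = x1 + r * fst (coord p V) + e1"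
    "fst (snd (coord p E)) = x2 + r * fst (snd (coord p V)) + e2"
    "fst (snd (snd (coord p E))) = x3 + r * fst (snd (snd (coord p V))) + e3"
    "snd (snd (snd (coord p E))) = x4 + r * snd (snd (snd (coord p V))) + e4"
proof -
  define D where "D = coord p (E - frame p (x1, x2, x3, x4) - r *\<^sub>R V)"
  have "norm D \<le> Q * e" unfolding D_def by (rule order_trans[OF Q mult_left_mono[OF err Q0]])
  moreover have "norm (fst D) \<le> norm D" "norm (fst (snd D)) \<le> norm (snd D)" "norm (snd D) \<le> norm D"
    "norm (fst (snd (snd D))) \<le> norm (snd (snd D))" "norm (snd (snd D)) \<le> norm (snd D)"
    "norm (snd (snd (snd D))) \<le> norm (snd (snd D))"
    by (metis norm_fst_le norm_snd_le prod.collapse)+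
  ultimately have b: "\<bar>fst D\<bar> \<le> Q * e" "\<bar>fst (snd D)\<bar> \<le> Q * e" "\<bar>fst (snd (snd D))\<bar> \<le> Q * e"
    "\<bar>snd (snd (snd D))\<bar> \<le> Q * e"
    unfolding real_norm_def by linarith+
  have "coord p E = coord p (frame p (x1, x2, x3, x4) + r *\<^sub>R V + (E - frame p (x1, x2, x3, x4) - r *\<^sub>R V))"
    by simp
  also have "\<dots> = (x1, x2, x3, x4) + r *\<^sub>R coord p V + D"
    unfolding D_def by (simp only: linear_add[OF linear_coord[OF p]] linear_cmul[OF linear_coord[OF p]] coord_frame[OF p])
  finally show ?thesis using that[OF b] by simp
qed

lemma continuous_on_defect:
  assumes p: "norm (u, v) \<le> 1" and a: "\<bar>\<epsilon> * X\<bar> + \<bar>\<epsilon> * Y\<bar> + 2 * (\<epsilon> ^ 3 * R) \<le> \<rho> - 1" and \<epsilon>: "0 \<le> \<epsilon>"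
    and S: "\<And>x. x \<in> S \<Longrightarrow> \<bar>w' x\<bar> \<le> R \<and> \<bar>z' x\<bar> \<le> R"
    and c: "continuous_on S w'" "continuous_on S z'" "continuous_on S q1" "continuous_on S q2"
  shows "continuous_on S (\<lambda>x. defect u v \<epsilon> X Y w z (w' x) (z' x) (q1 x) (q2 x))"
proof -
  have "continuous_on S (\<lambda>x. h (u + (\<epsilon> * X + \<epsilon> ^ 3 * w' x), v + (\<epsilon> * Y + \<epsilon> ^ 3 * z' x)))"
  proof (rule continuous_on_compose2[OF smooth_on_continuous_on[OF smooth]])
    show "continuous_on S (\<lambda>x. (u + (\<epsilon> * X + \<epsilon> ^ 3 * w' x), v + (\<epsilon> * Y + \<epsilon> ^ 3 * z' x)))"
      by (intro continuous_intros c)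
    show "(\<lambda>x. (u + (\<epsilon> * X + \<epsilon> ^ 3 * w' x), v + (\<epsilon> * Y + \<epsilon> ^ 3 * z' x))) ` S \<subseteq> U"
    proof (safe)
      fix x assume "x \<in> S"
      then have "\<bar>\<epsilon> ^ 3 * w' x\<bar> \<le> \<epsilon> ^ 3 * R" "\<bar>\<epsilon> ^ 3 * z' x\<bar> \<le> \<epsilon> ^ 3 * R"
        using S \<epsilon> by (auto intro!: abs_mult_le)
      then have "\<bar>\<epsilon> * X + \<epsilon> ^ 3 * w' x\<bar> + \<bar>\<epsilon> * Y + \<epsilon> ^ 3 * z' x\<bar> \<le> \<rho> - 1"
        using a by linarith
      then show "(u + (\<epsilon> * X + \<epsilon> ^ 3 * w' x), v + (\<epsilon> * Y + \<epsilon> ^ 3 * z' x)) \<in> U"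
        using shift_in_cball[OF p] U by blast
    qed
  qed
  then show ?thesis unfolding defect_def by (intro continuous_intros c)
qed

text \<open>\<open>a\<close> and \<open>b\<close> are the deviations of the side lengths at order
  \<epsilon> relative to the mesh. The error is linear in \<open>M\<close>, with a constant
  independent of the data; a quadratic one would spoil the Gronwall argument.\<close>

definition fourth_vertex_bound :: "real \<Rightarrow> real \<Rightarrow> real \<Rightarrow> bool" where
  "fourth_vertex_bound \<sigma> \<tau> C \<longleftrightarrow> (\<forall>u v \<epsilon> a b w z M. norm (u, v) < 1 \<longrightarrow> 0 < \<epsilon> \<longrightarrow>
    M = 1 + \<bar>a\<bar> + \<bar>b\<bar> + \<bar>w\<bar> + \<bar>z\<bar> \<longrightarrow> C * (\<epsilon> * M) \<le> 1 \<longrightarrow>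
    (\<exists>w' z'. \<bar>w' + w - src_u \<sigma> \<tau> (u, v)\<bar> \<le> C * (\<epsilon> * M) \<and> \<bar>z' + z - src_v \<sigma> \<tau> (u, v)\<bar> \<le> C * (\<epsilon> * M) \<and>
      lift_coplanar h (u, v) (u + \<epsilon> * (\<sigma> + \<epsilon> * a), v + \<epsilon> ^ 3 * z) (u + \<epsilon> ^ 3 * w, v + \<epsilon> * (\<tau> + \<epsilon> * b))
        (u + (\<epsilon> * (\<sigma> + \<epsilon> * a) + \<epsilon> ^ 3 * w'), v + (\<epsilon> * (\<tau> + \<epsilon> * b) + \<epsilon> ^ 3 * z'))))"

lemma lift_coplanar_of_defect:
  assumes "defect u v \<epsilon> X Y w z w' z' q1 q2 = 0"
  shows "lift_coplanar h (u, v) (u + \<epsilon> * X, v + \<epsilon> ^ 3 * z) (u + \<epsilon> ^ 3 * w, v + \<epsilon> * Y)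
        (u + (\<epsilon> * X + \<epsilon> ^ 3 * w'), v + (\<epsilon> * Y + \<epsilon> ^ 3 * z'))"
  unfolding lift_coplanar_def
  by (rule exI[of _ "\<epsilon> * Y * cA (u, v) + \<epsilon>\<^sup>2 * q1"], rule exI[of _ "\<epsilon> * X * cB (u, v) + \<epsilon>\<^sup>2 * q2"])
    (use assms in \<open>simp only: defect_def diff_eq_eq add_0_left add.commute\<close>)

text \<open>Eliminating the multipliers from the equations along \<open>hu\<close>, \<open>huu\<close> (and \<open>hv\<close>, \<open>hvv\<close>) leaves
  \<open>w' + w = src_u\<close> and \<open>z' + z = src_v\<close> to leading order; Brouwer's theorem, in a box around the solution
  of this linear system, provides an exact solution.\<close>

lemma fourth_vertex:
  assumes \<sigma>: "\<bar>\<sigma>\<bar> = 1" "\<bar>\<tau>\<bar> = 1"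
  shows "\<exists>C>0. fourth_vertex_bound \<sigma> \<tau> C"
proof -
  obtain Q where Q: "Q > 0" "\<And>p y. p \<in> cball 0 1 \<Longrightarrow> norm (coord p y) \<le> Q * norm y"
    using coord_bounded by blast
  let ?fs = "[cA, cB, g1, g2, k1, k2, \<nu>1 \<sigma> \<tau>, \<nu>2 \<sigma> \<tau>, \<nu>3 \<sigma> \<tau>, \<nu>4 \<sigma> \<tau>]"
  have "\<forall>f\<in>set ?fs. bdd_lipschitz f (cball 0 1)" by (simp add: bdd_lipschitz_coeffs bdd_lipschitz_\<nu>)
  then obtain B where B: "1 \<le> B" and "\<forall>f\<in>set ?fs. \<forall>p\<in>cball 0 1. norm (f p) \<le> B"
    using common_bound by blast
  then have BB: "\<bar>cA p\<bar> \<le> B" "\<bar>cB p\<bar> \<le> B" "\<bar>g1 p\<bar> \<le> B" "\<bar>g2 p\<bar> \<le> B" "\<bar>k1 p\<bar> \<le> B" "\<bar>k2 p\<bar> \<le> B"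
    "\<bar>\<nu>1 \<sigma> \<tau> p\<bar> \<le> B" "\<bar>\<nu>2 \<sigma> \<tau> p\<bar> \<le> B" "\<bar>\<nu>3 \<sigma> \<tau> p\<bar> \<le> B" "\<bar>\<nu>4 \<sigma> \<tau> p\<bar> \<le> B" if "p \<in> cball 0 1" for p
    using that by simp_all
  obtain D where D: "D > 0" and D_bound: "\<forall>u v \<epsilon> M X Y w z w' z' q1 q2 \<sigma> \<tau>. norm (u, v) < 1 \<longrightarrow> almost_square \<epsilon> M \<sigma> \<tau> X Y \<longrightarrow>
    (\<forall>t\<in>{w, z, w', z', q1, q2}. \<bar>t\<bar> \<le> M) \<longrightarrow>
    norm (defect u v \<epsilon> X Y w z w' z' q1 q2 - frame (u, v) (leading_part u v \<epsilon> X Y w z w' z' q1 q2)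
      - \<epsilon> ^ 4 *\<^sub>R V0 \<sigma> \<tau> (u, v)) \<le> D * (\<epsilon> ^ 5 * M)"
    using defect_bound by (elim exE conjE)
  define T where "T = (20 + 4 * (3 * B)) * B"
  define L where "L = 2 * T + (6 * B + 6 * (Q * D))"
  \<comment> \<open>One summand for each consequence of \<open>C * (\<epsilon> * M) \<le> 1\<close>:
    \<open>r \<le> 1\<close>, \<open>\<epsilon> * N \<le> 1 / 2\<close>,
    \<open>8 * \<epsilon> \<le> \<rho> - 1\<close> and
    \<open>\<epsilon> \<le> 1 / 2\<close>.\<close>
  define C where "C = L * (14 * B) + 28 * B + 8 / (\<rho> - 1) + 2"
  have T0: "0 \<le> T" using B by (simp add: T_def)
  have QD: "0 < Q * D" using Q(1) D by simp
  have L0: "0 < L" using T0 QD B unfolding L_def by linarith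
  have C0: "0 < C" using L0 B rho unfolding C_def by (simp add: add_pos_pos)
  have main: "\<exists>w' z'. \<bar>w' + w - src_u \<sigma> \<tau> (u, v)\<bar> \<le> C * (\<epsilon> * M) \<and> \<bar>z' + z - src_v \<sigma> \<tau> (u, v)\<bar> \<le> C * (\<epsilon> * M) \<and>
      lift_coplanar h (u, v) (u + \<epsilon> * (\<sigma> + \<epsilon> * a1), v + \<epsilon> ^ 3 * z) (u + \<epsilon> ^ 3 * w, v + \<epsilon> * (\<tau> + \<epsilon> * b1))
        (u + (\<epsilon> * (\<sigma> + \<epsilon> * a1) + \<epsilon> ^ 3 * w'), v + (\<epsilon> * (\<tau> + \<epsilon> * b1) + \<epsilon> ^ 3 * z'))"
    if p: "norm (u, v) < 1" and \<epsilon>0: "0 < \<epsilon>" and M_eq: "M = 1 + \<bar>a1\<bar> + \<bar>b1\<bar> + \<bar>w\<bar> + \<bar>z\<bar>" and CM: "C * (\<epsilon> * M) \<le> 1"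
    for u v \<epsilon> a1 b1 w z M
  proof -
    have M: "1 \<le> M" and ab: "\<bar>a1\<bar> \<le> M" "\<bar>b1\<bar> \<le> M" and w: "\<bar>w\<bar> \<le> M" "\<bar>z\<bar> \<le> M"
      unfolding M_eq by linarith+
    let ?p = "(u, v)"
    have pb: "?p \<in> ball 0 1" "?p \<in> cball 0 1" "norm ?p \<le> 1" using p by auto
    note bb = BB[OF pb(2)]
    \<comment> \<open>A common bound for old and new data: the box centre has coordinates at most
      \<open>6 * (B * M)\<close>, its radius is at most 1, and division by \<open>X\<close> or
      \<open>Y\<close> can double the resulting \<open>7 * (B * M)\<close>.\<close>
    define N where "N = 14 * B * M"
    have \<epsilon>M: "\<epsilon> \<le> \<epsilon> * M" using \<epsilon>0 M by simp
    have part: "k * (\<epsilon> * M) \<le> 1" if "k \<le> C" for k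
    proof -
      have "k * (\<epsilon> * M) \<le> C * (\<epsilon> * M)" using that \<epsilon>0 M by (intro mult_right_mono) auto
      then show ?thesis using CM by linarith
    qed
    have nn: "0 \<le> L * (14 * B)" "0 \<le> 8 / (\<rho> - 1)" using L0 B rho by simp_all
    have "28 * B * (\<epsilon> * M) \<le> 1" by (rule part) (use nn in \<open>simp add: C_def\<close>)
    then have \<epsilon>N: "\<epsilon> * N \<le> 1 / 2" by (simp add: N_def algebra_simps)
    have "8 / (\<rho> - 1) * (\<epsilon> * M) \<le> 1" by (rule part) (use nn B in \<open>simp add: C_def\<close>)
    then have "8 * (\<epsilon> * M) \<le> \<rho> - 1" using rho by (simp add: field_simps)
    then have \<epsilon>\<rho>: "8 * \<epsilon> \<le> \<rho> - 1" using \<epsilon>M by linarith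
    have "2 * (\<epsilon> * M) \<le> 1" by (rule part) (use nn B in \<open>simp add: C_def\<close>)
    then have \<epsilon>: "0 < \<epsilon>" "\<epsilon> \<le> 1 / 2" "\<epsilon> \<le> 1" using \<epsilon>0 \<epsilon>M by linarith+
    define r where "r = L * (\<epsilon> * N)"
    have r_le: "r \<le> C * (\<epsilon> * M)"
      using mult_right_mono[of "L * (14 * B)" C "\<epsilon> * M"] nn B \<epsilon> M by (simp add: C_def r_def N_def algebra_simps)
    have r0: "0 \<le> r" unfolding r_def N_def using L0 B \<epsilon> M by simp
    have r1: "r \<le> 1" using r_le CM by linarith
    have MB: "M \<le> B * M" "B \<le> B * M" using M B mult_right_mono[of 1 B M] mult_left_mono[of 1 M B] by simp_all
    have "14 * (B * M) = N" by (simp add: N_def)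
    with MB M have N: "1 \<le> N" "M \<le> N" "14 * (B * M) = N" by linarith+
    define X where "X = \<sigma> + \<epsilon> * a1"
    define Y where "Y = \<tau> + \<epsilon> * b1"
    have "\<bar>\<epsilon> * a1\<bar> \<le> \<epsilon> * N" "\<bar>\<epsilon> * b1\<bar> \<le> \<epsilon> * N"
      by (intro abs_mult_le order_trans[OF ab(1) N(2)] order_trans[OF ab(2) N(2)]; use \<epsilon> in simp)+
    then have X: "\<bar>X - \<sigma>\<bar> \<le> \<epsilon> * N" "\<bar>Y - \<tau>\<bar> \<le> \<epsilon> * N" by (simp_all add: X_def Y_def)
    note nx = near_sign_bounds[OF \<sigma> X \<epsilon>N] and ny = near_sign_bounds[OF \<sigma>(2,1) X(2,1) \<epsilon>N]
    have XY0: "X \<noteq> 0" "Y \<noteq> 0" using nx(2) ny(2) by auto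
    have wN: "\<bar>w\<bar> \<le> N" "\<bar>z\<bar> \<le> N" using w N by linarith+
    define \<gamma>1 where "\<gamma>1 = (\<tau> * g1 ?p + \<sigma> * k1 ?p) / 2"
    define \<gamma>2 where "\<gamma>2 = (\<sigma> * k2 ?p + \<tau> * g2 ?p) / 2"
    define n3 where "n3 = \<nu>3 \<sigma> \<tau> ?p"
    define n4 where "n4 = \<nu>4 \<sigma> \<tau> ?p"
    have sB: "\<bar>s * t\<bar> \<le> B" if "\<bar>s\<bar> = 1" "\<bar>t\<bar> \<le> B" for s t :: real
      using that by (simp add: abs_mult)
    have avg: "\<bar>(s + t) / 2\<bar> \<le> B" if "\<bar>s\<bar> \<le> B" "\<bar>t\<bar> \<le> B" for s t :: real
      using that abs_triangle_ineq[of s t] by simp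
    have \<gamma>: "\<bar>\<gamma>1\<bar> \<le> B" "\<bar>\<gamma>2\<bar> \<le> B" "\<bar>\<sigma> * n3\<bar> \<le> B" "\<bar>\<tau> * n4\<bar> \<le> B"
      unfolding \<gamma>1_def \<gamma>2_def n3_def n4_def by (intro avg sB \<sigma> bb)+
    \<comment> \<open>The centre of the box is the exact solution of the leading system. Its
      unknowns are \<open>q1 * X\<close> and \<open>q2 * Y\<close> instead of \<open>q1\<close> and
      \<open>q2\<close>, so that \<open>X\<close>, \<open>Y\<close> drop out of the leading
      tangential equations.\<close>
    define \<alpha>0 where "\<alpha>0 = 2 * \<gamma>1 - 2 * w - 2 * \<sigma> * n3"
    define \<beta>0 where "\<beta>0 = 2 * \<gamma>2 - 2 * z - 2 * \<tau> * n4"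
    define w0 where "w0 = \<gamma>1 - w - 2 * \<sigma> * n3"
    define z0 where "z0 = \<gamma>2 - z - 2 * \<tau> * n4"
    have c0: "\<bar>\<alpha>0\<bar> \<le> 6 * (B * M)" "\<bar>\<beta>0\<bar> \<le> 6 * (B * M)" "\<bar>w0\<bar> \<le> 6 * (B * M)" "\<bar>z0\<bar> \<le> 6 * (B * M)"
      unfolding \<alpha>0_def \<beta>0_def w0_def z0_def mult.assoc using \<gamma> w MB B M unfolding abs_le_iff by linarith+
    have in_box: "\<bar>x\<bar> \<le> 7 * (B * M)" if "\<bar>x - c\<bar> \<le> r" "\<bar>c\<bar> \<le> 6 * (B * M)" for x c
      using abs_center_le[OF that] r1 MB M B by linarith
    define S where "S = cball \<alpha>0 r \<times> cball \<beta>0 r \<times> cball w0 r \<times> cball z0 r"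
    define d where "d x = coord ?p (defect u v \<epsilon> X Y w z (fst (snd (snd x))) (snd (snd (snd x))) (fst x / X) (fst (snd x) / Y))"
      for x :: "real \<times> real \<times> real \<times> real"
    \<comment> \<open>The equations preconditioned by the inverse of the leading system: on the box
      each \<psi> differs from the corresponding component of \<open>x\<close> minus the centre by
      at most \<open>r\<close>.\<close>
    define \<psi>1 where "\<psi>1 x = 2 * fst (snd (snd (d x))) / (\<epsilon> ^ 4 * X) - 2 * fst (d x) / \<epsilon> ^ 3" for x
    define \<psi>2 where "\<psi>2 x = 2 * snd (snd (snd (d x))) / (\<epsilon> ^ 4 * Y) - 2 * fst (snd (d x)) / \<epsilon> ^ 3" for x
    define \<psi>3 where "\<psi>3 x = 2 * fst (snd (snd (d x))) / (\<epsilon> ^ 4 * X) - fst (d x) / \<epsilon> ^ 3" for x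
    define \<psi>4 where "\<psi>4 x = 2 * snd (snd (snd (d x))) / (\<epsilon> ^ 4 * Y) - fst (snd (d x)) / \<epsilon> ^ 3" for x
    have S_D: "\<bar>fst x - \<alpha>0\<bar> \<le> r" "\<bar>fst (snd x) - \<beta>0\<bar> \<le> r" "\<bar>fst (snd (snd x)) - w0\<bar> \<le> r" "\<bar>snd (snd (snd x)) - z0\<bar> \<le> r"
      if "x \<in> S" for x
      using that by (auto simp: S_def dist_real_def abs_minus_commute)
    have est: "\<bar>\<psi>1 x - (fst x - \<alpha>0)\<bar> \<le> r" "\<bar>\<psi>2 x - (fst (snd x) - \<beta>0)\<bar> \<le> r"
       "\<bar>\<psi>3 x - (fst (snd (snd x)) - w0)\<bar> \<le> r" "\<bar>\<psi>4 x - (snd (snd (snd x)) - z0)\<bar> \<le> r" if x: "x \<in> S" for x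
    proof -
      obtain \<alpha>1 \<beta>1 w' z' where xx: "x = (\<alpha>1, \<beta>1, w', z')" by (cases x) auto
      have bx: "\<bar>\<alpha>1\<bar> \<le> 7 * (B * M)" "\<bar>\<beta>1\<bar> \<le> 7 * (B * M)" "\<bar>w'\<bar> \<le> 7 * (B * M)" "\<bar>z'\<bar> \<le> 7 * (B * M)"
        using in_box[OF S_D(1)[OF x] c0(1)] in_box[OF S_D(2)[OF x] c0(2)] in_box[OF S_D(3)[OF x] c0(3)]
          in_box[OF S_D(4)[OF x] c0(4)] by (simp_all add: xx)
      define q1 where "q1 = \<alpha>1 / X"
      define q2 where "q2 = \<beta>1 / Y"
      have quot: "\<bar>t / s\<bar> \<le> N" if "\<bar>t\<bar> \<le> 7 * (B * M)" "1 / 2 \<le> \<bar>s\<bar>" for t s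
      proof -
        have "\<bar>t / s\<bar> \<le> 7 * (B * M) / (1 / 2)" unfolding abs_divide using that by (intro frac_le) auto
        then show ?thesis using N(3) by simp
      qed
      have qN: "\<bar>q1\<bar> \<le> N" "\<bar>q2\<bar> \<le> N" unfolding q1_def q2_def by (intro quot bx nx ny)+
      have wN': "\<bar>w'\<bar> \<le> N" "\<bar>z'\<bar> \<le> N" using bx(3,4) N MB M by linarith+
      have qX: "q1 * X = \<alpha>1" "q2 * Y = \<beta>1" using XY0 by (simp_all add: q1_def q2_def)
      define \<alpha> where "\<alpha> = \<epsilon> * Y * cA ?p + \<epsilon>\<^sup>2 * q1"
      define \<beta> where "\<beta> = \<epsilon> * X * cB ?p + \<epsilon>\<^sup>2 * q2"
      define E where "E = defect u v \<epsilon> X Y w z w' z' q1 q2"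
      have dx: "d x = coord ?p E" by (simp add: d_def xx E_def q1_def q2_def)
      define t1 where "t1 = tang (cA ?p) (g1 ?p) (k1 ?p) \<epsilon> X Y w z w' z' \<alpha> \<beta> \<alpha>1"
      define t2 where "t2 = tang (cB ?p) (k2 ?p) (g2 ?p) \<epsilon> Y X z w z' w' \<beta> \<alpha> \<beta>1"
      have "norm (E - frame ?p (\<epsilon> ^ 3 * t1, \<epsilon> ^ 3 * t2, \<epsilon> ^ 4 * (X * (w' - \<alpha>1 / 2)), \<epsilon> ^ 4 * (Y * (z' - \<beta>1 / 2)))
          - \<epsilon> ^ 4 *\<^sub>R V0 \<sigma> \<tau> ?p) \<le> D * (\<epsilon> ^ 5 * N)"
      proof -
        have "almost_square \<epsilon> N \<sigma> \<tau> X Y" using \<epsilon> \<epsilon>\<rho> N(1) \<epsilon>N \<sigma> X by (simp add: almost_square_def)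
        then have "norm (E - frame ?p (leading_part u v \<epsilon> X Y w z w' z' q1 q2) - \<epsilon> ^ 4 *\<^sub>R V0 \<sigma> \<tau> ?p) \<le> D * (\<epsilon> ^ 5 * N)"
          unfolding E_def by (rule D_bound[rule_format, OF p]) (use wN wN' qN in auto)
        then show ?thesis
          unfolding leading_part_def Let_def t1_def t2_def \<alpha>_def \<beta>_def by (simp only: qX)
      qed
      from coord_error[OF Q(2)[OF pb(2)] pb(2) this less_imp_le[OF Q(1)]]
      obtain e1 e2 e3 e4 where e: "\<bar>e1\<bar> \<le> Q * (D * (\<epsilon> ^ 5 * N))" "\<bar>e2\<bar> \<le> Q * (D * (\<epsilon> ^ 5 * N))"
          "\<bar>e3\<bar> \<le> Q * (D * (\<epsilon> ^ 5 * N))" "\<bar>e4\<bar> \<le> Q * (D * (\<epsilon> ^ 5 * N))"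
        and c: "fst (d x) = \<epsilon> ^ 3 * t1 + \<epsilon> ^ 4 * \<nu>1 \<sigma> \<tau> ?p + e1"
          "fst (snd (d x)) = \<epsilon> ^ 3 * t2 + \<epsilon> ^ 4 * \<nu>2 \<sigma> \<tau> ?p + e2"
          "fst (snd (snd (d x))) = \<epsilon> ^ 4 * (X * (w' - \<alpha>1 / 2)) + \<epsilon> ^ 4 * n3 + e3"
          "snd (snd (snd (d x))) = \<epsilon> ^ 4 * (Y * (z' - \<beta>1 / 2)) + \<epsilon> ^ 4 * n4 + e4"
        unfolding dx \<nu>1_def \<nu>2_def \<nu>3_def \<nu>4_def n3_def n4_def by blast
      note e' = e[folded mult.assoc[of Q D]]
      have \<epsilon>q: "\<bar>\<epsilon>\<^sup>2 * q\<bar> \<le> \<epsilon>" if "\<bar>q\<bar> \<le> N" for q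
      proof -
        have "\<bar>\<epsilon> * (\<epsilon> * q)\<bar> \<le> \<epsilon> * (\<epsilon> * N)" by (intro abs_mult_le that) (use \<epsilon> in auto)
        also have "\<dots> \<le> \<epsilon> * 1" using \<epsilon> \<epsilon>N by (intro mult_left_mono) auto
        finally show ?thesis by (simp add: power2_eq_square mult.assoc)
      qed
      have abs\<epsilon>: "\<bar>\<epsilon>\<bar> \<le> \<epsilon>" using \<epsilon> by simp
      have "\<epsilon> * 1 \<le> \<epsilon> * (3 / 2 * B)" using \<epsilon> B by (intro mult_left_mono) auto
      then have "\<epsilon> * (3 / 2) * B + \<epsilon> \<le> 3 * B * \<epsilon>" by (simp only: mult_1_right mult.assoc mult.commute[of _ \<epsilon>])
      moreover have "\<bar>\<epsilon> * Y * cA ?p\<bar> \<le> \<epsilon> * (3 / 2) * B" "\<bar>\<epsilon> * X * cB ?p\<bar> \<le> \<epsilon> * (3 / 2) * B"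
        by (intro abs_mult_le abs\<epsilon> nx ny bb)+
      ultimately have \<alpha>: "\<bar>\<alpha>\<bar> \<le> 3 * B * \<epsilon>" "\<bar>\<beta>\<bar> \<le> 3 * B * \<epsilon>"
        unfolding \<alpha>_def \<beta>_def using \<epsilon>q[OF qN(1)] \<epsilon>q[OF qN(2)] by linarith+
      have T1: "\<bar>t1 - (\<gamma>1 + w' - w - \<alpha>1)\<bar> \<le> T * (\<epsilon> * N)"
        unfolding t1_def \<gamma>1_def T_def
        by (rule tang_approx[OF \<sigma> X \<epsilon>N \<epsilon>(1,3) N(1) B bb(1,3,5) wN wN' \<alpha>])
      have T2: "\<bar>t2 - (\<gamma>2 + z' - z - \<beta>1)\<bar> \<le> T * (\<epsilon> * N)"
        unfolding t2_def \<gamma>2_def T_def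
        by (rule tang_approx[OF \<sigma>(2,1) X(2,1) \<epsilon>N \<epsilon>(1,3) N(1) B bb(2,6,4) wN(2,1) wN'(2,1) \<alpha>(2,1)])
      note A1 = corner_equations_approx[OF c(1,3) T1 e'(1,3) bb(7) bb(9)[folded n3_def] \<epsilon>(1,3) N(1) nx(2,6)]
      note A2 = corner_equations_approx[OF c(2,4) T2 e'(2,4) bb(8) bb(10)[folded n4_def] \<epsilon>(1,3) N(1) ny(2,6)]
      have r2: "2 * (T * (\<epsilon> * N)) + (6 * B + 6 * (Q * D)) * (\<epsilon> * N) \<le> r"
        unfolding r_def L_def by (simp add: algebra_simps)
      have "0 \<le> T * (\<epsilon> * N)" "0 \<le> (B + Q * D) * (\<epsilon> * N)" using T0 QD B \<epsilon> N by simp_all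
      then have r3: "T * (\<epsilon> * N) + (5 * B + 5 * (Q * D)) * (\<epsilon> * N) \<le> r"
        using r2 by (simp add: algebra_simps)
      show "\<bar>\<psi>1 x - (fst x - \<alpha>0)\<bar> \<le> r" "\<bar>\<psi>2 x - (fst (snd x) - \<beta>0)\<bar> \<le> r"
        "\<bar>\<psi>3 x - (fst (snd (snd x)) - w0)\<bar> \<le> r" "\<bar>\<psi>4 x - (snd (snd (snd x)) - z0)\<bar> \<le> r"
        unfolding \<psi>1_def \<psi>2_def \<psi>3_def \<psi>4_def \<alpha>0_def \<beta>0_def w0_def z0_def
        using order_trans[OF A1(2) r2] order_trans[OF A2(2) r2] order_trans[OF A1(1) r3] order_trans[OF A2(1) r3]
        by (simp_all only: xx fst_conv snd_conv)
    qed
    \<comment> \<open>A simplified Newton step. The estimates \<open>est\<close> say precisely that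
      its image stays in the box, and its fixed points are the common zeros of the \<psi>.\<close>
    define \<Phi> where "\<Phi> x = (fst x - \<psi>1 x, fst (snd x) - \<psi>2 x, fst (snd (snd x)) - \<psi>3 x, snd (snd (snd x)) - \<psi>4 x)" for x
    have "compact S" "convex S" unfolding S_def by (intro compact_Times convex_Times compact_cball convex_cball)+
    moreover have "S \<noteq> {}" using r0 by (auto simp: S_def)
    moreover have "continuous_on S \<Phi>"
    proof -
      have cd: "continuous_on S (\<lambda>x. defect u v \<epsilon> X Y w z (fst (snd (snd x))) (snd (snd (snd x))) (fst x / X) (fst (snd x) / Y))"
      proof (rule continuous_on_defect[OF pb(3), where R = N])
        have "\<bar>\<epsilon> * X\<bar> \<le> \<epsilon> * (3 / 2)" "\<bar>\<epsilon> * Y\<bar> \<le> \<epsilon> * (3 / 2)" by (intro abs_mult_le nx ny; use \<epsilon> in simp)+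
        moreover have "\<epsilon> ^ 3 * N \<le> \<epsilon>"
        proof -
          have "\<epsilon>\<^sup>2 * (\<epsilon> * N) \<le> \<epsilon> * 1" using \<epsilon> \<epsilon>N N by (intro mult_mono) (auto simp: power2_eq_square mult_left_le)
          then show ?thesis by (simp add: eval_nat_numeral)
        qed
        ultimately show "\<bar>\<epsilon> * X\<bar> + \<bar>\<epsilon> * Y\<bar> + 2 * (\<epsilon> ^ 3 * N) \<le> \<rho> - 1" using \<epsilon>\<rho> \<epsilon> by linarith
        show "\<bar>fst (snd (snd x))\<bar> \<le> N \<and> \<bar>snd (snd (snd x))\<bar> \<le> N" if "x \<in> S" for x
          using in_box[OF S_D(3)[OF that] c0(3)] in_box[OF S_D(4)[OF that] c0(4)] N MB M by linarith
      qed (use \<epsilon> XY0 in \<open>auto intro!: continuous_intros\<close>)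
      have "continuous_on UNIV (coord ?p)"
        using linear_coord[OF pb(2)] by (simp add: linear_continuous_on linear_conv_bounded_linear)
      then have "continuous_on S d"
        unfolding d_def by (rule continuous_on_compose2[OF _ cd]) auto
      then show ?thesis unfolding \<Phi>_def \<psi>1_def \<psi>2_def \<psi>3_def \<psi>4_def
        using \<epsilon> XY0 by (intro continuous_intros) auto
    qed
    moreover have "\<Phi> \<in> S \<rightarrow> S"
    proof
      fix x assume "x \<in> S"
      from est[OF this] show "\<Phi> x \<in> S"
        unfolding \<Phi>_def S_def by (simp add: dist_real_def abs_minus_commute algebra_simps)
    qed
    ultimately obtain x where x: "x \<in> S" "\<Phi> x = x" by (rule brouwer)
    then have "\<psi>1 x = 0" "\<psi>2 x = 0" "\<psi>3 x = 0" "\<psi>4 x = 0"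
      by (auto simp: \<Phi>_def prod_eq_iff)
    then have \<psi>z: "2 * fst (snd (snd (d x))) / (\<epsilon> ^ 4 * X) = 2 * fst (d x) / \<epsilon> ^ 3"
      "2 * fst (snd (snd (d x))) / (\<epsilon> ^ 4 * X) = fst (d x) / \<epsilon> ^ 3"
      "2 * snd (snd (snd (d x))) / (\<epsilon> ^ 4 * Y) = 2 * fst (snd (d x)) / \<epsilon> ^ 3"
      "2 * snd (snd (snd (d x))) / (\<epsilon> ^ 4 * Y) = fst (snd (d x)) / \<epsilon> ^ 3"
      unfolding \<psi>1_def \<psi>2_def \<psi>3_def \<psi>4_def by linarith+
    \<comment> \<open>Preconditioning loses no equation: \<open>\<psi>1\<close> and
      \<open>\<psi>3\<close> contain the same normal term but different multiples of the tangential
      one.\<close>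
    have "2 * fst (d x) / \<epsilon> ^ 3 = fst (d x) / \<epsilon> ^ 3" "2 * fst (snd (d x)) / \<epsilon> ^ 3 = fst (snd (d x)) / \<epsilon> ^ 3"
      using \<psi>z by metis+
    then have d12: "fst (d x) = 0" "fst (snd (d x)) = 0"
      using \<epsilon>(1) by (simp_all add: field_simps)
    then have "fst (snd (snd (d x))) = 0" "snd (snd (snd (d x))) = 0"
      using \<psi>z(2,4) \<epsilon>(1) XY0 by auto
    with d12 have "d x = 0" by (simp add: prod_eq_iff)
    then have "frame ?p (d x) = 0" using linear_0[OF linear_frame] by simp
    then have "defect u v \<epsilon> X Y w z (fst (snd (snd x))) (snd (snd (snd x))) (fst x / X) (fst (snd x) / Y) = 0"
      unfolding d_def frame_coord[OF pb(2)] .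
    moreover have "\<bar>fst (snd (snd x)) + w - src_u \<sigma> \<tau> ?p\<bar> \<le> C * (\<epsilon> * M)"
      using S_D(3)[OF x(1)] r_le unfolding w0_def src_u_def \<gamma>1_def n3_def by (simp add: algebra_simps)
    moreover have "\<bar>snd (snd (snd x)) + z - src_v \<sigma> \<tau> ?p\<bar> \<le> C * (\<epsilon> * M)"
      using S_D(4)[OF x(1)] r_le unfolding z0_def src_v_def \<gamma>2_def n4_def by (simp add: algebra_simps)
    ultimately show ?thesis using lift_coplanar_of_defect unfolding X_def Y_def by blast
  qed
  show ?thesis unfolding fourth_vertex_bound_def using C0 by (intro exI[of _ C] conjI allI impI main)
qed

end

section \<open>The discrete Goursat problem\<close>

text \<open>Constant data on both axes suffice because the unknown is the displacement from the
  grid. The rule receives the values at \<open>(i, j)\<close>, \<open>(i + 1, j)\<close>,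
  \<open>(i, j + 1)\<close> in this order.\<close>

fun goursat :: "(nat \<Rightarrow> nat \<Rightarrow> 'a \<Rightarrow> 'a \<Rightarrow> 'a \<Rightarrow> 'a) \<Rightarrow> 'a \<Rightarrow> nat \<Rightarrow> nat \<Rightarrow> 'a" where
  "goursat F c 0 j = c"
| "goursat F c (Suc i) 0 = c"
| "goursat F c (Suc i) (Suc j) = F i j (goursat F c i j) (goursat F c (Suc i) j) (goursat F c i (Suc j))"

lemma goursat_0 [simp]: "goursat F c i 0 = c"
  by (cases i) auto

text \<open>Closure under smaller indices means that \<open>J\<close> contains the dependence
  rectangle of each of its elements. The margin \<open>K * \<epsilon>\<^sup>2\<close> keeps
  displaced vertices in the disk, and the bound 3 limits the number of steps to
  \<open>O(1 / \<epsilon>)\<close>.\<close>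

definition goursat_domain :: "real \<Rightarrow> real \<Rightarrow> real \<Rightarrow> real \<Rightarrow> real \<Rightarrow> real \<Rightarrow> (nat \<times> nat) set \<Rightarrow> bool" where
  "goursat_domain K \<sigma> \<tau> x0 y0 \<epsilon> J \<longleftrightarrow>
    (\<forall>i j i' j'. (i, j) \<in> J \<longrightarrow> i' \<le> i \<longrightarrow> j' \<le> j \<longrightarrow> (i', j') \<in> J) \<and>
    (\<forall>i j. (i, j) \<in> J \<longrightarrow> real i * \<epsilon> \<le> 3 \<and> real j * \<epsilon> \<le> 3 \<and>
      norm (x0 + \<sigma> * real i * \<epsilon>, y0 + \<tau> * real j * \<epsilon>) + K * \<epsilon>\<^sup>2 < 1)"

text \<open>The axis values are prescribed exactly and on all of \<open>nat\<close>, so that nets of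
  neighbouring quadrants agree on their common axis.\<close>

definition quadrant_net :: "(real \<times> real \<Rightarrow> 'b::real_vector) \<Rightarrow> real \<Rightarrow> real \<Rightarrow> real \<Rightarrow> real \<Rightarrow> real \<Rightarrow> real \<Rightarrow>
    (nat \<Rightarrow> nat \<Rightarrow> real \<times> real) \<Rightarrow> bool" where
  "quadrant_net h K \<sigma> \<tau> x0 y0 \<epsilon> p \<longleftrightarrow>
    (\<forall>i. p i 0 = (x0 + \<sigma> * real i * \<epsilon>, y0)) \<and> (\<forall>j. p 0 j = (x0, y0 + \<tau> * real j * \<epsilon>)) \<and>
    (\<forall>J. goursat_domain K \<sigma> \<tau> x0 y0 \<epsilon> J \<longrightarrow>
      (\<forall>i j. (i, j) \<in> J \<longrightarrow> norm (p i j - (x0 + \<sigma> * real i * \<epsilon>, y0 + \<tau> * real j * \<epsilon>)) \<le> K * \<epsilon>\<^sup>2) \<and>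
      (\<forall>i j. (Suc i, Suc j) \<in> J \<longrightarrow> lift_coplanar h (p i j) (p (Suc i) j) (p i (Suc j)) (p (Suc i) (Suc j))))"

lemma quadrant_net_axes:
  assumes "quadrant_net h K \<sigma> \<tau> x0 y0 \<epsilon> p"
  shows "p i 0 = (x0 + \<sigma> * real i * \<epsilon>, y0)" "p 0 j = (x0, y0 + \<tau> * real j * \<epsilon>)"
  using assms[unfolded quadrant_net_def, THEN conjunct1, THEN spec]
    assms[unfolded quadrant_net_def, THEN conjunct2, THEN conjunct1, THEN spec] .

lemma quadrant_netD:
  assumes "quadrant_net h K \<sigma> \<tau> x0 y0 \<epsilon> p" "goursat_domain K \<sigma> \<tau> x0 y0 \<epsilon> J"
  shows "(i, j) \<in> J \<Longrightarrow> norm (p i j - (x0 + \<sigma> * real i * \<epsilon>, y0 + \<tau> * real j * \<epsilon>)) \<le> K * \<epsilon>\<^sup>2"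
    "(Suc i, Suc j) \<in> J \<Longrightarrow> lift_coplanar h (p i j) (p (Suc i) j) (p i (Suc j)) (p (Suc i) (Suc j))"
  using assms unfolding quadrant_net_def by blast+

text \<open>A larger \<open>K\<close> weakens the estimate and at the same time shrinks the class of
  admissible domains.\<close>

lemma quadrant_net_mono:
  assumes net: "quadrant_net h K1 \<sigma> \<tau> x0 y0 \<epsilon> p" and le: "K1 \<le> K2"
  shows "quadrant_net h K2 \<sigma> \<tau> x0 y0 \<epsilon> p"
proof -
  have le': "K1 * \<epsilon>\<^sup>2 \<le> K2 * \<epsilon>\<^sup>2" using le by (intro mult_right_mono) auto
  have dom: "goursat_domain K1 \<sigma> \<tau> x0 y0 \<epsilon> J" if "goursat_domain K2 \<sigma> \<tau> x0 y0 \<epsilon> J" for J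
    using that le' unfolding goursat_domain_def by (meson add_left_mono le_less_trans)
  show ?thesis unfolding quadrant_net_def
    using quadrant_net_axes[OF net] quadrant_netD[OF net dom] le' by (meson order_trans)
qed

lemma power_le_exp:
  fixes x :: real
  assumes "0 \<le> x" "real n * x \<le> b"
  shows "(1 + x) ^ n \<le> exp b"
proof -
  have "(1 + x) ^ n \<le> exp x ^ n"
    using exp_ge_add_one_self[of x] assms(1) by (intro power_mono) auto
  also have "\<dots> = exp (real n * x)" by (simp add: exp_of_nat_mult)
  also have "\<dots> \<le> exp b" using assms(2) by simp
  finally show ?thesis .
qed

context conjugate_net
begin

definition node :: "real \<Rightarrow> real \<Rightarrow> real \<Rightarrow> real \<Rightarrow> real \<Rightarrow> nat \<Rightarrow> nat \<Rightarrow> real \<times> real \<Rightarrow> real \<times> real" where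
  "node \<sigma> \<tau> x0 y0 \<epsilon> i j q = (x0 + \<sigma> * real i * \<epsilon> + \<epsilon>\<^sup>2 * fst q, y0 + \<tau> * real j * \<epsilon> + \<epsilon>\<^sup>2 * snd q)"

text \<open>In the proof, \<open>\<epsilon>\<^sup>2 q\<close> is the displacement of a vertex; \<open>G n\<close> is a Gronwall bound on the diagonal \<open>i + j = n\<close>.\<close>

lemma quadrant:
  assumes \<sigma>: "\<bar>\<sigma>\<bar> = 1" "\<bar>\<tau>\<bar> = 1"
  shows "\<exists>K>0. \<exists>\<epsilon>0>0. \<forall>\<epsilon> x0 y0. 0 < \<epsilon> \<longrightarrow> \<epsilon> < \<epsilon>0 \<longrightarrow> (\<exists>p. quadrant_net h K \<sigma> \<tau> x0 y0 \<epsilon> p)"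
proof -
  obtain C where C: "C > 0" "fourth_vertex_bound \<sigma> \<tau> C"
    using fourth_vertex[OF \<sigma>] by blast
  obtain L1 where L1: "L1 > 0" "\<And>p. p \<in> cball 0 1 \<Longrightarrow> norm (src_u \<sigma> \<tau> p) \<le> L1"
    "\<And>p q. p \<in> cball 0 1 \<Longrightarrow> q \<in> cball 0 1 \<Longrightarrow> norm (src_u \<sigma> \<tau> p - src_u \<sigma> \<tau> q) \<le> L1 * norm (p - q)"
    using bdd_lipschitz_src(1) by (rule bdd_lipschitzE) blast
  obtain L2 where L2: "L2 > 0" "\<And>p. p \<in> cball 0 1 \<Longrightarrow> norm (src_v \<sigma> \<tau> p) \<le> L2"
    "\<And>p q. p \<in> cball 0 1 \<Longrightarrow> q \<in> cball 0 1 \<Longrightarrow> norm (src_v \<sigma> \<tau> p - src_v \<sigma> \<tau> q) \<le> L2 * norm (p - q)"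
    using bdd_lipschitz_src(2) by (rule bdd_lipschitzE) blast
  define k where "k = 1 + C + L1 + L2"
  have k: "1 \<le> k" "C \<le> k" "L1 \<le> k" "L2 \<le> k" using C(1) L1(1) L2(1) by (auto simp: k_def)
  have src: "\<bar>src_u \<sigma> \<tau> p\<bar> \<le> k" "\<bar>src_v \<sigma> \<tau> p\<bar> \<le> k" if "norm p < 1" for p
    using L1(2)[of p] L2(2)[of p] that k by auto
  have src_lip: "\<bar>src_u \<sigma> \<tau> p - src_u \<sigma> \<tau> q\<bar> \<le> k * norm (p - q)" "\<bar>src_v \<sigma> \<tau> p - src_v \<sigma> \<tau> q\<bar> \<le> k * norm (p - q)"
    if "norm p < 1" "norm q < 1" for p q
    using L1(3)[of p q] L2(3)[of p q] that k mult_right_mono[of L1 k "norm (p - q)"] mult_right_mono[of L2 k "norm (p - q)"]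
    by auto
  \<comment> \<open>Twice 11: the size of the data of a quadrilateral is at most
    \<open>11 * G n\<close>, and both the error of the fourth vertex and the change of the source
    cost \<open>k * \<epsilon>\<close> times that size.\<close>
  define \<Lambda> where "\<Lambda> = 22 * k"
  \<comment> \<open>The limit of the Gronwall bound: \<open>i * \<epsilon>\<close> and
    \<open>j * \<epsilon>\<close> are at most 3 each, so
    \<open>(i + j) * \<epsilon> \<le> 6\<close>.\<close>
  define Gs where "Gs = (1 + k) * exp (6 * \<Lambda>)"
  have Gs: "1 \<le> Gs" using k mult_mono[of 1 "1 + k" 1 "exp (6 * \<Lambda>)"] by (auto simp: Gs_def \<Lambda>_def)
  \<comment> \<open>Gives \<open>\<Lambda> * \<epsilon> \<le> 1\<close> and
    \<open>k * (\<epsilon> * (11 * Gs)) \<le> 1\<close>, the latter being the smallness needed to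
    construct a fourth vertex.\<close>
  define \<epsilon>0 where "\<epsilon>0 = 1 / (22 * k * Gs)"
  have kG: "1 \<le> k * Gs" using mult_mono[of 1 k 1 Gs] k Gs by simp
  then have \<epsilon>0: "0 < \<epsilon>0" by (simp add: \<epsilon>0_def mult.assoc)
  have main: "\<exists>p. quadrant_net h (2 * Gs) \<sigma> \<tau> x0 y0 \<epsilon> p"
    if \<epsilon>: "0 < \<epsilon>" "\<epsilon> < \<epsilon>0" for \<epsilon> x0 y0
  proof -
    have "22 * (k * Gs) * \<epsilon> \<le> 1"
      using \<epsilon> kG by (simp add: \<epsilon>0_def field_simps)
    then have \<epsilon>k: "22 * (k * (\<epsilon> * Gs)) \<le> 1" by (simp add: mult_ac)
    have "k * (\<epsilon> * 1) \<le> k * (\<epsilon> * Gs)" using k \<epsilon> Gs by (intro mult_left_mono) auto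
    then have \<epsilon>\<Lambda>: "\<Lambda> * \<epsilon> \<le> 1" using \<epsilon>k by (simp add: \<Lambda>_def)
    have ke: "1 * \<epsilon> \<le> k * \<epsilon>" using k \<epsilon> by (intro mult_right_mono) auto
    have ke2: "\<Lambda> * \<epsilon> = 22 * (k * \<epsilon>)" by (simp add: \<Lambda>_def)
    have \<epsilon>1: "\<epsilon> \<le> 1" and \<epsilon>2: "2 * \<epsilon> \<le> \<Lambda> * \<epsilon>" using \<epsilon>\<Lambda> \<epsilon> ke ke2 by linarith+
    let ?nd = "node \<sigma> \<tau> x0 y0 \<epsilon>"
    \<comment> \<open>This is the \<open>M\<close> of \<open>fourth_vertex_bound\<close>. Increments
      across an edge direction are divided by \<epsilon>, those along it are not.\<close>
    define disp where "disp q00 q10 q01 = 1 + \<bar>fst q10 - fst q00\<bar> + \<bar>snd q01 - snd q00\<bar>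
       + \<bar>(fst q01 - fst q00) / \<epsilon>\<bar> + \<bar>(snd q10 - snd q00) / \<epsilon>\<bar>" for q00 q10 q01 :: "real \<times> real"
    define step where "step i j q00 q10 q01 q11 \<longleftrightarrow>
       \<bar>(fst q11 - fst q10) / \<epsilon> + (fst q01 - fst q00) / \<epsilon> - src_u \<sigma> \<tau> (?nd i j q00)\<bar> \<le> k * (\<epsilon> * disp q00 q10 q01) \<and>
       \<bar>(snd q11 - snd q01) / \<epsilon> + (snd q10 - snd q00) / \<epsilon> - src_v \<sigma> \<tau> (?nd i j q00)\<bar> \<le> k * (\<epsilon> * disp q00 q10 q01) \<and>
       lift_coplanar h (?nd i j q00) (?nd (Suc i) j q10) (?nd i (Suc j) q01) (?nd (Suc i) (Suc j) q11)"
      for i j and q00 q10 q01 q11 :: "real \<times> real"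
    have step_ex: "\<exists>q11. step i j q00 q10 q01 q11"
      if nd: "norm (?nd i j q00) < 1" and sz: "k * (\<epsilon> * disp q00 q10 q01) \<le> 1" for i j q00 q10 q01
    proof -
      let ?u = "fst (?nd i j q00)" and ?v = "snd (?nd i j q00)"
      let ?a = "fst q10 - fst q00" and ?b = "snd q01 - snd q00"
      let ?w = "(fst q01 - fst q00) / \<epsilon>" and ?z = "(snd q10 - snd q00) / \<epsilon>"
      have nd': "norm (?u, ?v) < 1" using nd by simp
      have sz0: "0 \<le> \<epsilon> * disp q00 q10 q01" using \<epsilon> by (simp add: disp_def)
      have Ck: "C * (\<epsilon> * disp q00 q10 q01) \<le> k * (\<epsilon> * disp q00 q10 q01)"
        by (rule mult_right_mono[OF k(2) sz0])
      obtain w' z' where wz: "\<bar>w' + ?w - src_u \<sigma> \<tau> (?u, ?v)\<bar> \<le> C * (\<epsilon> * disp q00 q10 q01)"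
        "\<bar>z' + ?z - src_v \<sigma> \<tau> (?u, ?v)\<bar> \<le> C * (\<epsilon> * disp q00 q10 q01)"
        "lift_coplanar h (?u, ?v) (?u + \<epsilon> * (\<sigma> + \<epsilon> * ?a), ?v + \<epsilon> ^ 3 * ?z) (?u + \<epsilon> ^ 3 * ?w, ?v + \<epsilon> * (\<tau> + \<epsilon> * ?b))
        (?u + (\<epsilon> * (\<sigma> + \<epsilon> * ?a) + \<epsilon> ^ 3 * w'), ?v + (\<epsilon> * (\<tau> + \<epsilon> * ?b) + \<epsilon> ^ 3 * z'))"
        using C(2)[unfolded fourth_vertex_bound_def, rule_format, OF nd' \<epsilon>(1) disp_def order_trans[OF Ck sz]] by blast
      define q11 where "q11 = (fst q10 + \<epsilon> * w', snd q01 + \<epsilon> * z')"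
      \<comment> \<open>Matches the two scalings: deviations \<open>\<epsilon> ^ 3 * w\<close> of a
        quadrilateral are differences of displacements
        \<open>\<epsilon>\<^sup>2 * q\<close>.\<close>
      have e3: "\<epsilon> ^ 3 * (t / \<epsilon>) = \<epsilon>\<^sup>2 * t" for t using \<epsilon>(1) by (simp add: eval_nat_numeral)
      have e3': "\<epsilon> ^ 3 = \<epsilon>\<^sup>2 * \<epsilon>" by (simp add: eval_nat_numeral)
      have pos: "(?u + \<epsilon> * (\<sigma> + \<epsilon> * ?a), ?v + \<epsilon> ^ 3 * ?z) = ?nd (Suc i) j q10"
        "(?u + \<epsilon> ^ 3 * ?w, ?v + \<epsilon> * (\<tau> + \<epsilon> * ?b)) = ?nd i (Suc j) q01"
        "(?u + (\<epsilon> * (\<sigma> + \<epsilon> * ?a) + \<epsilon> ^ 3 * w'), ?v + (\<epsilon> * (\<tau> + \<epsilon> * ?b) + \<epsilon> ^ 3 * z')) = ?nd (Suc i) (Suc j) q11"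
        unfolding e3 unfolding e3' by (simp_all add: node_def q11_def algebra_simps power2_eq_square)
      have quot: "(fst q11 - fst q10) / \<epsilon> = w'" "(snd q11 - snd q01) / \<epsilon> = z'"
        using \<epsilon>(1) by (simp_all add: q11_def)
      have "step i j q00 q10 q01 q11"
        unfolding step_def quot
        using order_trans[OF wz(1) Ck] order_trans[OF wz(2) Ck] wz(3)[unfolded pos] unfolding prod.collapse by blast
      then show ?thesis by blast
    qed
    \<comment> \<open>The choice makes \<open>q\<close> total; its values are meaningful only as
      long as the vertices stay in the disk and the data stay small, which the induction below
      establishes on \<open>J\<close>.\<close>
    define q where "q = goursat (\<lambda>i j q00 q10 q01. SOME q11. step i j q00 q10 q01 q11) (0, 0)"
    have q0: "q i 0 = (0, 0)" "q 0 j = (0, 0)" for i j by (simp_all add: q_def)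
    have q_step: "step i j (q i j) (q (Suc i) j) (q i (Suc j)) (q (Suc i) (Suc j))"
      if "norm (?nd i j (q i j)) < 1" "k * (\<epsilon> * disp (q i j) (q (Suc i) j) (q i (Suc j))) \<le> 1" for i j
      using someI_ex[OF step_ex[OF that]] by (simp add: q_def)
    define p where "p i j = ?nd i j (q i j)" for i j
    define x where "x i j = fst (q i j)" for i j
    define y where "y i j = snd (q i j)" for i j
    define w where "w i j = (x i (Suc j) - x i j) / \<epsilon>" for i j
    define z where "z i j = (y (Suc i) j - y i j) / \<epsilon>" for i j
    have xw: "x i (Suc j) = x i j + \<epsilon> * w i j" and yz: "y (Suc i) j = y i j + \<epsilon> * z i j" for i j
      using \<epsilon>(1) by (simp_all add: w_def z_def)
    have p_diff: "p i j - (x0 + \<sigma> * real i * \<epsilon>, y0 + \<tau> * real j * \<epsilon>) = (\<epsilon>\<^sup>2 * x i j, \<epsilon>\<^sup>2 * y i j)" for i j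
      by (simp add: p_def node_def x_def y_def)
    \<comment> \<open>The initial value \<open>1 + k\<close> dominates both the summand 1 of
      \<open>disp\<close> and the sources, which are bounded by \<open>k\<close>.\<close>
    define G where "G n = (1 + k) * (1 + \<Lambda> * \<epsilon>) ^ n" for n :: nat
    have \<Lambda>0: "0 \<le> \<Lambda> * \<epsilon>" using k \<epsilon> by (simp add: \<Lambda>_def)
    have G_Suc: "G (Suc n) = G n + \<Lambda> * \<epsilon> * G n" for n by (simp add: G_def algebra_simps)
    have G1: "1 + k \<le> G n" for n
    proof -
      have "(1 + k) * 1 \<le> (1 + k) * (1 + \<Lambda> * \<epsilon>) ^ n"
        using k \<Lambda>0 by (intro mult_left_mono one_le_power) auto
      then show ?thesis by (simp add: G_def)
    qed
    have Gpos: "0 \<le> G n" for n using G1[of n] k by linarith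
    have G_Suc_le: "G (Suc n) \<le> 2 * G n" "G n \<le> G (Suc n)" "G n + 2 * \<epsilon> * G n \<le> G (Suc n)" for n
      using mult_right_mono[OF \<epsilon>\<Lambda> Gpos[of n]] mult_right_mono[OF \<Lambda>0 Gpos[of n]] mult_right_mono[OF \<epsilon>2 Gpos[of n]]
      unfolding G_Suc by linarith+
    have G_le: "G (i + j) \<le> Gs" if "real i * \<epsilon> \<le> 3" "real j * \<epsilon> \<le> 3" for i j
    proof -
      have "(real i * \<epsilon> + real j * \<epsilon>) * \<Lambda> \<le> 6 * \<Lambda>"
        using that k by (intro mult_right_mono) (auto simp: \<Lambda>_def)
      then have "(1 + \<Lambda> * \<epsilon>) ^ (i + j) \<le> exp (6 * \<Lambda>)"
        by (intro power_le_exp \<Lambda>0) (simp add: algebra_simps)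
      then show ?thesis unfolding G_def Gs_def using k by (intro mult_left_mono) auto
    qed
    have J: "(\<forall>i j. (i, j) \<in> J \<longrightarrow> norm (p i j - (x0 + \<sigma> * real i * \<epsilon>, y0 + \<tau> * real j * \<epsilon>)) \<le> (2 * Gs) * \<epsilon>\<^sup>2) \<and>
      (\<forall>i j. (Suc i, Suc j) \<in> J \<longrightarrow> lift_coplanar h (p i j) (p (Suc i) j) (p i (Suc j)) (p (Suc i) (Suc j)))"
      if goursat: "goursat_domain (2 * Gs) \<sigma> \<tau> x0 y0 \<epsilon> J" for J
    proof -
      note down = goursat[unfolded goursat_domain_def, THEN conjunct1]
        and dom = goursat[unfolded goursat_domain_def, THEN conjunct2]
      have J_le: "(i', j') \<in> J" if "(i, j) \<in> J" "i' \<le> i" "j' \<le> j" for i j i' j'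
        using down that by blast
      have JG: "G (i + j) \<le> Gs" if "(i, j) \<in> J" for i j
        using G_le dom that by blast
      have near: "norm (p i j - (x0 + \<sigma> * real i * \<epsilon>, y0 + \<tau> * real j * \<epsilon>)) \<le> (2 * Gs) * \<epsilon>\<^sup>2"
        if "(i, j) \<in> J" "\<bar>x i j\<bar> \<le> G (i + j)" "\<bar>y i j\<bar> \<le> G (i + j)" for i j
      proof -
        have "\<bar>\<epsilon>\<^sup>2 * x i j\<bar> \<le> \<epsilon>\<^sup>2 * Gs" "\<bar>\<epsilon>\<^sup>2 * y i j\<bar> \<le> \<epsilon>\<^sup>2 * Gs"
          using that JG[OF that(1)] by (intro abs_mult_le; simp)+
        then show ?thesis unfolding p_diff using norm_pair_le[of "\<epsilon>\<^sup>2 * x i j" "\<epsilon>\<^sup>2 * y i j"]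
          by (simp add: algebra_simps)
      qed
      have inside: "norm (p i j) < 1" if "(i, j) \<in> J" "\<bar>x i j\<bar> \<le> G (i + j)" "\<bar>y i j\<bar> \<le> G (i + j)" for i j
        using near[OF that] dom that(1) norm_triangle_sub[of "p i j" "(x0 + \<sigma> * real i * \<epsilon>, y0 + \<tau> * real j * \<epsilon>)"]
        by fastforce
      have edge: "\<bar>s\<bar> \<le> 2 * G n" if "\<bar>s - t / 2\<bar> \<le> G n" "\<bar>t\<bar> \<le> k" for s t n
        using that G1[of n] k by linarith
      \<comment> \<open>The 11 is 1 + 3 + 3 + 2 + 2: increments along the edges are at most
        \<open>G (i + j) + G (Suc (i + j))\<close>, hence three times \<open>G (i + j)\<close>, and
        \<open>w\<close>, \<open>z\<close> at most twice.\<close>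
      have quad: "step i j (q i j) (q (Suc i) j) (q i (Suc j)) (q (Suc i) (Suc j)) \<and>
           disp (q i j) (q (Suc i) j) (q i (Suc j)) \<le> 11 * G (i + j)"
        if J: "(i, j) \<in> J" and xy: "\<bar>x i j\<bar> \<le> G (i + j)" "\<bar>y i j\<bar> \<le> G (i + j)"
          and xy': "\<bar>x (Suc i) j\<bar> \<le> G (Suc (i + j))" "\<bar>y i (Suc j)\<bar> \<le> G (Suc (i + j))"
          and wz: "\<bar>w i j - src_u \<sigma> \<tau> (p i j) / 2\<bar> \<le> G (i + j)" "\<bar>z i j - src_v \<sigma> \<tau> (p i j) / 2\<bar> \<le> G (i + j)" for i j
      proof -
        note ins = inside[OF J xy]
        have "\<bar>w i j\<bar> \<le> 2 * G (i + j)" "\<bar>z i j\<bar> \<le> 2 * G (i + j)"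
          using edge[OF wz(1) src(1)[OF ins]] edge[OF wz(2) src(2)[OF ins]] .
        moreover have "disp (q i j) (q (Suc i) j) (q i (Suc j)) = 1 + \<bar>x (Suc i) j - x i j\<bar> + \<bar>y i (Suc j) - y i j\<bar> + \<bar>w i j\<bar> + \<bar>z i j\<bar>"
          by (simp add: disp_def x_def y_def w_def z_def)
        moreover have "\<bar>x (Suc i) j - x i j\<bar> \<le> 3 * G (i + j)" "\<bar>y i (Suc j) - y i j\<bar> \<le> 3 * G (i + j)"
          using xy xy' G_Suc_le(1)[of "i + j"] by linarith+
        ultimately have sz: "disp (q i j) (q (Suc i) j) (q i (Suc j)) \<le> 11 * G (i + j)"
          using G1[of "i + j"] k by linarith
        have "k * (\<epsilon> * disp (q i j) (q (Suc i) j) (q i (Suc j))) \<le> k * (\<epsilon> * (11 * Gs))"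
          using sz JG[OF J] k \<epsilon> by (intro mult_left_mono) auto
        also have "\<dots> \<le> 1" using \<epsilon>k k \<epsilon> Gs by simp
        finally show ?thesis using q_step[of i j] ins sz by (simp add: p_def)
      qed
      \<comment> \<open>The bounds on \<open>w\<close> and \<open>z\<close> carry extra guards
        because these quantities involve a vertex on the next diagonal.\<close>
      have inv: "\<forall>i j. i + j = n \<longrightarrow> (i, j) \<in> J \<longrightarrow> \<bar>x i j\<bar> \<le> G n \<and> \<bar>y i j\<bar> \<le> G n \<and>
          ((i, Suc j) \<in> J \<longrightarrow> \<bar>w i j - src_u \<sigma> \<tau> (p i j) / 2\<bar> \<le> G n) \<and>
          ((Suc i, j) \<in> J \<longrightarrow> \<bar>z i j - src_v \<sigma> \<tau> (p i j) / 2\<bar> \<le> G n)" for n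
      proof (induction n)
        case 0
        have "\<bar>w 0 0 - src_u \<sigma> \<tau> (p 0 0) / 2\<bar> \<le> G 0 \<and> \<bar>z 0 0 - src_v \<sigma> \<tau> (p 0 0) / 2\<bar> \<le> G 0 \<and> \<bar>x 0 0\<bar> \<le> G 0 \<and> \<bar>y 0 0\<bar> \<le> G 0"
          if "(0, 0) \<in> J"
        proof -
          have z: "x 0 0 = 0" "y 0 0 = 0" "w 0 0 = 0" "z 0 0 = 0" by (simp_all add: x_def y_def w_def z_def q0)
          then have "norm (p 0 0) < 1" using inside[OF that] Gpos by simp
          from src[OF this] show ?thesis using z G1[of 0] k by simp
        qed
        then show ?case by simp
      next
        case (Suc n)
        have prev: "\<bar>x i j\<bar> \<le> G n" "\<bar>y i j\<bar> \<le> G n"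
          "(i, Suc j) \<in> J \<Longrightarrow> \<bar>w i j - src_u \<sigma> \<tau> (p i j) / 2\<bar> \<le> G n"
          "(Suc i, j) \<in> J \<Longrightarrow> \<bar>z i j - src_v \<sigma> \<tau> (p i j) / 2\<bar> \<le> G n" if "i + j = n" "(i, j) \<in> J" for i j
          using Suc.IH that by blast+
        have grow: "\<bar>a + \<epsilon> * b\<bar> \<le> G (Suc n)" if "\<bar>a\<bar> \<le> G n" "\<bar>b\<bar> \<le> 2 * G n" for a b
        proof -
          have "\<bar>\<epsilon> * b\<bar> \<le> \<epsilon> * (2 * G n)" using that \<epsilon> by (intro abs_mult_le) auto
          then show ?thesis using that(1) G_Suc_le(3)[of n] by linarith
        qed
        have X: "\<bar>x i j\<bar> \<le> G (Suc n)" if ij: "i + j = Suc n" "(i, j) \<in> J" for i j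
        proof (cases j)
          case 0
          then show ?thesis using Gpos by (simp add: x_def q0)
        next
          case (Suc j')
          have J': "(i, j') \<in> J" "i + j' = n" "(i, Suc j') \<in> J" using J_le[OF ij(2)] ij Suc by auto
          have "norm (p i j') < 1" using inside[OF J'(1)] prev[OF J'(2,1)] J'(2) by simp
          from edge[OF prev(3)[OF J'(2,1,3)] src(1)[OF this]] show ?thesis
            unfolding Suc xw by (intro grow prev(1)[OF J'(2,1)])
        qed
        have Y: "\<bar>y i j\<bar> \<le> G (Suc n)" if ij: "i + j = Suc n" "(i, j) \<in> J" for i j
        proof (cases i)
          case 0
          then show ?thesis using Gpos by (simp add: y_def q0)
        next
          case (Suc i')
          have J': "(i', j) \<in> J" "i' + j = n" "(Suc i', j) \<in> J" using J_le[OF ij(2)] ij Suc by auto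
          have "norm (p i' j) < 1" using inside[OF J'(1)] prev[OF J'(2,1)] J'(2) by simp
          from edge[OF prev(4)[OF J'(2,1,3)] src(2)[OF this]] show ?thesis
            unfolding Suc yz by (intro grow prev(2)[OF J'(2,1)])
        qed
        have ins: "norm (p i j) < 1" if "i + j = Suc n" "(i, j) \<in> J" for i j
          using inside[OF that(2)] X[OF that] Y[OF that] that(1) by simp
        \<comment> \<open>From \<open>b - s' / 2 = (b + a - s) - (a - s / 2) - (s' - s) / 2\<close>:
          the deviation from half the source changes its sign, while its size grows only by terms of
          order \<open>\<epsilon> * m\<close>.\<close>
        have flip: "\<bar>b - s' / 2\<bar> \<le> G (Suc n)" if "\<bar>a - s / 2\<bar> \<le> G n" "\<bar>b + a - s\<bar> \<le> k * (\<epsilon> * m)"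
            "\<bar>s' - s\<bar> \<le> k * (\<epsilon> * m)" "m \<le> 11 * G n" for a b s s' m
        proof -
          have "k * (\<epsilon> * m) \<le> k * (\<epsilon> * (11 * G n))" using that(4) k \<epsilon> by (intro mult_left_mono) auto
          moreover have "\<Lambda> * \<epsilon> * G n = 2 * (k * (\<epsilon> * (11 * G n)))" by (simp add: \<Lambda>_def)
          moreover have "0 \<le> k * (\<epsilon> * (11 * G n))" using k \<epsilon> Gpos by simp
          ultimately show ?thesis using that(1-3) unfolding G_Suc by linarith
        qed
        have W: "\<bar>w i j - src_u \<sigma> \<tau> (p i j) / 2\<bar> \<le> G (Suc n)" if ij: "i + j = Suc n" "(i, j) \<in> J" "(i, Suc j) \<in> J" for i j
        proof (cases i)
          case 0
          then have "w i j = 0" by (simp add: w_def x_def q0)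
          then show ?thesis using src(1)[OF ins[OF ij(1,2)]] G1[of "Suc n"] k by simp
        next
          case (Suc i')
          have J': "i' + j = n" "(i', j) \<in> J" "(i', Suc j) \<in> J" "(Suc i', j) \<in> J" using J_le[OF ij(3)] ij Suc by auto
          note pr = prev[OF J'(1,2)]
          have nn: "Suc i' + j = Suc n" "i' + Suc j = Suc n" using J'(1) by auto
          let ?m = "disp (q i' j) (q (Suc i') j) (q i' (Suc j))"
          have qd: "step i' j (q i' j) (q (Suc i') j) (q i' (Suc j)) (q (Suc i') (Suc j)) \<and> ?m \<le> 11 * G n"
            using quad[OF J'(2)] pr(1,2) X[OF nn(1) J'(4)] Y[OF nn(2) J'(3)] pr(3)[OF J'(3)] pr(4)[OF J'(4)] J'(1) by simp
          then have s: "\<bar>w (Suc i') j + w i' j - src_u \<sigma> \<tau> (p i' j)\<bar> \<le> k * (\<epsilon> * ?m)"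
            by (simp add: step_def w_def x_def p_def)
          have pin: "norm (p i' j) < 1" using inside[OF J'(2)] pr(1,2) J'(1) by simp
          have pin': "norm (p (Suc i') j) < 1" by (rule ins[OF nn(1) J'(4)])
          \<comment> \<open>The edge is no longer than \<open>\<epsilon> * ?m\<close>, so the
            Lipschitz source changes by no more than the error already allowed for the fourth
            vertex.\<close>
          have "p (Suc i') j - p i' j = (\<epsilon> * (\<sigma> + \<epsilon> * (x (Suc i') j - x i' j)), \<epsilon> * (\<epsilon> * (\<epsilon> * z i' j)))"
            by (simp add: p_def node_def x_def[symmetric] y_def[symmetric] yz algebra_simps power2_eq_square)
          then have "norm (p (Suc i') j - p i' j) \<le> \<bar>\<epsilon> * (\<sigma> + \<epsilon> * (x (Suc i') j - x i' j))\<bar> + \<bar>\<epsilon> * (\<epsilon> * (\<epsilon> * z i' j))\<bar>"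
            using norm_pair_le by simp
          also have "\<dots> \<le> \<epsilon> * (1 + 1 * \<bar>x (Suc i') j - x i' j\<bar>) + \<epsilon> * (1 * (1 * \<bar>z i' j\<bar>))"
          proof (intro add_mono abs_mult_le)
            have "\<bar>\<epsilon> * (x (Suc i') j - x i' j)\<bar> \<le> 1 * \<bar>x (Suc i') j - x i' j\<bar>"
              by (intro abs_mult_le) (use \<epsilon> \<epsilon>1 in auto)
            then show "\<bar>\<sigma> + \<epsilon> * (x (Suc i') j - x i' j)\<bar> \<le> 1 + 1 * \<bar>x (Suc i') j - x i' j\<bar>"
              using \<sigma>(1) by linarith
          qed (use \<epsilon> \<epsilon>1 in auto)
          also have "\<dots> = \<epsilon> * (1 + \<bar>x (Suc i') j - x i' j\<bar> + \<bar>z i' j\<bar>)" by (simp add: algebra_simps)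
          also have "\<dots> \<le> \<epsilon> * ?m" using \<epsilon> by (intro mult_left_mono) (auto simp: disp_def x_def y_def z_def)
          finally have "k * norm (p (Suc i') j - p i' j) \<le> k * (\<epsilon> * ?m)" using k by (intro mult_left_mono) auto
          then have "\<bar>src_u \<sigma> \<tau> (p (Suc i') j) - src_u \<sigma> \<tau> (p i' j)\<bar> \<le> k * (\<epsilon> * ?m)"
            using src_lip(1)[OF pin' pin] by linarith
          from flip[OF pr(3)[OF J'(3)] s this] qd show ?thesis by (simp add: Suc)
        qed
        have Z: "\<bar>z i j - src_v \<sigma> \<tau> (p i j) / 2\<bar> \<le> G (Suc n)" if ij: "i + j = Suc n" "(i, j) \<in> J" "(Suc i, j) \<in> J" for i j
        proof (cases j)
          case 0
          then have "z i j = 0" by (simp add: z_def y_def q0)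
          then show ?thesis using src(2)[OF ins[OF ij(1,2)]] G1[of "Suc n"] k by simp
        next
          case (Suc j')
          have J': "i + j' = n" "(i, j') \<in> J" "(i, Suc j') \<in> J" "(Suc i, j') \<in> J" using J_le[OF ij(3)] ij Suc by auto
          note pr = prev[OF J'(1,2)]
          have nn: "Suc i + j' = Suc n" "i + Suc j' = Suc n" using J'(1) by auto
          let ?m = "disp (q i j') (q (Suc i) j') (q i (Suc j'))"
          have qd: "step i j' (q i j') (q (Suc i) j') (q i (Suc j')) (q (Suc i) (Suc j')) \<and> ?m \<le> 11 * G n"
            using quad[OF J'(2)] pr(1,2) X[OF nn(1) J'(4)] Y[OF nn(2) J'(3)] pr(3)[OF J'(3)] pr(4)[OF J'(4)] J'(1) by simp
          then have s: "\<bar>z i (Suc j') + z i j' - src_v \<sigma> \<tau> (p i j')\<bar> \<le> k * (\<epsilon> * ?m)"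
            by (simp add: step_def z_def y_def p_def)
          have pin: "norm (p i j') < 1" using inside[OF J'(2)] pr(1,2) J'(1) by simp
          have pin': "norm (p i (Suc j')) < 1" by (rule ins[OF nn(2) J'(3)])
          have "p i (Suc j') - p i j' = (\<epsilon> * (\<epsilon> * (\<epsilon> * w i j')), \<epsilon> * (\<tau> + \<epsilon> * (y i (Suc j') - y i j')))"
            by (simp add: p_def node_def x_def[symmetric] y_def[symmetric] xw algebra_simps power2_eq_square)
          then have "norm (p i (Suc j') - p i j') \<le> \<bar>\<epsilon> * (\<epsilon> * (\<epsilon> * w i j'))\<bar> + \<bar>\<epsilon> * (\<tau> + \<epsilon> * (y i (Suc j') - y i j'))\<bar>"
            using norm_pair_le by simp
          also have "\<dots> \<le> \<epsilon> * (1 * (1 * \<bar>w i j'\<bar>)) + \<epsilon> * (1 + 1 * \<bar>y i (Suc j') - y i j'\<bar>)"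
          proof (intro add_mono abs_mult_le)
            have "\<bar>\<epsilon> * (y i (Suc j') - y i j')\<bar> \<le> 1 * \<bar>y i (Suc j') - y i j'\<bar>"
              by (intro abs_mult_le) (use \<epsilon> \<epsilon>1 in auto)
            then show "\<bar>\<tau> + \<epsilon> * (y i (Suc j') - y i j')\<bar> \<le> 1 + 1 * \<bar>y i (Suc j') - y i j'\<bar>"
              using \<sigma>(2) by linarith
          qed (use \<epsilon> \<epsilon>1 in auto)
          also have "\<dots> = \<epsilon> * (1 + \<bar>y i (Suc j') - y i j'\<bar> + \<bar>w i j'\<bar>)" by (simp add: algebra_simps)
          also have "\<dots> \<le> \<epsilon> * ?m" using \<epsilon> by (intro mult_left_mono) (auto simp: disp_def x_def y_def w_def)
          finally have "k * norm (p i (Suc j') - p i j') \<le> k * (\<epsilon> * ?m)" using k by (intro mult_left_mono) auto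
          then have "\<bar>src_v \<sigma> \<tau> (p i (Suc j')) - src_v \<sigma> \<tau> (p i j')\<bar> \<le> k * (\<epsilon> * ?m)"
            using src_lip(2)[OF pin' pin] by linarith
          from flip[OF pr(4)[OF J'(4)] s this] qd show ?thesis by (simp add: Suc)
        qed
        show ?case using X Y W Z by blast
      qed
      have bounds: "\<bar>x i j\<bar> \<le> G (i + j)" "\<bar>y i j\<bar> \<le> G (i + j)" if "(i, j) \<in> J" for i j
        using inv that by blast+
      have "lift_coplanar h (p i j) (p (Suc i) j) (p i (Suc j)) (p (Suc i) (Suc j))" if "(Suc i, Suc j) \<in> J" for i j
      proof -
        have J': "(i, j) \<in> J" "(Suc i, j) \<in> J" "(i, Suc j) \<in> J" using J_le[OF that] by auto
        have "\<bar>w i j - src_u \<sigma> \<tau> (p i j) / 2\<bar> \<le> G (i + j)" "\<bar>z i j - src_v \<sigma> \<tau> (p i j) / 2\<bar> \<le> G (i + j)"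
          using inv J' by blast+
        from quad[OF J'(1) bounds[OF J'(1)] _ _ this] bounds(1)[OF J'(2)] bounds(2)[OF J'(3)]
        show ?thesis by (simp add: step_def p_def)
      qed
      then show ?thesis using near bounds by blast
    qed
    have "quadrant_net h (2 * Gs) \<sigma> \<tau> x0 y0 \<epsilon> p"
      using J unfolding quadrant_net_def by (simp add: p_def node_def q0)
    then show ?thesis by blast
  qed
  have "0 < 2 * Gs" using Gs by simp
  then show ?thesis using \<epsilon>0 main by blast
qed

end

section \<open>Curvature line parametrizations\<close>

lemma independent_imp_cross_nonzero:
  fixes a b :: "real^3"
  assumes "\<And>s t. s *\<^sub>R a + t *\<^sub>R b = 0 \<Longrightarrow> s = 0 \<and> t = 0"
  shows "cross3 a b \<noteq> 0"
proof
  assume "cross3 a b = 0"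
  then have "a = 0 \<or> b = 0 \<or> (\<exists>c. b = c *\<^sub>R a)"
    by (simp add: cross_eq_0 collinear_lemma)
  then show False
    using assms[of 1 0] assms[of 0 1] assms[of _ "-1"] by auto
qed

lemma orthogonal_cross_frame_eq_0:
  fixes a b y :: "real^3"
  assumes "cross3 a b \<noteq> 0" "y \<bullet> a = 0" "y \<bullet> b = 0" "y \<bullet> cross3 a b = 0"
  shows "y = 0"
proof -
  have "cross3 y (cross3 a b) = (y \<bullet> b) *\<^sub>R a - (y \<bullet> a) *\<^sub>R b" by (simp add: Lagrange)
  then have "y \<bullet> cross3 a b = 0 \<and> cross3 y (cross3 a b) = 0" using assms by simp
  then show ?thesis using assms(1) norm_and_cross_eq_0 by blast
qed

text \<open>Relative to \<open>A\<close>, a point \<open>r\<close> of the plane lies on the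
  circumcircle of the triangle iff \<open>r \<bullet> r = 2 * (v \<bullet> r)\<close>, where
  \<open>v\<close> points to the circumcentre. The right side is linear in \<open>r\<close>, which
  is just what coplanarity of the lifts states for \<open>D\<close>. Independence of the edges is
  essential: collinear points determine no circle.\<close>

lemma concircular_of_coplanar_lift:
  fixes A B C D :: "real^3"
  assumes D: "D = A + \<mu> *\<^sub>R (B - A) + \<nu> *\<^sub>R (C - A)"
    and DD: "D \<bullet> D = A \<bullet> A + \<mu> * (B \<bullet> B - A \<bullet> A) + \<nu> * (C \<bullet> C - A \<bullet> A)"
    and ind: "\<And>s t. s *\<^sub>R (B - A) + t *\<^sub>R (C - A) = 0 \<Longrightarrow> s = 0 \<and> t = 0"
  shows "\<exists>c. is_circle c \<and> {A, B, D, C} \<subseteq> c"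
proof -
  define d where "d = B - A"
  define e where "e = C - A"
  have BC: "B = A + d" "C = A + e" by (simp_all add: d_def e_def)
  have ind': "cross3 d e \<noteq> 0"
    using ind by (intro independent_imp_cross_nonzero) (simp add: d_def e_def)
  define gram where "gram = (d \<bullet> d) * (e \<bullet> e) - (d \<bullet> e)\<^sup>2"
  have "gram = (norm (cross3 d e))\<^sup>2"
    using norm_cross_dot[of d e] by (simp add: gram_def power_mult_distrib power2_norm_eq_inner)
  then have gram: "gram \<noteq> 0" using ind' by simp
  \<comment> \<open>Cramer's rule for the circumcentre \<open>v\<close>, that is for
    \<open>2 * (v \<bullet> d) = d \<bullet> d\<close> and
    \<open>2 * (v \<bullet> e) = e \<bullet> e\<close>; the Gram determinant is the squared norm of
    \<open>cross3 d e\<close>.\<close>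
  define x where "x = ((d \<bullet> d) * (e \<bullet> e) - (e \<bullet> e) * (d \<bullet> e)) / (2 * gram)"
  define y where "y = ((e \<bullet> e) * (d \<bullet> d) - (d \<bullet> d) * (d \<bullet> e)) / (2 * gram)"
  define v where "v = x *\<^sub>R d + y *\<^sub>R e"
  have X: "2 * gram * x = (d \<bullet> d) * (e \<bullet> e) - (e \<bullet> e) * (d \<bullet> e)"
    and Y: "2 * gram * y = (e \<bullet> e) * (d \<bullet> d) - (d \<bullet> d) * (d \<bullet> e)"
    using gram by (simp_all add: x_def y_def)
  have "gram * (2 * (v \<bullet> d)) = (2 * gram * x) * (d \<bullet> d) + (2 * gram * y) * (d \<bullet> e)"
    by (simp add: v_def inner_add_left inner_commute[of e d] algebra_simps)
  also have "\<dots> = gram * (d \<bullet> d)"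
    unfolding X Y unfolding gram_def by (simp add: algebra_simps power2_eq_square)
  finally have vd: "2 * (v \<bullet> d) = d \<bullet> d" using gram by simp
  have "gram * (2 * (v \<bullet> e)) = (2 * gram * x) * (d \<bullet> e) + (2 * gram * y) * (e \<bullet> e)"
    by (simp add: v_def inner_add_left algebra_simps)
  also have "\<dots> = gram * (e \<bullet> e)"
    unfolding X Y unfolding gram_def by (simp add: algebra_simps power2_eq_square)
  finally have ve: "2 * (v \<bullet> e) = e \<bullet> e" using gram by simp
  have "v \<noteq> 0" using vd ind' by auto
  define c where "c = {X. dist (A + v) X = norm v \<and> cross3 d e \<bullet> (X - (A + v)) = 0}"
  have circ: "is_circle c"
    unfolding is_circle_def c_def using ind' \<open>v \<noteq> 0\<close> by (metis zero_less_norm_iff)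
  have mem: "A + s *\<^sub>R d + t *\<^sub>R e \<in> c"
    if "(s *\<^sub>R d + t *\<^sub>R e) \<bullet> (s *\<^sub>R d + t *\<^sub>R e) = s * (d \<bullet> d) + t * (e \<bullet> e)" for s t
  proof -
    let ?r = "s *\<^sub>R d + t *\<^sub>R e"
    have "(v - ?r) \<bullet> (v - ?r) = v \<bullet> v - 2 * (v \<bullet> ?r) + ?r \<bullet> ?r"
      by (simp add: inner_diff_left inner_diff_right inner_commute)
    also have "2 * (v \<bullet> ?r) = s * (d \<bullet> d) + t * (e \<bullet> e)"
      using vd ve by (simp add: inner_add_right algebra_simps)
    finally have "(v - ?r) \<bullet> (v - ?r) = v \<bullet> v" using that by simp
    then have "norm (v - ?r) = norm v" by (simp add: norm_eq_sqrt_inner)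
    then have "dist (A + v) (A + s *\<^sub>R d + t *\<^sub>R e) = norm v"
      by (simp add: dist_norm algebra_simps)
    moreover have "cross3 d e \<bullet> (A + s *\<^sub>R d + t *\<^sub>R e - (A + v)) = 0"
    proof -
      have "A + s *\<^sub>R d + t *\<^sub>R e - (A + v) = (s - x) *\<^sub>R d + (t - y) *\<^sub>R e"
        by (simp add: v_def algebra_simps)
      then show ?thesis by (simp add: inner_add_right dot_cross_self)
    qed
    ultimately show ?thesis by (simp add: c_def)
  qed
  have "(\<mu> *\<^sub>R d + \<nu> *\<^sub>R e) \<bullet> (\<mu> *\<^sub>R d + \<nu> *\<^sub>R e) = \<mu> * (d \<bullet> d) + \<nu> * (e \<bullet> e)"
    using DD unfolding D BC by (simp add: inner_add_left inner_add_right inner_commute algebra_simps)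
  then have "D \<in> c" using mem[of \<mu> \<nu>] unfolding D d_def e_def by simp
  moreover have "A \<in> c" "B \<in> c" "C \<in> c"
    using mem[of 0 0] mem[of 1 0] mem[of 0 1] by (simp_all add: d_def e_def)
  ultimately show ?thesis using circ by blast
qed

lemma du_dv_cong:
  assumes "open U" "\<And>x. x \<in> U \<Longrightarrow> f x = g x" "p \<in> U" "f differentiable (at p)"
  shows "du f p = du g p" "dv f p = dv g p"
proof -
  have "(f has_derivative frechet_derivative f (at p)) (at p)"
    using assms(4) by (simp add: frechet_derivative_works)
  then have "(g has_derivative frechet_derivative f (at p)) (at p)"
    using has_derivative_transform_within_open[OF _ assms(1,3)] assms(2) by blast
  from frechet_derivative_at[OF this] show "du f p = du g p" "dv f p = dv g p"
    by (simp_all add: du_def dv_def)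
qed

lemma du_dv_eqI:
  assumes "(f has_derivative f') (at p)"
  shows "du f p = f' (1, 0)" "dv f p = f' (0, 1)"
  using frechet_derivative_at[OF assms] by (simp_all add: du_def dv_def)

lemma has_derivative_du_dv:
  assumes "f differentiable (at p)"
  shows "(f has_derivative frechet_derivative f (at p)) (at p)"
    "frechet_derivative f (at p) (1, 0) = du f p" "frechet_derivative f (at p) (0, 1) = dv f p"
  using assms by (simp_all add: frechet_derivative_works du_def dv_def)

definition paraboloid_lift :: "('a \<Rightarrow> 'b::real_inner) \<Rightarrow> 'a \<Rightarrow> 'b \<times> real" where
  "paraboloid_lift g p = (g p, g p \<bullet> g p)"

section \<open>Curvature line parametrizations without umbilics\<close>

locale curvature_line_piece =
  fixes g :: "real \<times> real \<Rightarrow> real^3" and U :: "(real \<times> real) set" and \<rho> :: real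
  assumes open_U: "open U" and smooth: "smooth_on g U" and rho: "\<rho> > 1" and U: "cball 0 \<rho> \<subseteq> U"
    and immersion: "immersion_on g (cball 0 1)"
    and curvature: "curvature_line_parametrized_on g (cball 0 1)"
    and no_umbilic: "\<And>p. p \<in> cball 0 1 \<Longrightarrow> \<not> umbilic g p"
begin

lemma disk_U: "cball 0 1 \<subseteq> U"
  using U rho by (meson less_imp_le order_trans subset_cball)

lemmas diff = smooth_on_differentiable
lemmas smooths = smooth smooth_du[OF smooth] smooth_dv[OF smooth]
  smooth_du[OF smooth_du[OF smooth]] smooth_dv[OF smooth_du[OF smooth]] smooth_dv[OF smooth_dv[OF smooth]]
  smooth_du[OF smooth_dv[OF smooth]]

lemma cross_nonzero:
  assumes "p \<in> cball 0 1"
  shows "cross3 (du g p) (dv g p) \<noteq> 0"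
proof (rule independent_imp_cross_nonzero)
  fix s t assume st: "s *\<^sub>R du g p + t *\<^sub>R dv g p = 0"
  have pU: "p \<in> U" using assms disk_U by blast
  have "frechet_derivative g (at p) = (\<lambda>w. fst w *\<^sub>R du g p + snd w *\<^sub>R dv g p)"
    using frechet_derivative_at[OF smooth_on_has_derivative[OF smooth pU]] by simp
  moreover have "inj (frechet_derivative g (at p))"
    using immersion assms by (simp add: immersion_on_def)
  ultimately have "(s, t) = (0, 0)"
    using st by (intro injD[of "frechet_derivative g (at p)"]) auto
  then show "s = 0 \<and> t = 0" by simp
qed

lemma unit_normal_differentiable:
  assumes "p \<in> cball 0 1"
  shows "unit_normal g differentiable (at p)"
proof -
  have pU: "p \<in> U" using assms disk_U by blast
  have bb: "bounded_bilinear cross3" using bilinear_cross bilinear_conv_bounded_bilinear by blast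
  have "(\<lambda>p. cross3 (du g p) (dv g p)) differentiable (at p)"
    using bounded_bilinear.FDERIV[OF bb has_derivative_du_dv(1)[OF diff[OF smooths(2) pU]]
        has_derivative_du_dv(1)[OF diff[OF smooths(3) pU]]]
    by (auto simp: differentiable_def)
  moreover have "(norm \<circ> (\<lambda>p. cross3 (du g p) (dv g p))) differentiable (at p)"
    using calculation cross_nonzero[OF assms]
    by (intro differentiable_chain_at differentiable_norm_at) auto
  ultimately have "(\<lambda>p. inverse (norm (cross3 (du g p) (dv g p))) *\<^sub>R cross3 (du g p) (dv g p)) differentiable (at p)"
    using cross_nonzero[OF assms] by (intro differentiable_scaleR differentiable_inverse) (auto simp: o_def)
  moreover have "unit_normal g = (\<lambda>p. inverse (norm (cross3 (du g p) (dv g p))) *\<^sub>R cross3 (du g p) (dv g p))"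
    by (auto simp: unit_normal_def du_def dv_def sgn_div_norm)
  ultimately show ?thesis by simp
qed

lemma unit_normal_orthogonal: "unit_normal g q \<bullet> du g q = 0" "unit_normal g q \<bullet> dv g q = 0"
  by (simp_all add: unit_normal_def du_def dv_def sgn_div_norm dot_cross_self)

text \<open>The coordinate directions span the tangent plane, so equal principal curvatures in them
  would make the point umbilic.\<close>

lemma principal:
  assumes p: "p \<in> cball 0 1"
  obtains k1 k2 where "du (unit_normal g) p = - (k1 *\<^sub>R du g p)" "dv (unit_normal g) p = - (k2 *\<^sub>R dv g p)" "k1 \<noteq> k2"
proof -
  obtain u v where uv: "p = (u, v)" by fastforce
  have "principal_direction g p (1, 0)"
  proof -
    have "vector_derivative (\<lambda>t. (t, v)) (at u) = (1, 0)"
      by (rule vector_derivative_at) (auto intro!: derivative_eq_intros simp: has_vector_derivative_def)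
    then show ?thesis
      using curvature p unfolding curvature_line_parametrized_on_def line_of_curvature_def uv
      by (metis mem_Collect_eq)
  qed
  then obtain k1 where k1: "- frechet_derivative (unit_normal g) (at p) (1, 0) = k1 *\<^sub>R frechet_derivative g (at p) (1, 0)"
    by (auto simp: principal_direction_def)
  have "principal_direction g p (0, 1)"
  proof -
    have "vector_derivative (\<lambda>t. (u, t)) (at v) = (0, 1)"
      by (rule vector_derivative_at) (auto intro!: derivative_eq_intros simp: has_vector_derivative_def)
    then show ?thesis
      using curvature p unfolding curvature_line_parametrized_on_def line_of_curvature_def uv
      by (metis mem_Collect_eq)
  qed
  then obtain k2 where k2: "- frechet_derivative (unit_normal g) (at p) (0, 1) = k2 *\<^sub>R frechet_derivative g (at p) (0, 1)"
    by (auto simp: principal_direction_def)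
  have k12: "du (unit_normal g) p = - (k1 *\<^sub>R du g p)" "dv (unit_normal g) p = - (k2 *\<^sub>R dv g p)"
    using k1 k2 unfolding du_def dv_def by (metis add.inverse_inverse)+
  have "k1 \<noteq> k2"
  proof
    assume k: "k1 = k2"
    have lin: "linear (frechet_derivative f (at p))" if "f differentiable (at p)" for f :: "real \<times> real \<Rightarrow> real^3"
      using has_derivative_du_dv(1)[OF that] has_derivative_linear by blast
    have eq: "frechet_derivative f (at p) w = fst w *\<^sub>R du f p + snd w *\<^sub>R dv f p"
      if "f differentiable (at p)" for f :: "real \<times> real \<Rightarrow> real^3" and w
    proof -
      have "frechet_derivative f (at p) w = frechet_derivative f (at p) (fst w *\<^sub>R (1, 0) + snd w *\<^sub>R (0, 1))" by simp
      also have "\<dots> = fst w *\<^sub>R du f p + snd w *\<^sub>R dv f p"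
        by (simp only: linear_add[OF lin[OF that]] linear_cmul[OF lin[OF that]] du_def dv_def)
      finally show ?thesis .
    qed
    have pU: "p \<in> U" using p disk_U by blast
    have "- frechet_derivative (unit_normal g) (at p) w = k1 *\<^sub>R frechet_derivative g (at p) w" for w
      unfolding eq[OF unit_normal_differentiable[OF p]] eq[OF diff[OF smooth pU]]
      by (simp add: k12 k algebra_simps)
    then show False using no_umbilic[OF p] by (auto simp: umbilic_def)
  qed
  with k12 show ?thesis by (rule that)
qed

text \<open>Differentiate \<open>unit_normal g q \<bullet> f q = 0\<close>. Used for both tangent
  fields, it expresses the second fundamental form by derivatives of the normal.\<close>

lemma normal_derivative:
  assumes p: "p \<in> cball 0 1" and f: "smooth_on f U" and orth: "\<And>q. unit_normal g q \<bullet> f q = 0"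
  shows "unit_normal g p \<bullet> du f p = - (du (unit_normal g) p \<bullet> f p)"
    "unit_normal g p \<bullet> dv f p = - (dv (unit_normal g) p \<bullet> f p)"
proof -
  have pU: "p \<in> U" using p disk_U by blast
  have "((\<lambda>q. unit_normal g q \<bullet> f q) has_derivative
      (\<lambda>w. unit_normal g p \<bullet> frechet_derivative f (at p) w + frechet_derivative (unit_normal g) (at p) w \<bullet> f p)) (at p)"
    by (rule has_derivative_inner[OF has_derivative_du_dv(1)[OF unit_normal_differentiable[OF p]]
          has_derivative_du_dv(1)[OF diff[OF f pU]]])
  then have "((\<lambda>q. 0) has_derivative
      (\<lambda>w. unit_normal g p \<bullet> frechet_derivative f (at p) w + frechet_derivative (unit_normal g) (at p) w \<bullet> f p)) (at p)"
    by (simp add: orth)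
  from has_derivative_unique[OF this has_derivative_const]
  have "unit_normal g p \<bullet> frechet_derivative f (at p) w + frechet_derivative (unit_normal g) (at p) w \<bullet> f p = 0" for w
    by meson
  from this[of "(1, 0)"] this[of "(0, 1)"] show "unit_normal g p \<bullet> du f p = - (du (unit_normal g) p \<bullet> f p)"
    "unit_normal g p \<bullet> dv f p = - (dv (unit_normal g) p \<bullet> f p)"
    by (simp_all add: du_def dv_def)
qed

text \<open>The normal part of the mixed derivative equals both \<open>k1\<close> and
  \<open>k2\<close> times \<open>du g p \<bullet> dv g p\<close>, by symmetry of mixed derivatives;
  as \<open>k1 \<noteq> k2\<close>, the net is orthogonal and conjugate at once.\<close>

lemma second_fundamental_form:
  assumes p: "p \<in> cball 0 1"
  obtains k1 k2 where "k1 \<noteq> k2" "du g p \<bullet> dv g p = 0" "unit_normal g p \<bullet> dv (du g) p = 0"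
    "unit_normal g p \<bullet> du (du g) p = k1 * (du g p \<bullet> du g p)" "unit_normal g p \<bullet> dv (dv g) p = k2 * (dv g p \<bullet> dv g p)"
proof -
  have pU: "p \<in> U" using p disk_U by blast
  obtain k1 k2 where k: "du (unit_normal g) p = - (k1 *\<^sub>R du g p)" "dv (unit_normal g) p = - (k2 *\<^sub>R dv g p)" "k1 \<noteq> k2"
    using principal[OF p] .
  note nu = normal_derivative[OF p smooths(2) unit_normal_orthogonal(1)]
  note nv = normal_derivative[OF p smooths(3) unit_normal_orthogonal(2)]
  have 1: "unit_normal g p \<bullet> dv (du g) p = k2 * (du g p \<bullet> dv g p)"
    using nu(2) by (simp add: k inner_commute)
  have "unit_normal g p \<bullet> dv (du g) p = k1 * (du g p \<bullet> dv g p)"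
    using nv(1) mixed_partials_commute[OF open_U smooth pU] by (simp add: k)
  with 1 k(3) have 2: "du g p \<bullet> dv g p = 0" by simp
  show ?thesis
    by (rule that[OF k(3) 2]) (use nu(1) nv(2) 1 2 in \<open>simp_all add: k\<close>)
qed

lemma coordinate_lines_orthogonal: "p \<in> cball 0 1 \<Longrightarrow> du g p \<bullet> dv g p = 0"
  and mixed_partial_tangential: "p \<in> cball 0 1 \<Longrightarrow> unit_normal g p \<bullet> dv (du g) p = 0"
  by (erule second_fundamental_form, assumption)+

lemma tangents_nonzero: "p \<in> cball 0 1 \<Longrightarrow> du g p \<bullet> du g p \<noteq> 0" "p \<in> cball 0 1 \<Longrightarrow> dv g p \<bullet> dv g p \<noteq> 0"
  using cross_nonzero by fastforce+

text \<open>Projection coefficients, valid because the tangents are orthogonal; as explicit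
  quotients they are differentiable, which is needed to differentiate the Laplace equation.\<close>

definition "lap_A q = (dv (du g) q \<bullet> du g q) / (du g q \<bullet> du g q)"
definition "lap_B q = (dv (du g) q \<bullet> dv g q) / (dv g q \<bullet> dv g q)"

lemma laplace_equation:
  assumes p: "p \<in> cball 0 1"
  shows "dv (du g) p = lap_A p *\<^sub>R du g p + lap_B p *\<^sub>R dv g p"
proof -
  note orth = coordinate_lines_orthogonal[OF p]
  have "unit_normal g p = inverse (norm (cross3 (du g p) (dv g p))) *\<^sub>R cross3 (du g p) (dv g p)"
    by (simp add: unit_normal_def du_def dv_def sgn_div_norm)
  then have n: "dv (du g) p \<bullet> cross3 (du g p) (dv g p) = 0"
    using mixed_partial_tangential[OF p] cross_nonzero[OF p] by (simp add: inner_commute)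
  have "dv (du g) p - (lap_A p *\<^sub>R du g p + lap_B p *\<^sub>R dv g p) = 0"
  proof (rule orthogonal_cross_frame_eq_0[OF cross_nonzero[OF p]])
    show "(dv (du g) p - (lap_A p *\<^sub>R du g p + lap_B p *\<^sub>R dv g p)) \<bullet> du g p = 0"
      using orth tangents_nonzero[OF p] by (simp add: lap_A_def inner_diff_left inner_add_left inner_commute[of "dv g p" "du g p"])
    show "(dv (du g) p - (lap_A p *\<^sub>R du g p + lap_B p *\<^sub>R dv g p)) \<bullet> dv g p = 0"
      using orth tangents_nonzero[OF p] by (simp add: lap_B_def inner_diff_left inner_add_left)
    show "(dv (du g) p - (lap_A p *\<^sub>R du g p + lap_B p *\<^sub>R dv g p)) \<bullet> cross3 (du g p) (dv g p) = 0"
      using n by (simp add: inner_diff_left inner_add_left dot_cross_self)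
  qed
  then show ?thesis by simp
qed

section \<open>The lift to the paraboloid is a conjugate net\<close>

abbreviation "H \<equiv> paraboloid_lift g"

lemma smooth_H: "smooth_on H U"
  using smooth unfolding smooth_on_def paraboloid_lift_def[abs_def]
  by (intro allI Ck_on_Pair Ck_on_inner open_U) auto

text \<open>A common product rule: the last component of \<open>H\<close> and of its first
  derivatives is a combination of inner products, so each further derivative is one
  instance.\<close>

lemma lift_derivatives:
  assumes a: "smooth_on a U" and b: "smooth_on b U" and p: "p \<in> U" and F: "smooth_on F U"
    and eq: "\<And>q. q \<in> U \<Longrightarrow> F q = (a q :: real^3, c * (b q \<bullet> d q) + c' * (b' q \<bullet> d' q) :: real)"
    and s: "smooth_on d U" "smooth_on b' U" "smooth_on d' U"
  shows "du F p = (du a p, c * (du b p \<bullet> d p + b p \<bullet> du d p) + c' * (du b' p \<bullet> d' p + b' p \<bullet> du d' p))"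
    "dv F p = (dv a p, c * (dv b p \<bullet> d p + b p \<bullet> dv d p) + c' * (dv b' p \<bullet> d' p + b' p \<bullet> dv d' p))"
proof -
  note D = has_derivative_du_dv(1)[OF diff[OF _ p]]
  have "((\<lambda>q. (a q, c * (b q \<bullet> d q) + c' * (b' q \<bullet> d' q))) has_derivative
    (\<lambda>w. (frechet_derivative a (at p) w, c * (b p \<bullet> frechet_derivative d (at p) w + frechet_derivative b (at p) w \<bullet> d p)
      + c' * (b' p \<bullet> frechet_derivative d' (at p) w + frechet_derivative b' (at p) w \<bullet> d' p)))) (at p)"
    by (intro has_derivative_Pair has_derivative_add has_derivative_mult_right has_derivative_inner D a b s)
  from du_dv_eqI[OF this]
  show "du F p = (du a p, c * (du b p \<bullet> d p + b p \<bullet> du d p) + c' * (du b' p \<bullet> d' p + b' p \<bullet> du d' p))"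
    "dv F p = (dv a p, c * (dv b p \<bullet> d p + b p \<bullet> dv d p) + c' * (dv b' p \<bullet> d' p + b' p \<bullet> dv d' p))"
    using du_dv_cong[OF open_U eq p diff[OF F p]] by (simp_all add: du_def dv_def add.commute)
qed

lemma H_u: "q \<in> U \<Longrightarrow> du H q = (du g q, 2 * (du g q \<bullet> g q))"
  and H_v: "q \<in> U \<Longrightarrow> dv H q = (dv g q, 2 * (dv g q \<bullet> g q))"
  using lift_derivatives[OF smooth smooth _ smooth_H, of q 1 g 0 g g] smooth
  by (simp_all add: paraboloid_lift_def inner_commute)

lemma H_uu: "q \<in> U \<Longrightarrow> du (du H) q = (du (du g) q, 2 * (du (du g) q \<bullet> g q + du g q \<bullet> du g q))"
  and H_uv: "q \<in> U \<Longrightarrow> dv (du H) q = (dv (du g) q, 2 * (dv (du g) q \<bullet> g q + du g q \<bullet> dv g q))"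
  using lift_derivatives[OF smooths(2,2) _ smooth_du[OF smooth_H], of q 2 g 0 g g] H_u smooth
  by simp_all

lemma H_vv: "q \<in> U \<Longrightarrow> dv (dv H) q = (dv (dv g) q, 2 * (dv (dv g) q \<bullet> g q + dv g q \<bullet> dv g q))"
  using lift_derivatives(2)[OF smooths(3,3) _ smooth_dv[OF smooth_H], of q 2 g 0 g g] H_v smooth
  by simp

text \<open>The last component of the mixed derivative of \<open>H\<close> exceeds that of the
  linear combination by \<open>2 * (du g p \<bullet> dv g p)\<close>, which vanishes by
  orthogonality. So the lift satisfies the Laplace equation of \<open>g\<close> with the same
  coefficients.\<close>

lemma laplace_equation_lift:
  assumes p: "p \<in> cball 0 1"
  shows "dv (du H) p = lap_A p *\<^sub>R du H p + lap_B p *\<^sub>R dv H p"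
proof -
  have pU: "p \<in> U" using p disk_U by blast
  have "dv (du g) p \<bullet> g p = (lap_A p *\<^sub>R du g p + lap_B p *\<^sub>R dv g p) \<bullet> g p"
    using laplace_equation[OF p] by simp
  then show ?thesis using laplace_equation[OF p] coordinate_lines_orthogonal[OF p]
    by (simp add: H_u[OF pU] H_v[OF pU] H_uv[OF pU] inner_add_left algebra_simps)
qed

lemma lap_differentiable:
  assumes p: "p \<in> cball 0 1"
  shows "lap_A differentiable (at p)" "lap_B differentiable (at p)"
proof -
  have pU: "p \<in> U" using p disk_U by blast
  show "lap_A differentiable (at p)" "lap_B differentiable (at p)"
    unfolding lap_A_def[abs_def] lap_B_def[abs_def]
    by (intro differentiable_divide differentiable_inner diff[OF _ pU] smooths tangents_nonzero[OF p])+
qed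

text \<open>Restricted to the open ball because the Laplace equation, known on the closed disk only,
  must hold in a neighbourhood to be differentiated. The mixed derivative reappearing on the right
  is eliminated by the equation itself.\<close>

lemma laplace_derivatives:
  assumes p: "p \<in> ball 0 1"
  shows "du (dv (du H)) p = (du lap_A p + lap_B p * lap_A p) *\<^sub>R du H p + (du lap_B p + lap_B p * lap_B p) *\<^sub>R dv H p
      + lap_A p *\<^sub>R du (du H) p"
    "dv (dv (du H)) p = (dv lap_A p + lap_A p * lap_A p) *\<^sub>R du H p + (dv lap_B p + lap_A p * lap_B p) *\<^sub>R dv H p
      + lap_B p *\<^sub>R dv (dv H) p"
proof -
  have pc: "p \<in> cball 0 1" and pU: "p \<in> U" using p disk_U by auto
  note D = has_derivative_du_dv(1)
  have "((\<lambda>q. lap_A q *\<^sub>R du H q + lap_B q *\<^sub>R dv H q) has_derivative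
     (\<lambda>w. (lap_A p *\<^sub>R frechet_derivative (du H) (at p) w + frechet_derivative lap_A (at p) w *\<^sub>R du H p)
       + (lap_B p *\<^sub>R frechet_derivative (dv H) (at p) w + frechet_derivative lap_B (at p) w *\<^sub>R dv H p))) (at p)"
    by (intro has_derivative_add has_derivative_scaleR D lap_differentiable[OF pc] diff[OF _ pU]
        smooth_du smooth_dv smooth_H)
  note E = du_dv_eqI[OF this]
  have c: "du (dv (du H)) p = du (\<lambda>q. lap_A q *\<^sub>R du H q + lap_B q *\<^sub>R dv H q) p"
    "dv (dv (du H)) p = dv (\<lambda>q. lap_A q *\<^sub>R du H q + lap_B q *\<^sub>R dv H q) p"
    by (rule du_dv_cong[OF open_ball laplace_equation_lift p diff[OF _ pU]]; use smooth_H in auto)+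
  have m: "frechet_derivative (dv H) (at p) (1, 0) = dv (du H) p"
    using mixed_partials_commute[OF open_U smooth_H pU] by (simp add: du_def)
  show "du (dv (du H)) p = (du lap_A p + lap_B p * lap_A p) *\<^sub>R du H p + (du lap_B p + lap_B p * lap_B p) *\<^sub>R dv H p
      + lap_A p *\<^sub>R du (du H) p"
    unfolding c E m laplace_equation_lift[OF pc] by (simp add: du_def[symmetric] algebra_simps)
  have m': "frechet_derivative (du H) (at p) (0, 1) = dv (du H) p" by (simp add: dv_def)
  show "dv (dv (du H)) p = (dv lap_A p + lap_A p * lap_A p) *\<^sub>R du H p + (dv lap_B p + lap_A p * lap_B p) *\<^sub>R dv H p
      + lap_B p *\<^sub>R dv (dv H) p"
    unfolding c E m' laplace_equation_lift[OF pc] by (simp add: dv_def[symmetric] algebra_simps)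
qed

text \<open>The last component gives \<open>x3 * E + x4 * G = 0\<close>, the normal component
  \<open>k1 * (x3 * E) + k2 * (x4 * G) = 0\<close>, with \<open>E\<close>, \<open>G\<close> the
  squared lengths of the tangents. The determinant is \<open>k2 - k1\<close>, so absence of umbilics
  kills \<open>x3\<close> and \<open>x4\<close>; orthogonality of the tangents does the
  rest.\<close>

lemma lift_frame_independent:
  assumes p: "p \<in> cball 0 1"
    and eq: "x1 *\<^sub>R du H p + x2 *\<^sub>R dv H p + x3 *\<^sub>R du (du H) p + x4 *\<^sub>R dv (dv H) p = 0"
  shows "x1 = 0 \<and> x2 = 0 \<and> x3 = 0 \<and> x4 = 0"
proof -
  have pU: "p \<in> U" using p disk_U by blast
  obtain k1 k2 where k: "k1 \<noteq> k2" "du g p \<bullet> dv g p = 0"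
    "unit_normal g p \<bullet> du (du g) p = k1 * (du g p \<bullet> du g p)" "unit_normal g p \<bullet> dv (dv g) p = k2 * (dv g p \<bullet> dv g p)"
    by (rule second_fundamental_form[OF p]) blast
  note t = tangents_nonzero[OF p]
  have y: "x1 *\<^sub>R du g p + x2 *\<^sub>R dv g p + x3 *\<^sub>R du (du g) p + x4 *\<^sub>R dv (dv g) p = 0" (is "?y = 0")
    and q: "x1 * (2 * (du g p \<bullet> g p)) + x2 * (2 * (dv g p \<bullet> g p)) + x3 * (2 * (du (du g) p \<bullet> g p + du g p \<bullet> du g p))
      + x4 * (2 * (dv (dv g) p \<bullet> g p + dv g p \<bullet> dv g p)) = 0"
    using eq by (simp_all add: H_u[OF pU] H_v[OF pU] H_uu[OF pU] H_vv[OF pU] prod_eq_iff)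
  have "2 * (?y \<bullet> g p) = 0" by (simp add: y)
  with q have 1: "x3 * (du g p \<bullet> du g p) + x4 * (dv g p \<bullet> dv g p) = 0"
    by (simp add: inner_add_left algebra_simps)
  have "unit_normal g p \<bullet> ?y = 0" by (simp add: y)
  then have 2: "k1 * (x3 * (du g p \<bullet> du g p)) + k2 * (x4 * (dv g p \<bullet> dv g p)) = 0"
    by (simp add: inner_add_right unit_normal_orthogonal k algebra_simps)
  have "x4 * (dv g p \<bullet> dv g p) = - (x3 * (du g p \<bullet> du g p))" using 1 by linarith
  with 2 have "(k1 - k2) * (x3 * (du g p \<bullet> du g p)) = 0" by (simp add: algebra_simps)
  then have x3: "x3 = 0" using k(1) t by simp
  then have x4: "x4 = 0" using 1 t by simp
  have "?y \<bullet> du g p = 0" "?y \<bullet> dv g p = 0" by (simp_all add: y)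
  then have "x1 = 0" "x2 = 0"
    using x3 x4 k(2) t by (simp_all add: inner_add_left inner_commute[of "dv g p" "du g p"])
  then show ?thesis using x3 x4 by simp
qed

lemma conjugate_net_H: "conjugate_net H U \<rho>"
proof unfold_locales
  show "\<exists>A B g1 g2 k1 k2. dv (du H) p = A *\<^sub>R du H p + B *\<^sub>R dv H p \<and>
      du (dv (du H)) p = g1 *\<^sub>R du H p + g2 *\<^sub>R dv H p + A *\<^sub>R du (du H) p \<and>
      dv (dv (du H)) p = k1 *\<^sub>R du H p + k2 *\<^sub>R dv H p + B *\<^sub>R dv (dv H) p" if p: "p \<in> ball 0 1" for p
  proof -
    have "p \<in> cball 0 1" using p by auto
    from laplace_equation_lift[OF this] laplace_derivatives[OF p] show ?thesis by blast
  qed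
qed (use open_U smooth_H rho U lift_frame_independent in auto)

section \<open>Nondegenerate quadrilaterals and the four quadrants\<close>

text \<open>Excludes collinear vertices, for which coplanar lifts would not yield a genuine
  circle.\<close>

definition nondegenerate_below :: "real \<Rightarrow> real \<Rightarrow> bool" where
  "nondegenerate_below K \<epsilon>1 \<longleftrightarrow> (\<forall>\<epsilon> \<sigma> \<tau> p00 p10 p01. 0 < \<epsilon> \<longrightarrow> \<epsilon> < \<epsilon>1 \<longrightarrow> \<bar>\<sigma>\<bar> = 1 \<longrightarrow> \<bar>\<tau>\<bar> = 1 \<longrightarrow>
    p00 \<in> ball 0 1 \<longrightarrow> p10 \<in> ball 0 1 \<longrightarrow> p01 \<in> ball 0 1 \<longrightarrow>
    norm (p10 - p00 - (\<sigma> * \<epsilon>, 0)) \<le> K * \<epsilon>\<^sup>2 \<longrightarrow> norm (p01 - p00 - (0, \<tau> * \<epsilon>)) \<le> K * \<epsilon>\<^sup>2 \<longrightarrow>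
    (\<forall>s t. s *\<^sub>R (g p10 - g p00) + t *\<^sub>R (g p01 - g p00) = 0 \<longrightarrow> s = 0 \<and> t = 0))"

text \<open>Up to \<open>O(\<epsilon>\<^sup>2)\<close> the edges are \<epsilon> times orthogonal
  vectors whose lengths have a positive lower bound on the disk. Testing a vanishing combination
  with these two vectors bounds its coefficients by a small multiple of themselves.\<close>

lemma edges_independent:
  assumes K: "K > 0"
  shows "\<exists>\<epsilon>1>0. nondegenerate_below K \<epsilon>1"
proof -
  obtain C where C: "C > 0" "\<And>u v x y d. (u, v) \<in> cball 0 1 \<Longrightarrow> (u + x, v + y) \<in> cball 0 1 \<Longrightarrow> \<bar>x\<bar> \<le> d \<Longrightarrow> \<bar>y\<bar> \<le> d \<Longrightarrow>
    norm (g (u + x, v + y) - g (u, v) - x *\<^sub>R du g (u, v) - y *\<^sub>R dv g (u, v)) \<le> C * d ^ 2"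
    using smooth_on_taylor1[OF smooth compact_cball convex_cball disk_U] by blast
  obtain B1 where B1: "B1 > 0" "\<And>p. p \<in> cball 0 1 \<Longrightarrow> norm (du g p) \<le> B1"
    using smooth_on_bounded[OF smooths(2) compact_cball disk_U] by blast
  obtain B2 where B2: "B2 > 0" "\<And>p. p \<in> cball 0 1 \<Longrightarrow> norm (dv g p) \<le> B2"
    using smooth_on_bounded[OF smooths(3) compact_cball disk_U] by blast
  define B where "B = B1 + B2"
  have B: "0 < B" "\<And>p. p \<in> cball 0 1 \<Longrightarrow> norm (du g p) \<le> B" "\<And>p. p \<in> cball 0 1 \<Longrightarrow> norm (dv g p) \<le> B"
    using B1 B2 unfolding B_def by (auto intro: add_increasing add_increasing2)
  have lower: "\<exists>m>0. \<forall>p\<in>cball 0 1. m \<le> f p \<bullet> f p"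
    if f: "smooth_on f U" and nz: "\<And>p. p \<in> cball 0 1 \<Longrightarrow> f p \<bullet> f p \<noteq> 0" for f :: "real \<times> real \<Rightarrow> real^3"
  proof -
    have "continuous_on (cball 0 1) f"
      using smooth_on_continuous_on[OF f] disk_U continuous_on_subset by blast
    then have "continuous_on (cball 0 1) (\<lambda>p. f p \<bullet> f p)" by (intro continuous_intros)
    then obtain p where p: "p \<in> cball 0 1" "\<And>q. q \<in> cball 0 1 \<Longrightarrow> f p \<bullet> f p \<le> f q \<bullet> f q"
      using continuous_attains_inf[OF compact_cball, of 0 1 "\<lambda>p. f p \<bullet> f p"] by auto
    then show ?thesis using nz[OF p(1)] by (intro exI[of _ "f p \<bullet> f p"]) (auto simp: order_less_le)
  qed
  obtain m1 where m1: "m1 > 0" "\<And>p. p \<in> cball 0 1 \<Longrightarrow> m1 \<le> du g p \<bullet> du g p"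
    using lower[OF smooths(2) tangents_nonzero(1)] by blast
  obtain m2 where m2: "m2 > 0" "\<And>p. p \<in> cball 0 1 \<Longrightarrow> m2 \<le> dv g p \<bullet> dv g p"
    using lower[OF smooths(3) tangents_nonzero(2)] by blast
  define m where "m = min m1 m2"
  have m: "m > 0" "\<And>p. p \<in> cball 0 1 \<Longrightarrow> m \<le> du g p \<bullet> du g p" "\<And>p. p \<in> cball 0 1 \<Longrightarrow> m \<le> dv g p \<bullet> dv g p"
    using m1 m2 unfolding m_def by (auto intro: min.coboundedI1 min.coboundedI2)
  \<comment> \<open>The Taylor remainder for offsets up to \<open>2 * \<epsilon>\<close>, plus the
    error of \<open>K * \<epsilon>\<^sup>2\<close> in each coordinate of the offset.\<close>
  define D where "D = 4 * C + 2 * K * B"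
  have D: "D > 0" unfolding D_def using C(1) K B(1) by (simp add: add_pos_pos)
  \<comment> \<open>The first entry ensures \<open>K * \<epsilon>\<^sup>2 \<le> \<epsilon>\<close>,
    the second that the quadratic errors lose against \<open>\<epsilon> * m\<close>.\<close>
  define \<epsilon>1 where "\<epsilon>1 = min (1 / K) (m / (2 * D * B))"
  have \<epsilon>1: "\<epsilon>1 > 0" unfolding \<epsilon>1_def using K m(1) D B(1) by simp
  have "s = 0 \<and> t = 0"
    if \<epsilon>: "0 < \<epsilon>" "\<epsilon> < \<epsilon>1" and \<sigma>: "\<bar>\<sigma>\<bar> = 1" "\<bar>\<tau>\<bar> = 1"
      and p: "p00 \<in> ball 0 1" "p10 \<in> ball 0 1" "p01 \<in> ball 0 1"
      and near: "norm (p10 - p00 - (\<sigma> * \<epsilon>, 0)) \<le> K * \<epsilon>\<^sup>2" "norm (p01 - p00 - (0, \<tau> * \<epsilon>)) \<le> K * \<epsilon>\<^sup>2"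
      and st: "s *\<^sub>R (g p10 - g p00) + t *\<^sub>R (g p01 - g p00) = 0"
    for \<epsilon> \<sigma> \<tau> p00 p10 p01 s t
  proof -
    have pc: "p00 \<in> cball 0 1" "p10 \<in> cball 0 1" "p01 \<in> cball 0 1" using p by auto
    have "K * \<epsilon> \<le> 1" using \<epsilon> K by (simp add: \<epsilon>1_def field_simps)
    then have K\<epsilon>: "K * \<epsilon>\<^sup>2 \<le> \<epsilon>" using \<epsilon>(1) mult_right_mono[of "K * \<epsilon>" 1 \<epsilon>] by (simp add: power2_eq_square)
    have rem: "norm (g q - g p00 - (a *\<^sub>R du g p00 + b *\<^sub>R dv g p00)) \<le> D * \<epsilon>\<^sup>2"
      if q: "q \<in> cball 0 1" and ab: "\<bar>a\<bar> \<le> \<epsilon>" "\<bar>b\<bar> \<le> \<epsilon>" and nq: "norm (q - p00 - (a, b)) \<le> K * \<epsilon>\<^sup>2" for q a b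
    proof -
      let ?x = "fst q - fst p00" and ?y = "snd q - snd p00"
      have x: "\<bar>?x - a\<bar> \<le> K * \<epsilon>\<^sup>2" "\<bar>?y - b\<bar> \<le> K * \<epsilon>\<^sup>2"
        using norm_fst_le[of "?x - a" "?y - b"] norm_snd_le[of "?y - b" "?x - a"] nq
        by (auto simp: minus_prod_def)
      then have xd: "\<bar>?x\<bar> \<le> 2 * \<epsilon>" "\<bar>?y\<bar> \<le> 2 * \<epsilon>" using ab K\<epsilon> by linarith+
      have "norm (g q - g p00 - ?x *\<^sub>R du g p00 - ?y *\<^sub>R dv g p00) \<le> C * (2 * \<epsilon>) ^ 2"
        using C(2)[of "fst p00" "snd p00" ?x ?y "2 * \<epsilon>"] xd pc(1) q by simp
      moreover have "norm ((?x - a) *\<^sub>R du g p00 + (?y - b) *\<^sub>R dv g p00) \<le> 2 * (K * \<epsilon>\<^sup>2) * B"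
        by (rule norm_scaleR_add_le[OF B(2)[OF pc(1)] B(3)[OF pc(1)] x])
      ultimately have "norm ((g q - g p00 - ?x *\<^sub>R du g p00 - ?y *\<^sub>R dv g p00)
          + ((?x - a) *\<^sub>R du g p00 + (?y - b) *\<^sub>R dv g p00)) \<le> C * (2 * \<epsilon>) ^ 2 + 2 * (K * \<epsilon>\<^sup>2) * B"
        by (rule norm_triangle_mono)
      then show ?thesis by (simp add: D_def algebra_simps power_mult_distrib)
    qed
    define R1 where "R1 = g p10 - g p00 - (\<sigma> * \<epsilon>) *\<^sub>R du g p00"
    define R2 where "R2 = g p01 - g p00 - (\<tau> * \<epsilon>) *\<^sub>R dv g p00"
    have R: "norm R1 \<le> D * \<epsilon>\<^sup>2" "norm R2 \<le> D * \<epsilon>\<^sup>2"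
      using rem[OF pc(2), of "\<sigma> * \<epsilon>" 0] rem[OF pc(3), of 0 "\<tau> * \<epsilon>"] \<sigma> \<epsilon>(1) near
      by (simp_all add: R1_def R2_def abs_mult)
    have z: "s *\<^sub>R ((\<sigma> * \<epsilon>) *\<^sub>R du g p00 + R1) + t *\<^sub>R ((\<tau> * \<epsilon>) *\<^sub>R dv g p00 + R2) = 0"
      using st by (simp add: R1_def R2_def)
    have orth: "du g p00 \<bullet> dv g p00 = 0" using coordinate_lines_orthogonal[OF pc(1)] .
    have inn: "\<bar>r * (Q \<bullet> y)\<bar> \<le> \<bar>r\<bar> * (D * \<epsilon>\<^sup>2 * B)" if "norm Q \<le> D * \<epsilon>\<^sup>2" "norm y \<le> B" for r and Q y :: "real^3"
    proof -
      have "\<bar>Q \<bullet> y\<bar> \<le> norm Q * norm y" by (rule Cauchy_Schwarz_ineq2)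
      also have "\<dots> \<le> D * \<epsilon>\<^sup>2 * B" using that D by (intro mult_mono) auto
      finally show ?thesis by (simp add: abs_mult mult_left_mono)
    qed
    have one: "\<bar>r\<bar> * (\<epsilon> * m) \<le> (\<bar>s\<bar> + \<bar>t\<bar>) * (D * \<epsilon>\<^sup>2 * B)"
      if "r * (\<theta> * \<epsilon>) * (y \<bullet> y) + s * (R1 \<bullet> y) + t * (R2 \<bullet> y) = 0" "\<bar>\<theta>\<bar> = 1" "norm y \<le> B" "m \<le> y \<bullet> y" for r \<theta> and y :: "real^3"
    proof -
      have "\<bar>r\<bar> * (\<epsilon> * m) \<le> \<bar>r\<bar> * (\<epsilon> * (y \<bullet> y))" using that \<epsilon> by (intro mult_left_mono) auto
      also have "\<dots> = \<bar>r * (\<theta> * \<epsilon>) * (y \<bullet> y)\<bar>" using that(2) \<epsilon> by (simp add: abs_mult)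
      also have "\<dots> = \<bar>s * (R1 \<bullet> y) + t * (R2 \<bullet> y)\<bar>" using that(1) by linarith
      also have "\<dots> \<le> \<bar>s * (R1 \<bullet> y)\<bar> + \<bar>t * (R2 \<bullet> y)\<bar>" by (rule abs_triangle_ineq)
      also have "\<dots> \<le> \<bar>s\<bar> * (D * \<epsilon>\<^sup>2 * B) + \<bar>t\<bar> * (D * \<epsilon>\<^sup>2 * B)"
        by (intro add_mono inn R that)
      finally show ?thesis by (simp add: algebra_simps)
    qed
    have "(s *\<^sub>R ((\<sigma> * \<epsilon>) *\<^sub>R du g p00 + R1) + t *\<^sub>R ((\<tau> * \<epsilon>) *\<^sub>R dv g p00 + R2)) \<bullet> du g p00 = 0"
      "(s *\<^sub>R ((\<sigma> * \<epsilon>) *\<^sub>R du g p00 + R1) + t *\<^sub>R ((\<tau> * \<epsilon>) *\<^sub>R dv g p00 + R2)) \<bullet> dv g p00 = 0"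
      unfolding z by simp_all
    then have "s * (\<sigma> * \<epsilon>) * (du g p00 \<bullet> du g p00) + s * (R1 \<bullet> du g p00) + t * (R2 \<bullet> du g p00) = 0"
      "t * (\<tau> * \<epsilon>) * (dv g p00 \<bullet> dv g p00) + s * (R1 \<bullet> dv g p00) + t * (R2 \<bullet> dv g p00) = 0"
      using orth by (simp_all add: inner_add_left inner_commute[of "dv g p00" "du g p00"] algebra_simps)
    from one[OF this(1) \<sigma>(1) B(2)[OF pc(1)] m(2)[OF pc(1)]] one[OF this(2) \<sigma>(2) B(3)[OF pc(1)] m(3)[OF pc(1)]]
    have "(\<bar>s\<bar> + \<bar>t\<bar>) * (\<epsilon> * m) \<le> (\<bar>s\<bar> + \<bar>t\<bar>) * (2 * (D * \<epsilon>\<^sup>2 * B))"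
      by (simp add: algebra_simps)
    moreover have "2 * (D * \<epsilon>\<^sup>2 * B) < \<epsilon> * m"
    proof -
      have "\<epsilon> * (2 * D * B) < m" using \<epsilon>(2) D B(1) by (simp add: \<epsilon>1_def pos_less_divide_eq)
      then have "\<epsilon> * (\<epsilon> * (2 * D * B)) < \<epsilon> * m" using \<epsilon>(1) by (rule mult_strict_left_mono)
      then show ?thesis by (simp add: power2_eq_square algebra_simps)
    qed
    ultimately have "\<not> 0 < \<bar>s\<bar> + \<bar>t\<bar>" by (meson leD mult_strict_left_mono)
    then show ?thesis by linarith
  qed
  then have "nondegenerate_below K \<epsilon>1" unfolding nondegenerate_below_def by blast
  then show ?thesis using \<epsilon>1 by blast
qed

text \<open>There are only four pairs of signs, so the sum of the constants and the minimum of the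
  mesh bounds serve all of them.\<close>

lemma four_quadrants:
  "\<exists>K>0. \<exists>\<epsilon>0>0. \<forall>\<epsilon> x0 y0. 0 < \<epsilon> \<longrightarrow> \<epsilon> < \<epsilon>0 \<longrightarrow>
    (\<forall>\<sigma>\<in>{1,-1}. \<forall>\<tau>\<in>{1,-1}. \<exists>p. quadrant_net H K \<sigma> \<tau> x0 y0 \<epsilon> p)"
proof -
  have "\<exists>K>0. \<exists>\<epsilon>0>0. \<forall>\<epsilon> x0 y0. 0 < \<epsilon> \<longrightarrow> \<epsilon> < \<epsilon>0 \<longrightarrow> (\<exists>p. quadrant_net H K \<sigma> \<tau> x0 y0 \<epsilon> p)"
    if "\<sigma> \<in> {1,-1}" "\<tau> \<in> {1,-1}" for \<sigma> \<tau>
    using that by (intro conjugate_net.quadrant[OF conjugate_net_H]) auto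
  then obtain K \<epsilon>0 where q: "\<And>\<sigma> \<tau>. \<sigma> \<in> {1,-1} \<Longrightarrow> \<tau> \<in> {1,-1} \<Longrightarrow> 0 < K \<sigma> \<tau> \<and> 0 < \<epsilon>0 \<sigma> \<tau> \<and>
      (\<forall>\<epsilon> x0 y0. 0 < \<epsilon> \<longrightarrow> \<epsilon> < \<epsilon>0 \<sigma> \<tau> \<longrightarrow> (\<exists>p. quadrant_net H (K \<sigma> \<tau>) \<sigma> \<tau> x0 y0 \<epsilon> p))"
    by metis
  define K' where "K' = K 1 1 + K 1 (-1) + K (-1) 1 + K (-1) (-1)"
  define e' where "e' = min (min (\<epsilon>0 1 1) (\<epsilon>0 1 (-1))) (min (\<epsilon>0 (-1) 1) (\<epsilon>0 (-1) (-1)))"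
  have pos: "0 < K 1 1" "0 < K 1 (-1)" "0 < K (-1) 1" "0 < K (-1) (-1)"
    "0 < \<epsilon>0 1 1" "0 < \<epsilon>0 1 (-1)" "0 < \<epsilon>0 (-1) 1" "0 < \<epsilon>0 (-1) (-1)"
    using q[of 1 1] q[of 1 "-1"] q[of "-1" 1] q[of "-1" "-1"] by simp_all
  have K': "K \<sigma> \<tau> \<le> K'" if "\<sigma> \<in> {1,-1}" "\<tau> \<in> {1,-1}" for \<sigma> \<tau>
    using that pos by (auto simp: K'_def)
  have e': "e' \<le> \<epsilon>0 \<sigma> \<tau>" if "\<sigma> \<in> {1,-1}" "\<tau> \<in> {1,-1}" for \<sigma> \<tau>
    using that by (auto simp: e'_def)
  have "\<exists>p. quadrant_net H K' \<sigma> \<tau> x0 y0 \<epsilon> p"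
    if \<epsilon>: "0 < \<epsilon>" "\<epsilon> < e'" and \<sigma>: "\<sigma> \<in> {1,-1}" "\<tau> \<in> {1,-1}" for \<epsilon> x0 y0 \<sigma> \<tau>
  proof -
    obtain p where "quadrant_net H (K \<sigma> \<tau>) \<sigma> \<tau> x0 y0 \<epsilon> p"
      using q[OF \<sigma>] \<epsilon> e'[OF \<sigma>] by (meson order_less_le_trans)
    from quadrant_net_mono[OF this K'[OF \<sigma>]] show ?thesis by blast
  qed
  moreover have "0 < K'" "0 < e'" using pos by (simp_all add: K'_def e'_def)
  ultimately show ?thesis by blast
qed

lemma circle_through_lift_coplanar:
  assumes "lift_coplanar H p00 p10 p01 p11"
    and ind: "\<And>s t. s *\<^sub>R (g p10 - g p00) + t *\<^sub>R (g p01 - g p00) = 0 \<Longrightarrow> s = 0 \<and> t = 0"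
  shows "\<exists>c. is_circle c \<and> {g p00, g p10, g p11, g p01} \<subseteq> c"
proof -
  obtain \<alpha> \<beta> where "H p11 - H p10 - H p01 + H p00 = \<alpha> *\<^sub>R (H p10 - H p00) + \<beta> *\<^sub>R (H p01 - H p00)"
    using assms(1) by (auto simp: lift_coplanar_def)
  then have "g p11 = g p00 + (1 + \<alpha>) *\<^sub>R (g p10 - g p00) + (1 + \<beta>) *\<^sub>R (g p01 - g p00)"
    "g p11 \<bullet> g p11 = g p00 \<bullet> g p00 + (1 + \<alpha>) * (g p10 \<bullet> g p10 - g p00 \<bullet> g p00) + (1 + \<beta>) * (g p01 \<bullet> g p01 - g p00 \<bullet> g p00)"
    by (simp_all add: paraboloid_lift_def algebra_simps)
  from concircular_of_coplanar_lift[OF this ind] show ?thesis .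
qed

end

section \<open>Circular nets on the disk\<close>

lemma unit_disk_eq_ball: "unit_disk = ball 0 1"
  by (auto simp: unit_disk_def norm_Pair real_sqrt_lt_1_iff)

text \<open>Stepping back towards index 0 decreases the distance from the axis, except that with
  \<sigma> = -1 the start \<open>a\<close> may lie farther out than later points. This overshoot is
  below \<epsilon>, hence the extra \<open>\<epsilon>\<^sup>2\<close>.\<close>

lemma axis_distance:
  fixes a \<epsilon> \<sigma> :: real
  assumes "0 \<le> a" "a < \<epsilon>" "m \<le> m'" "\<sigma> \<in> {1,-1}"
  shows "(a + \<sigma> * real m * \<epsilon>)\<^sup>2 \<le> (a + \<sigma> * real m' * \<epsilon>)\<^sup>2 + \<epsilon>\<^sup>2"
proof -
  have mm: "real m * \<epsilon> \<le> real m' * \<epsilon>" using assms by (intro mult_right_mono) auto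
  have m0: "0 \<le> real m * \<epsilon>" using assms by simp
  consider "\<sigma> = 1" | "\<sigma> = -1" "m = 0" | "\<sigma> = -1" "1 \<le> m" using assms(4) by fastforce
  then show ?thesis
  proof cases
    case 1
    have "(a + real m * \<epsilon>)\<^sup>2 \<le> (a + real m' * \<epsilon>)\<^sup>2" using assms mm m0 by (intro power_mono) auto
    then show ?thesis using 1 by (simp add: add_increasing2)
  next
    case 2
    have "a\<^sup>2 \<le> \<epsilon>\<^sup>2" using assms by (intro power_mono) auto
    then show ?thesis using 2 by (simp add: add_increasing)
  next
    case 3
    have "1 * \<epsilon> \<le> real m * \<epsilon>" using 3 assms by (intro mult_right_mono) auto
    then have "0 \<le> real m * \<epsilon> - a" using assms by linarith
    then have "(real m * \<epsilon> - a)\<^sup>2 \<le> (real m' * \<epsilon> - a)\<^sup>2" using mm by (intro power_mono) auto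
    moreover have "(a + \<sigma> * real k * \<epsilon>)\<^sup>2 = (real k * \<epsilon> - a)\<^sup>2" for k
      using 3 by (simp add: power2_commute)
    ultimately show ?thesis by (simp add: add_increasing2)
  qed
qed

lemma nearest_index:
  fixes x \<epsilon> :: real
  assumes "0 < \<epsilon>"
  obtains k :: int where "0 \<le> x + of_int k * \<epsilon>" "x + of_int k * \<epsilon> < \<epsilon>"
proof
  let ?k = "\<lceil>- x / \<epsilon>\<rceil>"
  have "- x / \<epsilon> \<le> of_int ?k" "of_int ?k - 1 < - x / \<epsilon>" by linarith+
  then have "- x \<le> of_int ?k * \<epsilon>" "(of_int ?k - 1) * \<epsilon> < - x"
    unfolding pos_divide_le_eq[OF assms] pos_less_divide_eq[OF assms] .
  then show "0 \<le> x + of_int ?k * \<epsilon>" "x + of_int ?k * \<epsilon> < \<epsilon>" by (simp_all add: algebra_simps)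
qed

text \<open>The value at 0 is arbitrary, as both quadrants contain the axis with the same
  vertices.\<close>

definition dir :: "int \<Rightarrow> int" where "dir k = (if k \<ge> 0 then 1 else - 1)"

lemma signed_index: "i = i0 + dir (i - i0) * int (nat \<bar>i - i0\<bar>)" "dir k \<in> {1, -1}"
  by (auto simp: dir_def)

text \<open>Orients a unit edge away from \<open>i0\<close>, so that every quadrilateral lies in one
  quadrant and is traversed from its vertex nearest the crossing.\<close>

lemma signed_edge:
  obtains \<sigma> m where "\<sigma> \<in> {1, -1 :: int}"
    "(i = i0 + \<sigma> * int m \<and> i + 1 = i0 + \<sigma> * int (Suc m)) \<or> (i + 1 = i0 + \<sigma> * int m \<and> i = i0 + \<sigma> * int (Suc m))"
proof (cases "i \<ge> i0")
  case True
  then show ?thesis by (intro that[of 1 "nat (i - i0)"]) auto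
next
  case False
  then show ?thesis by (intro that[of "-1" "nat (i0 - i - 1)"]) auto
qed

lemma quad_vertices:
  fixes i i1 i2 j j1 j2 :: int
  assumes "(i = i1 \<and> i + 1 = i2) \<or> (i + 1 = i1 \<and> i = i2)" "(j = j1 \<and> j + 1 = j2) \<or> (j + 1 = j1 \<and> j = j2)"
  shows "{g (Q i j), g (Q (i + 1) j), g (Q (i + 1) (j + 1)), g (Q i (j + 1))} =
    {g (Q i1 j1), g (Q i2 j1), g (Q i2 j2), g (Q i1 j2)}"
  using assms by (elim disjE conjE; hypsubst; blast)

context curvature_line_piece
begin

text \<open>The Cauchy data are the grid points on the two grid lines nearest to the coordinate axes, so that
  the dependence rectangles of the grid points of the disk leave the disk by at most \<open>O(\<epsilon>\<^sup>2)\<close>. The grid is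
  contracted by \<open>1 - K' \<epsilon>\<^sup>2\<close> so that, including the displacements, everything stays inside the disk.\<close>

lemma circular_net_parameters:
  "\<exists>C \<epsilon>0. 0 < \<epsilon>0 \<and> (\<forall>\<epsilon>. 0 < \<epsilon> \<longrightarrow> \<epsilon> < \<epsilon>0 \<longrightarrow> (\<exists>Q. circular_net (grid_indices unit_disk p0 \<epsilon>) (\<lambda>i j. g (Q i j)) \<and>
    (\<forall>i j. (i, j) \<in> grid_indices unit_disk p0 \<epsilon> \<longrightarrow> Q i j \<in> ball 0 1 \<and> norm (Q i j - grid_point p0 \<epsilon> i j) \<le> C * \<epsilon>\<^sup>2)))"
proof -
  obtain K e0 where K: "K > 0" and e0: "e0 > 0" and quads: "\<forall>\<epsilon> x0 y0. 0 < \<epsilon> \<longrightarrow> \<epsilon> < e0 \<longrightarrow>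
      (\<forall>\<sigma>\<in>{1,-1}. \<forall>\<tau>\<in>{1,-1}. \<exists>p. quadrant_net H K \<sigma> \<tau> x0 y0 \<epsilon> p)"
    using four_quadrants by (elim exE conjE)
  \<comment> \<open>An edge error is the difference of two vertex displacements, hence nondegeneracy
    for \<open>2 * K\<close>.\<close>
  have "2 * K > 0" using K by simp
  then obtain e1 where e1: "e1 > 0" and ind: "nondegenerate_below (2 * K) e1"
    using edges_independent by blast
  \<comment> \<open>With this choice the contracted points plus displacements stay below
    \<open>1 - \<epsilon>\<^sup>2\<close>: \<open>K\<close> pays for the displacement, one unit for
    the overshoot of dependence rectangles, one for strictness.\<close>
  define K' where "K' = K + 2"
  have K': "K' > 2" using K by (simp add: K'_def)
  define \<epsilon>0 where "\<epsilon>0 = min (min e0 e1) (1 / K')"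
  have \<epsilon>0: "\<epsilon>0 > 0" using e0 e1 K' by (simp add: \<epsilon>0_def)
  \<comment> \<open>\<open>K\<close> for the displacement; contraction moves a grid point by
    \<open>K' * \<epsilon>\<^sup>2\<close> times its norm, which is at most 2.\<close>
  define C where "C = K + 2 * K'"
  have "\<exists>Q. circular_net (grid_indices unit_disk p0 \<epsilon>) (\<lambda>i j. g (Q i j)) \<and>
    (\<forall>i j. (i, j) \<in> grid_indices unit_disk p0 \<epsilon> \<longrightarrow> Q i j \<in> ball 0 1 \<and> norm (Q i j - grid_point p0 \<epsilon> i j) \<le> C * \<epsilon>\<^sup>2)"
    if \<epsilon>: "0 < \<epsilon>" "\<epsilon> < \<epsilon>0" for \<epsilon>
  proof -
    have "1 / K' < 1" using K' by simp
    then have \<epsilon>1: "\<epsilon> < 1" "\<epsilon> < e0" "\<epsilon> < e1" using \<epsilon>(2) by (auto simp: \<epsilon>0_def)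
    have "K' * \<epsilon> < 1" using \<epsilon>(2) K' by (simp add: \<epsilon>0_def field_simps)
    moreover have "K' * \<epsilon>\<^sup>2 \<le> K' * \<epsilon>"
      using \<epsilon> \<epsilon>1 K' by (intro mult_left_mono) (auto simp: power2_eq_square mult_left_le)
    ultimately have K'\<epsilon>: "K' * \<epsilon>\<^sup>2 < 1" by linarith
    define \<kappa> where "\<kappa> = 1 - K' * \<epsilon>\<^sup>2"
    have \<kappa>: "0 < \<kappa>" "\<kappa> \<le> 1" using K'\<epsilon> K' by (auto simp: \<kappa>_def)
    \<comment> \<open>The contracted grid is again a square grid, with mesh \<delta>, so the
      quadrant nets apply to it directly.\<close>
    define \<delta> where "\<delta> = \<kappa> * \<epsilon>"
    have \<delta>: "0 < \<delta>" "\<delta> \<le> \<epsilon>" using \<kappa> \<epsilon> by (auto simp: \<delta>_def mult_left_le_one_le)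
    then have \<delta>\<epsilon>: "K * \<delta>\<^sup>2 \<le> K * \<epsilon>\<^sup>2" using K by (intro mult_left_mono power_mono) auto
    obtain i0 where i0: "0 \<le> fst p0 + of_int i0 * \<epsilon>" "fst p0 + of_int i0 * \<epsilon> < \<epsilon>"
      using nearest_index[OF \<epsilon>(1)] .
    obtain j0 where j0: "0 \<le> snd p0 + of_int j0 * \<epsilon>" "snd p0 + of_int j0 * \<epsilon> < \<epsilon>"
      using nearest_index[OF \<epsilon>(1)] .
    define a0 where "a0 = fst p0 + of_int i0 * \<epsilon>"
    define b0 where "b0 = snd p0 + of_int j0 * \<epsilon>"
    have ab0: "0 \<le> a0" "a0 < \<epsilon>" "0 \<le> b0" "b0 < \<epsilon>" using i0 j0 by (simp_all add: a0_def b0_def)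
    define P where "P \<sigma> \<tau> = (SOME p. quadrant_net H K (real_of_int \<sigma>) (real_of_int \<tau>) (\<kappa> * a0) (\<kappa> * b0) \<delta> p)" for \<sigma> \<tau>
    have P: "quadrant_net H K (real_of_int \<sigma>) (real_of_int \<tau>) (\<kappa> * a0) (\<kappa> * b0) \<delta> (P \<sigma> \<tau>)"
      if "\<sigma> \<in> {1,-1}" "\<tau> \<in> {1,-1}" for \<sigma> \<tau>
    proof -
      have "\<exists>p. quadrant_net H K (real_of_int \<sigma>) (real_of_int \<tau>) (\<kappa> * a0) (\<kappa> * b0) \<delta> p"
        using quads[rule_format, of \<delta> "real_of_int \<sigma>" "real_of_int \<tau>" "\<kappa> * a0" "\<kappa> * b0"] \<delta> \<epsilon>1 that by auto
      from someI_ex[OF this] show ?thesis unfolding P_def .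
    qed
    define Q where "Q i j = P (dir (i - i0)) (dir (j - j0)) (nat \<bar>i - i0\<bar>) (nat \<bar>j - j0\<bar>)" for i j
    have P0: "P \<sigma> \<tau> m 0 = (\<kappa> * a0 + \<sigma> * real m * \<delta>, \<kappa> * b0)" "P \<sigma> \<tau> 0 n = (\<kappa> * a0, \<kappa> * b0 + \<tau> * real n * \<delta>)"
      if "\<sigma> \<in> {1,-1}" "\<tau> \<in> {1,-1}" for \<sigma> \<tau> m n
      by (rule quadrant_net_axes[OF P[OF that]])+
    \<comment> \<open>Gluing: off the axes the signs are determined by the indices, and on an axis
      the prescribed Cauchy data make the undetermined sign irrelevant.\<close>
    have Q_eq: "Q (i0 + \<sigma> * int m) (j0 + \<tau> * int n) = P \<sigma> \<tau> m n" if "\<sigma> \<in> {1,-1}" "\<tau> \<in> {1,-1}" for \<sigma> \<tau> m n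
    proof -
      have dir: "dir (s * int k) = s" if "s \<in> {1,-1}" "k \<noteq> 0" for s k using that by (auto simp: dir_def)
      have abs: "nat \<bar>s * int k\<bar> = k" if "s \<in> {1,-1}" for s k using that by (auto simp: abs_mult)
      have Q: "Q (i0 + \<sigma> * int m) (j0 + \<tau> * int n) = P (dir (\<sigma> * int m)) (dir (\<tau> * int n)) m n"
        using that by (simp add: Q_def abs)
      consider "m \<noteq> 0" "n \<noteq> 0" | "m = 0" | "n = 0" by blast
      then show ?thesis
      proof cases
        case 1
        then show ?thesis using Q dir that by simp
      next
        case 2
        then show ?thesis unfolding Q using P0(2)[OF signed_index(2) signed_index(2)] P0(2)[OF signed_index(2) that(2)] P0(2)[OF that] dir[OF that(2), of n]
          by (cases "n = 0") auto
      next
        case 3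
        then show ?thesis unfolding Q using P0(1)[OF signed_index(2) signed_index(2)] P0(1)[OF that(1) signed_index(2)] P0(1)[OF that] dir[OF that(1), of m]
          by (cases "m = 0") auto
      qed
    qed
    have grid: "grid_point p0 \<epsilon> (i0 + \<sigma> * int m) (j0 + \<tau> * int n) = (a0 + \<sigma> * real m * \<epsilon>, b0 + \<tau> * real n * \<epsilon>)" for \<sigma> \<tau> m n
      by (simp add: grid_point_def a0_def b0_def algebra_simps)
    \<comment> \<open>The downward closure of the indices with grid point in the disk; the grid
      points it adds may lie slightly outside.\<close>
    define J where "J \<sigma> \<tau> = {(m, n). \<exists>m'\<ge>m. \<exists>n'\<ge>n. (a0 + \<sigma> * real m' * \<epsilon>, b0 + \<tau> * real n' * \<epsilon>) \<in> ball 0 1}" for \<sigma> \<tau> :: int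
    have J_bound: "norm (a0 + \<sigma> * real m * \<epsilon>, b0 + \<tau> * real n * \<epsilon>) \<le> 1 + \<epsilon>\<^sup>2"
      if s: "\<sigma> \<in> {1,-1}" "\<tau> \<in> {1,-1}" and mn: "(m, n) \<in> J \<sigma> \<tau>" for \<sigma> \<tau> m n
    proof -
      obtain m' n' where mn': "m \<le> m'" "n \<le> n'" "(a0 + \<sigma> * real m' * \<epsilon>)\<^sup>2 + (b0 + \<tau> * real n' * \<epsilon>)\<^sup>2 < 1"
        using mn by (auto simp: J_def norm_Pair real_sqrt_lt_1_iff)
      have s': "real_of_int \<sigma> \<in> {1,-1}" "real_of_int \<tau> \<in> {1,-1}" using s by auto
      \<comment> \<open>Each coordinate contributes one \<open>\<epsilon>\<^sup>2\<close> of
        overshoot to the squared norm, which becomes a single \<open>\<epsilon>\<^sup>2\<close> for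
        the norm.\<close>
      have "(a0 + \<sigma> * real m * \<epsilon>)\<^sup>2 + (b0 + \<tau> * real n * \<epsilon>)\<^sup>2 \<le> 1 + 2 * \<epsilon>\<^sup>2"
        using axis_distance[OF ab0(1,2) mn'(1) s'(1)] axis_distance[OF ab0(3,4) mn'(2) s'(2)] mn'(3) by linarith
      also have "\<dots> \<le> (1 + \<epsilon>\<^sup>2)\<^sup>2" by (simp add: power2_sum)
      finally show ?thesis unfolding norm_Pair by (intro real_le_lsqrt) auto
    qed
    have scale: "(\<kappa> * a0 + \<sigma> * real m * \<delta>, \<kappa> * b0 + \<tau> * real n * \<delta>) = \<kappa> *\<^sub>R (a0 + \<sigma> * real m * \<epsilon>, b0 + \<tau> * real n * \<epsilon>)"
      for \<sigma> \<tau> :: int and m n by (simp add: \<delta>_def algebra_simps)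
    have contracted: "norm (\<kappa> * a0 + \<sigma> * real m * \<delta>, \<kappa> * b0 + \<tau> * real n * \<delta>) + K * \<delta>\<^sup>2 < 1"
      if "\<sigma> \<in> {1,-1}" "\<tau> \<in> {1,-1}" "(m, n) \<in> J \<sigma> \<tau>" for \<sigma> \<tau> m n
    proof -
      have "norm (\<kappa> * a0 + \<sigma> * real m * \<delta>, \<kappa> * b0 + \<tau> * real n * \<delta>) \<le> \<kappa> * (1 + \<epsilon>\<^sup>2)"
        unfolding scale norm_scaleR using J_bound[OF that] \<kappa> by (simp add: mult_left_mono)
      moreover have "\<kappa> * (1 + \<epsilon>\<^sup>2) + K * \<epsilon>\<^sup>2 = 1 - \<epsilon>\<^sup>2 - K' * (\<epsilon>\<^sup>2 * \<epsilon>\<^sup>2)"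
        by (simp add: \<kappa>_def K'_def algebra_simps)
      moreover have "0 < \<epsilon>\<^sup>2" "0 \<le> K' * (\<epsilon>\<^sup>2 * \<epsilon>\<^sup>2)" using \<epsilon> K' by simp_all
      ultimately show ?thesis using \<delta>\<epsilon> by linarith
    qed
    have steps: "real m * \<delta> \<le> 3" "real n * \<delta> \<le> 3"
      if s: "\<sigma> \<in> {1,-1}" "\<tau> \<in> {1,-1}" and mn: "(m, n) \<in> J \<sigma> \<tau>" for \<sigma> \<tau> m n
    proof -
      have "\<epsilon>\<^sup>2 \<le> 1" using \<epsilon> \<epsilon>1 by (simp add: power_le_one)
      then have "\<bar>a0 + \<sigma> * real m * \<epsilon>\<bar> \<le> 2" "\<bar>b0 + \<tau> * real n * \<epsilon>\<bar> \<le> 2"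
        using J_bound[OF that] norm_fst_le[of "a0 + \<sigma> * real m * \<epsilon>" "b0 + \<tau> * real n * \<epsilon>"]
          norm_snd_le[of "b0 + \<tau> * real n * \<epsilon>" "a0 + \<sigma> * real m * \<epsilon>"]
        unfolding real_norm_def by linarith+
      then have "real m * \<epsilon> \<le> 3" "real n * \<epsilon> \<le> 3" using s ab0 \<epsilon>1 by auto
      moreover have "real m * \<delta> \<le> real m * \<epsilon>" "real n * \<delta> \<le> real n * \<epsilon>" using \<delta> by (simp_all add: mult_left_mono)
      ultimately show "real m * \<delta> \<le> 3" "real n * \<delta> \<le> 3" by linarith+
    qed
    have dom: "goursat_domain K \<sigma> \<tau> (\<kappa> * a0) (\<kappa> * b0) \<delta> (J \<sigma> \<tau>)"
      if "\<sigma> \<in> {1,-1}" "\<tau> \<in> {1,-1}" for \<sigma> \<tau>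
      unfolding goursat_domain_def
    proof (intro conjI allI impI)
      show "(i', j') \<in> J \<sigma> \<tau>" if "(i, j) \<in> J \<sigma> \<tau>" "i' \<le> i" "j' \<le> j" for i j i' j'
        using that unfolding J_def by (auto intro: order_trans)
    qed (use contracted[OF that] steps[OF that] in auto)
    note net = quadrant_netD[OF P dom]
    have near: "norm (P \<sigma> \<tau> m n - (\<kappa> * a0 + \<sigma> * real m * \<delta>, \<kappa> * b0 + \<tau> * real n * \<delta>)) \<le> K * \<delta>\<^sup>2"
      if s: "\<sigma> \<in> {1,-1}" "\<tau> \<in> {1,-1}" and mn: "(m, n) \<in> J \<sigma> \<tau>" for \<sigma> \<tau> m n
      using net(1)[OF s s mn] .
    have coplanar: "lift_coplanar H (P \<sigma> \<tau> m n) (P \<sigma> \<tau> (Suc m) n) (P \<sigma> \<tau> m (Suc n)) (P \<sigma> \<tau> (Suc m) (Suc n))"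
      if s: "\<sigma> \<in> {1,-1}" "\<tau> \<in> {1,-1}" and mn: "(Suc m, Suc n) \<in> J \<sigma> \<tau>" for \<sigma> \<tau> m n
      using net(2)[OF s s mn] .
    have inside: "P \<sigma> \<tau> m n \<in> ball 0 1" if s: "\<sigma> \<in> {1,-1}" "\<tau> \<in> {1,-1}" and mn: "(m, n) \<in> J \<sigma> \<tau>" for \<sigma> \<tau> m n
      using near[OF that] contracted[OF that]
        norm_triangle_sub[of "P \<sigma> \<tau> m n" "(\<kappa> * a0 + \<sigma> * real m * \<delta>, \<kappa> * b0 + \<tau> * real n * \<delta>)"]
      unfolding mem_ball_0 by linarith
    have close: "norm (P \<sigma> \<tau> m n - (a0 + \<sigma> * real m * \<epsilon>, b0 + \<tau> * real n * \<epsilon>)) \<le> C * \<epsilon>\<^sup>2"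
      if s: "\<sigma> \<in> {1,-1}" "\<tau> \<in> {1,-1}" and mn: "(m, n) \<in> J \<sigma> \<tau>" for \<sigma> \<tau> m n
    proof -
      let ?G = "(a0 + \<sigma> * real m * \<epsilon>, b0 + \<tau> * real n * \<epsilon>)"
      have "norm (\<kappa> *\<^sub>R ?G - ?G) = norm ((- (K' * \<epsilon>\<^sup>2)) *\<^sub>R ?G)"
        by (simp add: \<kappa>_def algebra_simps)
      also have "\<dots> = K' * \<epsilon>\<^sup>2 * norm ?G" unfolding norm_scaleR using K' by simp
      also have "\<dots> \<le> K' * \<epsilon>\<^sup>2 * 2"
      proof (rule mult_left_mono)
        have "\<epsilon>\<^sup>2 \<le> 1" using \<epsilon> \<epsilon>1 by (simp add: power_le_one)
        then show "norm ?G \<le> 2" using J_bound[OF that] by linarith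
      qed (use K' in simp)
      finally have "norm (\<kappa> *\<^sub>R ?G - ?G) \<le> 2 * K' * \<epsilon>\<^sup>2" by simp
      moreover have "norm (P \<sigma> \<tau> m n - \<kappa> *\<^sub>R ?G) \<le> K * \<epsilon>\<^sup>2"
        using near[OF that] \<delta>\<epsilon> unfolding scale by linarith
      moreover have "norm (P \<sigma> \<tau> m n - ?G) \<le> norm (P \<sigma> \<tau> m n - \<kappa> *\<^sub>R ?G) + norm (\<kappa> *\<^sub>R ?G - ?G)"
        using dist_triangle[of "P \<sigma> \<tau> m n" ?G "\<kappa> *\<^sub>R ?G"] unfolding dist_norm .
      ultimately show ?thesis unfolding C_def by (simp add: algebra_simps)
    qed
    have in_J: "(m, n) \<in> J \<sigma> \<tau>" if "(i0 + \<sigma> * int m, j0 + \<tau> * int n) \<in> grid_indices unit_disk p0 \<epsilon>" for \<sigma> \<tau> m n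
      using that by (auto simp: grid_indices_def grid J_def unit_disk_eq_ball)
    have pts: "Q i j \<in> ball 0 1 \<and> norm (Q i j - grid_point p0 \<epsilon> i j) \<le> C * \<epsilon>\<^sup>2"
      if ij: "(i, j) \<in> grid_indices unit_disk p0 \<epsilon>" for i j
    proof -
      obtain \<sigma> \<tau> m n where s: "\<sigma> \<in> {1,-1}" "\<tau> \<in> {1,-1}" and i: "i = i0 + \<sigma> * int m" "j = j0 + \<tau> * int n"
        using signed_index by blast
      have "(m, n) \<in> J \<sigma> \<tau>" using in_J ij unfolding i .
      then show ?thesis unfolding i Q_eq[OF s] grid using inside[OF s] close[OF s] by blast
    qed
    have "circular_net (grid_indices unit_disk p0 \<epsilon>) (\<lambda>i j. g (Q i j))"
      unfolding circular_net_def
    proof (intro allI impI)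
      fix i j assume sub: "{(i, j), (i + 1, j), (i + 1, j + 1), (i, j + 1)} \<subseteq> grid_indices unit_disk p0 \<epsilon>"
      obtain \<sigma> m where \<sigma>: "\<sigma> \<in> {1,-1}" and i: "(i = i0 + \<sigma> * int m \<and> i + 1 = i0 + \<sigma> * int (Suc m)) \<or>
          (i + 1 = i0 + \<sigma> * int m \<and> i = i0 + \<sigma> * int (Suc m))" using signed_edge .
      obtain \<tau> n where \<tau>: "\<tau> \<in> {1,-1}" and j: "(j = j0 + \<tau> * int n \<and> j + 1 = j0 + \<tau> * int (Suc n)) \<or>
          (j + 1 = j0 + \<tau> * int n \<and> j = j0 + \<tau> * int (Suc n))" using signed_edge .
      have "(i0 + \<sigma> * int (Suc m), j0 + \<tau> * int (Suc n)) \<in> grid_indices unit_disk p0 \<epsilon>"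
        using sub i j by auto
      then have J11: "(Suc m, Suc n) \<in> J \<sigma> \<tau>" by (rule in_J)
      have JJ: "(m, n) \<in> J \<sigma> \<tau>" "(Suc m, n) \<in> J \<sigma> \<tau>" "(m, Suc n) \<in> J \<sigma> \<tau>"
        using J11 unfolding J_def by (auto dest: Suc_leD)
      let ?p = "P \<sigma> \<tau>"
      have diff: "norm (?p (Suc m) n - ?p m n - (real_of_int \<sigma> * \<delta>, 0)) \<le> (2 * K) * \<delta>\<^sup>2"
        "norm (?p m (Suc n) - ?p m n - (0, real_of_int \<tau> * \<delta>)) \<le> (2 * K) * \<delta>\<^sup>2"
      proof -
        have A: "norm ((?p (Suc m) n - (\<kappa> * a0 + \<sigma> * real (Suc m) * \<delta>, \<kappa> * b0 + \<tau> * real n * \<delta>))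
            - (?p m n - (\<kappa> * a0 + \<sigma> * real m * \<delta>, \<kappa> * b0 + \<tau> * real n * \<delta>))) \<le> K * \<delta>\<^sup>2 + K * \<delta>\<^sup>2"
          "norm ((?p m (Suc n) - (\<kappa> * a0 + \<sigma> * real m * \<delta>, \<kappa> * b0 + \<tau> * real (Suc n) * \<delta>))
            - (?p m n - (\<kappa> * a0 + \<sigma> * real m * \<delta>, \<kappa> * b0 + \<tau> * real n * \<delta>))) \<le> K * \<delta>\<^sup>2 + K * \<delta>\<^sup>2"
          by (intro norm_diff_mono near \<sigma> \<tau> JJ)+
        have E1: "(?p (Suc m) n - (\<kappa> * a0 + \<sigma> * real (Suc m) * \<delta>, \<kappa> * b0 + \<tau> * real n * \<delta>))
            - (?p m n - (\<kappa> * a0 + \<sigma> * real m * \<delta>, \<kappa> * b0 + \<tau> * real n * \<delta>))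
            = ?p (Suc m) n - ?p m n - (real_of_int \<sigma> * \<delta>, 0)"
          and E2: "(?p m (Suc n) - (\<kappa> * a0 + \<sigma> * real m * \<delta>, \<kappa> * b0 + \<tau> * real (Suc n) * \<delta>))
            - (?p m n - (\<kappa> * a0 + \<sigma> * real m * \<delta>, \<kappa> * b0 + \<tau> * real n * \<delta>))
            = ?p m (Suc n) - ?p m n - (0, real_of_int \<tau> * \<delta>)"
          by (simp_all add: prod_eq_iff algebra_simps)
        show "norm (?p (Suc m) n - ?p m n - (real_of_int \<sigma> * \<delta>, 0)) \<le> (2 * K) * \<delta>\<^sup>2"
          "norm (?p m (Suc n) - ?p m n - (0, real_of_int \<tau> * \<delta>)) \<le> (2 * K) * \<delta>\<^sup>2"
          using A(1)[unfolded E1] A(2)[unfolded E2] by simp_all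
      qed
      have "\<exists>c. is_circle c \<and> {g (?p m n), g (?p (Suc m) n), g (?p (Suc m) (Suc n)), g (?p m (Suc n))} \<subseteq> c"
      proof (rule circle_through_lift_coplanar[OF coplanar[OF \<sigma> \<tau> J11]])
        have \<sigma>': "\<bar>real_of_int \<sigma>\<bar> = 1" "\<bar>real_of_int \<tau>\<bar> = 1" "\<delta> < e1" using \<sigma> \<tau> \<delta>(2) \<epsilon>1(3) by auto
        fix s t assume "s *\<^sub>R (g (?p (Suc m) n) - g (?p m n)) + t *\<^sub>R (g (?p m (Suc n)) - g (?p m n)) = 0"
        from ind[unfolded nondegenerate_below_def, rule_format, OF \<delta>(1) \<sigma>'(3,1,2) inside[OF \<sigma> \<tau> JJ(1)]
            inside[OF \<sigma> \<tau> JJ(2)] inside[OF \<sigma> \<tau> JJ(3)] diff this]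
        show "s = 0 \<and> t = 0" .
      qed
      then have "\<exists>c. is_circle c \<and> {g (Q (i0 + \<sigma> * int m) (j0 + \<tau> * int n)), g (Q (i0 + \<sigma> * int (Suc m)) (j0 + \<tau> * int n)),
          g (Q (i0 + \<sigma> * int (Suc m)) (j0 + \<tau> * int (Suc n))), g (Q (i0 + \<sigma> * int m) (j0 + \<tau> * int (Suc n)))} \<subseteq> c"
        unfolding Q_eq[OF \<sigma> \<tau>] .
      moreover have "{g (Q i j), g (Q (i + 1) j), g (Q (i + 1) (j + 1)), g (Q i (j + 1))} =
          {g (Q (i0 + \<sigma> * int m) (j0 + \<tau> * int n)), g (Q (i0 + \<sigma> * int (Suc m)) (j0 + \<tau> * int n)),
          g (Q (i0 + \<sigma> * int (Suc m)) (j0 + \<tau> * int (Suc n))), g (Q (i0 + \<sigma> * int m) (j0 + \<tau> * int (Suc n)))}"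
        using i j by (rule quad_vertices)
      ultimately show "\<exists>C. is_circle C \<and> {g (Q i j), g (Q (i + 1) j), g (Q (i + 1) (j + 1)), g (Q i (j + 1))} \<subseteq> C"
        by simp
    qed
    then show ?thesis using pts by blast
  qed
  then show ?thesis using \<epsilon>0 by blast
qed

end

text \<open>Compactness gives a uniform distance \<open>e\<close> from the disk to the complement of
  \<open>U\<close>; a point of the larger disk outside the unit disk is within \<open>e\<close> of
  its radial projection to the unit circle.\<close>

lemma compact_disk_enlarge:
  fixes U :: "(real \<times> real) set"
  assumes "open U" "cball 0 1 \<subseteq> U"
  obtains \<rho> where "\<rho> > 1" "cball 0 \<rho> \<subseteq> U"
proof -
  obtain e where e: "e > 0" "(\<Union>x\<in>cball 0 1. cball x e) \<subseteq> U"
    using compact_subset_open_imp_cball_epsilon_subset[OF compact_cball assms] .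
  have "x \<in> U" if x: "norm x \<le> 1 + e" for x
  proof (cases "norm x \<le> 1")
    case False
    let ?y = "x /\<^sub>R norm x"
    have nx: "norm x \<noteq> 0" using False by linarith
    then have "norm ?y = 1" by simp
    moreover have "dist ?y x = norm x - 1"
    proof -
      have "?y - x = (inverse (norm x) - 1) *\<^sub>R x" by (simp add: algebra_simps)
      then have "dist ?y x = \<bar>inverse (norm x) - 1\<bar> * norm x" by (simp add: dist_norm)
      also have "\<dots> = \<bar>(inverse (norm x) - 1) * norm x\<bar>" by (simp add: abs_mult)
      also have "(inverse (norm x) - 1) * norm x = 1 - norm x" using nx by (simp add: algebra_simps)
      finally show ?thesis using False by simp
    qed
    ultimately have "?y \<in> cball 0 1" "x \<in> cball ?y e" using x by auto
    then show ?thesis using e(2) by blast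
  qed (use assms in auto)
  then show ?thesis using e(1) by (intro that[of "1 + e"]) auto
qed

theorem theorem15:
  fixes f :: "real \<times> real \<Rightarrow> real^3" and u0 v0 :: real
  assumes "finite_curvature_line_piece f unit_disk"
    and "(u0, v0) \<in> unit_disk"
  shows "\<exists>(F :: real \<Rightarrow> int \<Rightarrow> int \<Rightarrow> real^3) (C :: real) (\<epsilon>0 :: real). \<epsilon>0 > 0 \<and>
    (\<forall>\<epsilon>. 0 < \<epsilon> \<and> \<epsilon> < \<epsilon>0 \<longrightarrow>
       circular_net (grid_indices unit_disk (u0, v0) \<epsilon>) (F \<epsilon>) \<and>
       (\<forall>(i, j) \<in> grid_indices unit_disk (u0, v0) \<epsilon>.
          F \<epsilon> i j \<in> f ` unit_disk \<and>
          dist (f (grid_point (u0, v0) \<epsilon> i j)) (F \<epsilon> i j) \<le> C * \<epsilon>\<^sup>2))"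
proof -
  have cl: "closure unit_disk = cball 0 1" by (simp add: unit_disk_eq_ball)
  obtain g U where g: "open U" "cball 0 1 \<subseteq> U" "smooth_on g U" "\<And>p. p \<in> ball 0 1 \<Longrightarrow> g p = f p"
    "immersion_on g (cball 0 1)" "curvature_line_parametrized_on g (cball 0 1)"
    "\<And>p. p \<in> cball 0 1 \<Longrightarrow> \<not> umbilic g p"
    using assms(1) unfolding finite_curvature_line_piece_def cl by (auto simp: unit_disk_eq_ball)
  obtain \<rho> where \<rho>: "\<rho> > 1" "cball 0 \<rho> \<subseteq> U" using compact_disk_enlarge[OF g(1,2)] .
  interpret curvature_line_piece g U \<rho>
    using g \<rho> by unfold_locales auto
  obtain L where L: "L > 0" "\<And>p q. p \<in> cball 0 1 \<Longrightarrow> q \<in> cball 0 1 \<Longrightarrow> norm (g p - g q) \<le> L * norm (p - q)"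
    using smooth_on_lipschitz[OF smooth compact_cball convex_cball disk_U] by blast
  obtain C \<epsilon>0 where \<epsilon>0: "0 < \<epsilon>0" and ex: "\<forall>\<epsilon>. 0 < \<epsilon> \<and> \<epsilon> < \<epsilon>0 \<longrightarrow>
      (\<exists>Q. circular_net (grid_indices unit_disk (u0, v0) \<epsilon>) (\<lambda>i j. g (Q i j)) \<and>
    (\<forall>i j. (i, j) \<in> grid_indices unit_disk (u0, v0) \<epsilon> \<longrightarrow> Q i j \<in> ball 0 1 \<and> norm (Q i j - grid_point (u0, v0) \<epsilon> i j) \<le> C * \<epsilon>\<^sup>2))"
    using circular_net_parameters[of "(u0, v0)"] by blast
  then obtain Q where Q: "\<And>\<epsilon>. 0 < \<epsilon> \<and> \<epsilon> < \<epsilon>0 \<Longrightarrow> circular_net (grid_indices unit_disk (u0, v0) \<epsilon>) (\<lambda>i j. g (Q \<epsilon> i j)) \<and>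
    (\<forall>i j. (i, j) \<in> grid_indices unit_disk (u0, v0) \<epsilon> \<longrightarrow> Q \<epsilon> i j \<in> ball 0 1 \<and> norm (Q \<epsilon> i j - grid_point (u0, v0) \<epsilon> i j) \<le> C * \<epsilon>\<^sup>2)"
    by metis
  show ?thesis
  proof (rule exI[of _ "\<lambda>\<epsilon> i j. g (Q \<epsilon> i j)"], rule exI[of _ "L * C"], rule exI[of _ \<epsilon>0], intro conjI allI impI ballI)
    fix \<epsilon> assume \<epsilon>: "0 < \<epsilon> \<and> \<epsilon> < \<epsilon>0"
    show "circular_net (grid_indices unit_disk (u0, v0) \<epsilon>) (\<lambda>i j. g (Q \<epsilon> i j))" using Q[OF \<epsilon>] by blast
    fix z assume z: "z \<in> grid_indices unit_disk (u0, v0) \<epsilon>"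
    obtain i j where ij: "z = (i, j)" by fastforce
    let ?P = "grid_point (u0, v0) \<epsilon> i j"
    have q: "Q \<epsilon> i j \<in> ball 0 1" "norm (Q \<epsilon> i j - ?P) \<le> C * \<epsilon>\<^sup>2" using Q[OF \<epsilon>] z ij by blast+
    have P: "?P \<in> ball 0 1" using z ij by (simp add: grid_indices_def unit_disk_eq_ball)
    \<comment> \<open>The extension agrees with \<open>f\<close> on the open disk only, so the
      parameters have to lie strictly inside it; the contraction of the grid secures this.\<close>
    have "g (Q \<epsilon> i j) \<in> f ` unit_disk" using q(1) g(4) by (auto simp: unit_disk_eq_ball)
    moreover have "dist (f ?P) (g (Q \<epsilon> i j)) \<le> L * C * \<epsilon>\<^sup>2"
    proof -
      have "dist (f ?P) (g (Q \<epsilon> i j)) = norm (g (Q \<epsilon> i j) - g ?P)"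
        using g(4)[OF P] by (simp add: dist_norm norm_minus_commute)
      also have "\<dots> \<le> L * norm (Q \<epsilon> i j - ?P)" using q(1) P by (intro L(2)) auto
      also have "\<dots> \<le> L * (C * \<epsilon>\<^sup>2)" using q(2) L(1) by (intro mult_left_mono) auto
      finally show ?thesis by simp
    qed
    ultimately show "case z of (i, j) \<Rightarrow> g (Q \<epsilon> i j) \<in> f ` unit_disk \<and>
          dist (f (grid_point (u0, v0) \<epsilon> i j)) (g (Q \<epsilon> i j)) \<le> L * C * \<epsilon>\<^sup>2"
      by (simp add: ij)
  qed (rule \<epsilon>0)
qed

end
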